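(* Let $c\in\mathbb{R}[x,y]$ and let $f$ have polynomial entries in $(t,x)$. Suppose $T$ is finite and the basic semialgebraic sets $X_0$, $X$, $X_u$ are all Archimedean. Let $p^*$ be the optimal value of the measure program $$\begin{aligned} p^*=\inf\ & \langle c(x,y),\eta\rangle\\ \text{s.t. } & \pi^x_\#\eta=\pi^x_\#\mu_p,\quad \mu_p=\delta_0\otimes\mu_0+\mathcal{L}_f^\dagger\mu,\quad \langle 1,\mu_0\rangle=1,\\ & \mu_0\in\mathcal{M}_+(X_0),\ \eta\in\mathcal{M}_+(X\times X_u),\ \mu_p,\mu\in\mathcal{M}_+([0,T]\times X),\end{aligned}$$ and let $p^*_d$ be the optimal value of its degree-$d$ LMI relaxation (defined in the context). Then the sequence of lower bounds $p^*_d\le p^*_{d+1}\le p^*_{d+2}\le\cdots$ approaches $p^*$ as $d\to\infty$, i.e. $\lim_{d\to\infty}p^*_d=p^*$.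
   Context: **Measure program.** $X_0\subset X\subset\mathbb{R}^n$, $X_u\subset X$. $\mathcal{M}_+(S)$ is the set of nonnegative Borel measures on $S$, $\langle h,\nu\rangle=\int h\,d\nu$, $\pi^x_\#\nu$ is the $x$-marginal of $\nu$, $\mathcal{L}_f v=\partial_t v+f\cdot\nabla_x v$, and $\mu_p=\delta_0\otimes\mu_0+\mathcal{L}_f^\dagger\mu$ means $\langle v(t,x),\mu_p\rangle=\langle v(0,x),\mu_0\rangle+\langle\mathcal{L}_f v(t,x),\mu\rangle$ for all continuously differentiable $v$ on (a neighbourhood of) $[0,T]\times X$. **Sets.** $X_0=\{x\mid g^0_k(x)\ge0,\ k=1,\dots,N_0\}$, $X=\{x\mid g^X_k(x)\ge0,\ k=1,\dots,N_X\}$, $X_u=\{x\mid g^U_k(x)\ge0,\ k=1,\dots,N_U\}$ with polynomial $g$'s. The set $[0,T]$ is described by $t(T-t)\ge0$, and products are described by the union of the constraints of the factors. A set $\mathbb{K}=\{x\mid g_i(x)\ge0,\ i=1,\dots,N_c\}$ is Archimedean if there is $R\ge0$ such that $R-\|x\|_2^2$ belongs to the quadratic module $\{\sigma_0+\sum_i\sigma_i g_i:\ \sigma_0,\dots,\sigma_{N_c}\text{ sums of squares of polynomials}\}$. **Moment matrices.** For a real sequence $\mathbf{m}=(\mathbf{m}_\alpha)$ indexed by multi-indices, and a basic semialgebraic set $\mathbb{K}=\{x\mid g_k(x)\ge0,\ k=1,\dots,N_c\}$ with polynomials $g_k(x)=\sum_\sigma g_{k\sigma}x^\sigma$, $\mathbb{M}_d(\mathbb{K}\mathbf{m})$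 is the block-diagonal matrix with blocks $[\mathbf{m}_{\alpha+\theta}]_{|\alpha|,|\theta|\le d}$ and, for each $k=1,\dots,N_c$, $[\sum_\sigma g_{k\sigma}\mathbf{m}_{\alpha+\theta+\sigma}]_{|\alpha|,|\theta|\le d-\lceil\deg g_k/2\rceil}$. **LMI relaxation.** Write $c(x,y)=\sum_{\alpha,\gamma}c_{\alpha\gamma}x^\alpha y^\gamma$ and $\tilde d=d+\lceil\deg(f)/2\rceil-1$. The variables are real (pseudo-)moment sequences $\mathbf{m}^0$ (indexed by monomials $x^\alpha$), $\mathbf{m}^p$ and $\mathbf{m}$ (indexed by monomials $x^\alpha t^\beta$), $\mathbf{m}^\eta$ (indexed by monomials $x^\alpha y^\gamma$). For $d$ large enough that all terms are defined (in particular $2d\ge\deg c$), $$\begin{aligned} p^*_d=\min\ & \textstyle\sum_{\alpha,\gamma}c_{\alpha\gamma}\mathbf{m}^\eta_{\alpha\gamma}\\ \text{s.t. } & \mathbf{m}^\eta_{\alpha0}=\mathbf{m}^p_{\alpha0}\quad \forall\alpha\in\mathbb{N}^n,\ |\alpha|\le2d,\\ & \mathrm{Liou}_{\alpha\beta}(\mathbf{m}^0,\mathbf{m}^p,\mathbf{m})=0\quad\forall(\alpha,\beta)\in\mathbb{N}^{n+1},\ |\alpha|+\beta\le2d,\\ & \mathbf{m}^0_0=1,\\ & \mathbb{M}_d(X_0\,\mathbf{m}^0)\succeq0,\quad \mathbb{M}_d(([0,T]\times X)\,\mathbf{m}^p)\succeq0,\\ & \mathbb{M}_{\tilde d}(([0,T]\times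 X)\,\mathbf{m})\succeq0,\quad \mathbb{M}_d((X\times X_u)\,\mathbf{m}^\eta)\succeq0.\end{aligned}$$ Here $\mathrm{Liou}_{\alpha\beta}=0$ is the linear relation in moments obtained from $\langle x^\alpha,\mu_0\rangle\delta_{\beta0}+\langle\mathcal{L}_f(x^\alpha t^\beta),\mu\rangle-\langle x^\alpha t^\beta,\mu_p\rangle=0$ by replacing each monomial integral by the corresponding entry of $\mathbf{m}^0$, $\mathbf{m}$, $\mathbf{m}^p$ ($\delta_{\beta0}$ is the Kronecker delta). *)

theory Defs
  imports "HOL-Analysis.Analysis" "HOL-Library.Poly_Mapping"
begin

section \<open>Polynomials in finitely many variables\<close>

text \<open>Multi-indices over a finite type of variables are vectors of naturals; polynomials are finitely
  supported coefficient maps, with the ring structure of \<^theory>\<open>HOL-Library.Poly_Mapping\<close>.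
  The polynomial ring in \<open>(x,t)\<close> has variable type \<^typ>\<open>'n + 1\<close>, the one in \<open>(x,y)\<close> has
  variable type \<^typ>\<open>'n + 'n\<close>.\<close>

type_synonym 'v mpoly = "(nat ^ 'v) \<Rightarrow>\<^sub>0 real"

definition join :: "'a ^ 'm::finite \<Rightarrow> 'a ^ 'n::finite \<Rightarrow> 'a ^ ('m + 'n)" where
  "join u w = (\<chi> k. case k of Inl i \<Rightarrow> u $ i | Inr j \<Rightarrow> w $ j)"

definition mdeg :: "nat ^ 'v::finite \<Rightarrow> nat" where
  "mdeg \<alpha> = (\<Sum>i\<in>UNIV. \<alpha> $ i)"

definition monomial :: "nat ^ 'v::finite \<Rightarrow> 'v mpoly" where
  "monomial \<alpha> = Poly_Mapping.single \<alpha> 1"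

definition pconst :: "real \<Rightarrow> 'v::finite mpoly" where
  "pconst a = Poly_Mapping.single 0 a"

definition pvar :: "'v::finite \<Rightarrow> 'v mpoly" where
  "pvar i = monomial (axis i 1)"

text \<open>The zero polynomial gets degree 0.\<close>

definition pdeg :: "'v::finite mpoly \<Rightarrow> nat" where
  "pdeg p = Max (insert 0 (mdeg ` Poly_Mapping.keys p))"

definition half_deg :: "nat \<Rightarrow> nat" where
  "half_deg k = nat \<lceil>real k / 2\<rceil>"

definition peval :: "'v::finite mpoly \<Rightarrow> real ^ 'v \<Rightarrow> real" where
  "peval p x = (\<Sum>\<alpha>\<in>Poly_Mapping.keys p. Poly_Mapping.lookup p \<alpha> * (\<Prod>i\<in>UNIV. (x $ i) ^ (\<alpha> $ i)))"

definition ppartial :: "'v::finite \<Rightarrow> 'v mpoly \<Rightarrow> 'v mpoly" where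
  "ppartial i p = (\<Sum>\<alpha>\<in>Poly_Mapping.keys p.
     Poly_Mapping.single (\<alpha> - axis i 1) (of_nat (\<alpha> $ i) * Poly_Mapping.lookup p \<alpha>))"

definition embed_left :: "'m::finite mpoly \<Rightarrow> ('m + 'n::finite) mpoly" where
  "embed_left p = (\<Sum>\<alpha>\<in>Poly_Mapping.keys p. Poly_Mapping.single (join \<alpha> 0) (Poly_Mapping.lookup p \<alpha>))"

definition embed_right :: "'n::finite mpoly \<Rightarrow> ('m::finite + 'n) mpoly" where
  "embed_right p = (\<Sum>\<alpha>\<in>Poly_Mapping.keys p. Poly_Mapping.single (join 0 \<alpha>) (Poly_Mapping.lookup p \<alpha>))"


section \<open>Basic semialgebraic descriptions\<close>

text \<open>A description is the list of its constraint polynomials \<open>g\<close>, read as \<open>g \<ge> 0\<close>. Being Archimedean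
  is a property of the description, not only of the set.\<close>

definition semialg :: "'v::finite mpoly list \<Rightarrow> (real ^ 'v) set" where
  "semialg gs = {x. \<forall>g\<in>set gs. 0 \<le> peval g x}"

definition sos :: "'v::finite mpoly \<Rightarrow> bool" where
  "sos p \<longleftrightarrow> (\<exists>qs. p = (\<Sum>q\<leftarrow>qs. q * q))"

definition quadratic_module :: "'v::finite mpoly list \<Rightarrow> 'v mpoly set" where
  "quadratic_module gs =
     {\<sigma>\<^sub>0 + (\<Sum>i<length gs. \<sigma> i * gs ! i) | \<sigma>\<^sub>0 \<sigma>. sos \<sigma>\<^sub>0 \<and> (\<forall>i<length gs. sos (\<sigma> i))}"

definition archimedean_description :: "'v::finite mpoly list \<Rightarrow> bool" where
  "archimedean_description gs \<longleftrightarrow>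
     (\<exists>R\<ge>0. pconst R - (\<Sum>i\<in>UNIV. pvar i * pvar i) \<in> quadratic_module gs)"

definition prod_description :: "'m::finite mpoly list \<Rightarrow> 'n::finite mpoly list \<Rightarrow> ('m + 'n) mpoly list" where
  "prod_description gs hs = map embed_left gs @ map embed_right hs"

text \<open>The set \<open>[0,T] \<times> X\<close> is described in the coordinate order \<open>(x,t)\<close> of the monomials
  \<open>x\<^sup>\<alpha> t\<^sup>\<beta>\<close>, whereas the measures below live on pairs \<open>(t,x)\<close>.\<close>

definition time_description :: "real \<Rightarrow> 1 mpoly list" where
  "time_description T = [pvar 1 * (pconst T - pvar 1)]"


section \<open>The measure program\<close>

text \<open>Finiteness is what makes the pairing with every continuous function on a compact set meaningful
  (the Bochner integral of a non-integrable function is 0).\<close>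

definition nonneg_measures :: "'a::topological_space set \<Rightarrow> 'a measure set" where
  "nonneg_measures S = {\<nu>. sets \<nu> = sets (restrict_space borel S) \<and> finite_measure \<nu>}"

definition C1_on :: "'a::real_normed_vector set \<Rightarrow> ('a \<Rightarrow> real) \<Rightarrow> bool" where
  "C1_on U v \<longleftrightarrow> (\<exists>v' :: 'a \<Rightarrow> 'a \<Rightarrow>\<^sub>L real.
     (\<forall>z\<in>U. (v has_derivative blinfun_apply (v' z)) (at z)) \<and> continuous_on U v')"

definition gradient :: "(real ^ 'n::finite \<Rightarrow> real) \<Rightarrow> real ^ 'n \<Rightarrow> real ^ 'n" where
  "gradient h x = (\<chi> i. frechet_derivative h (at x) (axis i 1))"

definition lie_derivative ::
    "(real \<Rightarrow> real ^ 'n::finite \<Rightarrow> real ^ 'n) \<Rightarrow> (real \<times> (real ^ 'n) \<Rightarrow> real) \<Rightarrow> real \<times> (real ^ 'n) \<Rightarrow> real" where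
  "lie_derivative F v = (\<lambda>(t, x). deriv (\<lambda>s. v (s, x)) t + F t x \<bullet> gradient (\<lambda>\<xi>. v (t, \<xi>)) x)"

definition liouville ::
    "real \<Rightarrow> (real \<Rightarrow> real ^ 'n::finite \<Rightarrow> real ^ 'n) \<Rightarrow> (real ^ 'n) set \<Rightarrow>
     (real ^ 'n) measure \<Rightarrow> (real \<times> (real ^ 'n)) measure \<Rightarrow> (real \<times> (real ^ 'n)) measure \<Rightarrow> bool" where
  "liouville T F X \<mu>\<^sub>0 \<mu>\<^sub>p \<mu> \<longleftrightarrow>
     (\<forall>U v. open U \<longrightarrow> {0..T} \<times> X \<subseteq> U \<longrightarrow> C1_on U v \<longrightarrow>
        integral\<^sup>L \<mu>\<^sub>p v = (\<integral>x. v (0, x) \<partial>\<mu>\<^sub>0) + integral\<^sup>L \<mu> (lie_derivative F v))"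

definition measure_feasible ::
    "real \<Rightarrow> (real \<Rightarrow> real ^ 'n::finite \<Rightarrow> real ^ 'n) \<Rightarrow> (real ^ 'n) set \<Rightarrow> (real ^ 'n) set \<Rightarrow> (real ^ 'n) set \<Rightarrow>
     (real ^ 'n) measure \<Rightarrow> (real \<times> (real ^ 'n)) measure \<Rightarrow> (real \<times> (real ^ 'n)) measure \<Rightarrow>
     ((real ^ 'n) \<times> (real ^ 'n)) measure \<Rightarrow> bool" where
  "measure_feasible T F X\<^sub>0 X X\<^sub>u \<mu>\<^sub>0 \<mu>\<^sub>p \<mu> \<eta> \<longleftrightarrow>
     distr \<eta> borel fst = distr \<mu>\<^sub>p borel snd \<and>
     liouville T F X \<mu>\<^sub>0 \<mu>\<^sub>p \<mu> \<and>
     (\<integral>x. 1 \<partial>\<mu>\<^sub>0) = (1::real) \<and>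
     \<mu>\<^sub>0 \<in> nonneg_measures X\<^sub>0 \<and> \<eta> \<in> nonneg_measures (X \<times> X\<^sub>u) \<and>
     \<mu>\<^sub>p \<in> nonneg_measures ({0..T} \<times> X) \<and> \<mu> \<in> nonneg_measures ({0..T} \<times> X)"

definition measure_value ::
    "real \<Rightarrow> (real ^ 'n::finite \<Rightarrow> real ^ 'n \<Rightarrow> real) \<Rightarrow> (real \<Rightarrow> real ^ 'n \<Rightarrow> real ^ 'n) \<Rightarrow>
     (real ^ 'n) set \<Rightarrow> (real ^ 'n) set \<Rightarrow> (real ^ 'n) set \<Rightarrow> ereal" where
  "measure_value T c F X\<^sub>0 X X\<^sub>u =
     Inf {ereal (\<integral>(x, y). c x y \<partial>\<eta>) | \<mu>\<^sub>0 \<mu>\<^sub>p \<mu> \<eta>. measure_feasible T F X\<^sub>0 X X\<^sub>u \<mu>\<^sub>0 \<mu>\<^sub>p \<mu> \<eta>}"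


section \<open>The moment relaxation\<close>

text \<open>Replacing each monomial of a polynomial by the corresponding entry of a moment sequence.\<close>

definition riesz :: "(nat ^ 'v::finite \<Rightarrow> real) \<Rightarrow> 'v mpoly \<Rightarrow> real" where
  "riesz m p = (\<Sum>\<alpha>\<in>Poly_Mapping.keys p. Poly_Mapping.lookup p \<alpha> * m \<alpha>)"

text \<open>Rows and columns of the block-diagonal matrix \<open>M\<^sub>d(K m)\<close> are pairs of a block number and a
  multi-index. Block 0 belongs to the constraint \<open>1 \<ge> 0\<close>, which yields the plain moment matrix
  \<open>[m(\<alpha>+\<theta>)]\<close>. The bound \<open>|\<alpha>| \<le> d - \<lceil>deg g / 2\<rceil>\<close> is written without subtraction.\<close>

definition moment_index :: "nat \<Rightarrow> 'v::finite mpoly list \<Rightarrow> (nat \<times> (nat ^ 'v)) set" where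
  "moment_index d gs =
     {(k, \<alpha>). k \<le> length gs \<and> mdeg \<alpha> + half_deg (pdeg ((1 # gs) ! k)) \<le> d}"

definition moment_matrix ::
    "'v::finite mpoly list \<Rightarrow> (nat ^ 'v \<Rightarrow> real) \<Rightarrow> nat \<times> (nat ^ 'v) \<Rightarrow> nat \<times> (nat ^ 'v) \<Rightarrow> real" where
  "moment_matrix gs m = (\<lambda>(k, \<alpha>) (l, \<theta>).
     if k = l
     then \<Sum>\<sigma>\<in>Poly_Mapping.keys ((1 # gs) ! k). Poly_Mapping.lookup ((1 # gs) ! k) \<sigma> * m (\<alpha> + \<theta> + \<sigma>)
     else 0)"

definition psd_on :: "'i set \<Rightarrow> ('i \<Rightarrow> 'i \<Rightarrow> real) \<Rightarrow> bool" where
  "psd_on I M \<longleftrightarrow> (\<forall>i\<in>I. \<forall>j\<in>I. M i j = M j i) \<and>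
     (\<forall>w. 0 \<le> (\<Sum>i\<in>I. \<Sum>j\<in>I. w i * M i j * w j))"

definition moment_psd :: "nat \<Rightarrow> 'v::finite mpoly list \<Rightarrow> (nat ^ 'v \<Rightarrow> real) \<Rightarrow> bool" where
  "moment_psd d gs m \<longleftrightarrow> psd_on (moment_index d gs) (moment_matrix gs m)"

definition field_half_deg :: "('n::finite \<Rightarrow> ('n + 1) mpoly) \<Rightarrow> nat" where
  "field_half_deg f = half_deg (Max (range (\<lambda>i. pdeg (f i))))"

definition lie_poly :: "('n::finite \<Rightarrow> ('n + 1) mpoly) \<Rightarrow> ('n + 1) mpoly \<Rightarrow> ('n + 1) mpoly" where
  "lie_poly f p = ppartial (Inr 1) p + (\<Sum>i\<in>UNIV. f i * ppartial (Inl i) p)"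

definition field_eval :: "('n::finite \<Rightarrow> ('n + 1) mpoly) \<Rightarrow> real \<Rightarrow> real ^ 'n \<Rightarrow> real ^ 'n" where
  "field_eval f t x = (\<chi> i. peval (f i) (join x (vec t)))"

definition liou ::
    "('n::finite \<Rightarrow> ('n + 1) mpoly) \<Rightarrow> (nat ^ 'n \<Rightarrow> real) \<Rightarrow> (nat ^ ('n + 1) \<Rightarrow> real) \<Rightarrow>
     (nat ^ ('n + 1) \<Rightarrow> real) \<Rightarrow> nat ^ 'n \<Rightarrow> nat \<Rightarrow> real" where
  "liou f m\<^sub>0 m\<^sub>p m \<alpha> \<beta> =
     m\<^sub>0 \<alpha> * (if \<beta> = 0 then 1 else 0)
     + riesz m (lie_poly f (monomial (join \<alpha> (vec \<beta>))))
     - m\<^sub>p (join \<alpha> (vec \<beta>))"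

definition lmi_feasible ::
    "nat \<Rightarrow> real \<Rightarrow> ('n::finite \<Rightarrow> ('n + 1) mpoly) \<Rightarrow> 'n mpoly list \<Rightarrow> 'n mpoly list \<Rightarrow> 'n mpoly list \<Rightarrow>
     (nat ^ 'n \<Rightarrow> real) \<Rightarrow> (nat ^ ('n + 1) \<Rightarrow> real) \<Rightarrow> (nat ^ ('n + 1) \<Rightarrow> real) \<Rightarrow>
     (nat ^ ('n + 'n) \<Rightarrow> real) \<Rightarrow> bool" where
  "lmi_feasible d T f g0 gX gU m\<^sub>0 m\<^sub>p m m\<^sub>\<eta> \<longleftrightarrow>
     (\<forall>\<alpha>. mdeg \<alpha> \<le> 2 * d \<longrightarrow> m\<^sub>\<eta> (join \<alpha> 0) = m\<^sub>p (join \<alpha> 0)) \<and>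
     (\<forall>\<alpha> \<beta>. mdeg \<alpha> + \<beta> \<le> 2 * d \<longrightarrow> liou f m\<^sub>0 m\<^sub>p m \<alpha> \<beta> = 0) \<and>
     m\<^sub>0 0 = 1 \<and>
     moment_psd d g0 m\<^sub>0 \<and>
     moment_psd d (prod_description gX (time_description T)) m\<^sub>p \<and>
     moment_psd (d + field_half_deg f - 1) (prod_description gX (time_description T)) m \<and>
     moment_psd d (prod_description gX gU) m\<^sub>\<eta>"

definition lmi_value ::
    "nat \<Rightarrow> real \<Rightarrow> ('n::finite + 'n) mpoly \<Rightarrow> ('n \<Rightarrow> ('n + 1) mpoly) \<Rightarrow>
     'n mpoly list \<Rightarrow> 'n mpoly list \<Rightarrow> 'n mpoly list \<Rightarrow> ereal" where
  "lmi_value d T c f g0 gX gU =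
     Inf {ereal (riesz m\<^sub>\<eta> c) | m\<^sub>0 m\<^sub>p m m\<^sub>\<eta>. lmi_feasible d T f g0 gX gU m\<^sub>0 m\<^sub>p m m\<^sub>\<eta>}"

text \<open>All terms of the degree-\<open>d\<close> relaxation are defined: every block has a nonnegative order, and the
  cost is a combination of moments of degree at most \<open>2d\<close>. The time constraint has degree 2 and hence
  forces \<open>d \<ge> 1\<close>, so that the order of the moment matrix of \<open>m\<close> involves no truncated subtraction.\<close>

definition lmi_defined ::
    "nat \<Rightarrow> real \<Rightarrow> ('n::finite + 'n) mpoly \<Rightarrow> ('n \<Rightarrow> ('n + 1) mpoly) \<Rightarrow>
     'n mpoly list \<Rightarrow> 'n mpoly list \<Rightarrow> 'n mpoly list \<Rightarrow> bool" where
  "lmi_defined d T c f g0 gX gU \<longleftrightarrow>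
     pdeg c \<le> 2 * d \<and>
     (\<forall>g\<in>set g0. half_deg (pdeg g) \<le> d) \<and>
     (\<forall>g\<in>set (prod_description gX (time_description T)).
        half_deg (pdeg g) \<le> d \<and> half_deg (pdeg g) \<le> d + field_half_deg f - 1) \<and>
     (\<forall>g\<in>set (prod_description gX gU). half_deg (pdeg g) \<le> d)"

end

theory Submission
  imports Defs "HOL-Probability.Helly_Selection"
begin

text \<open>Monotonicity and \<open>p\<^sub>d \<le> p\<close> are immediate, since moments of feasible measures are feasible. For
  the limit suppose \<open>p\<^sub>d < r < p\<close> for all \<open>d\<close>. The Archimedean property bounds every fixed moment of
  feasible points of cost below \<open>r\<close> eventually in \<open>d\<close>, the masses being tied together by the
  Liouville relations for the monomials \<open>1\<close> and \<open>t\<close>. A diagonal subsequence converges to sequences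
  whose Riesz functionals are nonnegative on the quadratic modules; representing these by measures
  gives a feasible point of cost at most \<open>r\<close>, a contradiction.

  The representation needs no Positivstellensatz. If \<open>L\<close> is nonnegative on squares and its moments grow
  at most like \<open>r\<close> to the degree, iterated Cauchy-Schwarz shows that the same holds for
  \<open>L((r \<plusminus> x\<^sub>i) \<cdot>)\<close>. Hence \<open>L\<close> is nonnegative on the Bernstein basis of a cube, its values there are the
  weights of discrete measures on grids, and a weak limit of these represents \<open>L\<close>. Weak compactness
  is Helly's theorem on the line, transported by a space-filling curve. Nonnegativity of \<open>L(g q\<^sup>2)\<close> for
  all \<open>q\<close> forces \<open>g \<ge> 0\<close> almost everywhere.\<close>

section \<open>Polynomials and the Riesz functional\<close>

text \<open>At a fixed \<open>d\<close> only finitely many inequalities are available, so no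
  functional is nonnegative on a whole quadratic module. The Archimedean estimates are therefore
  derived for every set of polynomials that is closed under sums and contains all
  \<open>g q^2\<close>. The polynomials whose Riesz value is eventually nonnegative form such a set,
  which spares degree bounds on certificates. In the limit the four functionals are represented
  separately, and their measures are coupled only through monomials, while the program asks for
  equal marginals and for the Liouville equation with every C^1 test function near [0,T] x X. The
  marginals agree because finite measures on a compact set are determined by polynomials. The
  Liouville equation needs polynomials that approximate a function together with its derivative;
  convolution with Landau's kernel, after a cutoff, provides them. The monomial \<open>1\<close>
  gives \<open>m_p\<close> the mass of \<open>m_0\<close>, which is 1; the monomial \<open>t\<close>
  makes the mass of \<open>m\<close> the first time moment of \<open>m_p\<close>, and this is
  bounded because T is finite.\<close>

abbreviation single :: "'k \<Rightarrow> 'a \<Rightarrow> 'k \<Rightarrow>\<^sub>0 'a::zero" where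
  "single \<equiv> Poly_Mapping.single"

lemma sum_keys_superset:
  assumes "finite A" "Poly_Mapping.keys p \<subseteq> A" "\<And>k. \<Phi> k 0 = 0"
  shows "(\<Sum>k\<in>Poly_Mapping.keys p. \<Phi> k (Poly_Mapping.lookup p k)) = (\<Sum>k\<in>A. \<Phi> k (Poly_Mapping.lookup p k))"
  using assms by (intro sum.mono_neutral_left) (auto simp: in_keys_iff)

text \<open>Cancellation can shrink the support of a sum, so the three sums are compared over the
  union of the supports. \<open>riesz\<close>, \<open>ppartial\<close> and the two embeddings are
  all sums of this shape.\<close>

lemma sum_keys_add:
  fixes \<Phi> :: "'k \<Rightarrow> 'a::comm_monoid_add \<Rightarrow> 'b::comm_monoid_add"
  assumes "\<And>k. \<Phi> k 0 = 0" "\<And>k a b. \<Phi> k (a + b) = \<Phi> k a + \<Phi> k b"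
  shows "(\<Sum>k\<in>Poly_Mapping.keys (p + q). \<Phi> k (Poly_Mapping.lookup (p + q) k)) =
    (\<Sum>k\<in>Poly_Mapping.keys p. \<Phi> k (Poly_Mapping.lookup p k)) +
    (\<Sum>k\<in>Poly_Mapping.keys q. \<Phi> k (Poly_Mapping.lookup q k))"
proof -
  let ?A = "Poly_Mapping.keys p \<union> Poly_Mapping.keys q"
  have "Poly_Mapping.keys (p + q) \<subseteq> ?A" by (rule keys_add)
  then show ?thesis
    using sum_keys_superset[of ?A "p + q" \<Phi>] sum_keys_superset[of ?A p \<Phi>]
      sum_keys_superset[of ?A q \<Phi>] assms
    by (simp add: lookup_add sum.distrib)
qed

lemma sum_keys_single:
  assumes "\<Phi> k 0 = 0"
  shows "(\<Sum>j\<in>Poly_Mapping.keys (single k a). \<Phi> j (Poly_Mapping.lookup (single k a) j)) = \<Phi> k a"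
  using assms by (cases "a = 0") (auto simp: keys_single)

lemma poly_mapping_sum_single:
  "(\<Sum>k\<in>Poly_Mapping.keys p. single k (Poly_Mapping.lookup p k)) = p"
proof (rule poly_mapping_eqI)
  fix k
  have "Poly_Mapping.lookup (\<Sum>k\<in>Poly_Mapping.keys p. single k (Poly_Mapping.lookup p k)) k
    = (\<Sum>j\<in>Poly_Mapping.keys p. if j = k then Poly_Mapping.lookup p j else 0)"
    by (simp add: lookup_sum lookup_single when_def)
  also have "\<dots> = Poly_Mapping.lookup p k"
    by (simp add: in_keys_iff)
  finally show "Poly_Mapping.lookup (\<Sum>k\<in>Poly_Mapping.keys p. single k (Poly_Mapping.lookup p k)) k
    = Poly_Mapping.lookup p k" .
qed

lemma poly_mapping_induct [case_names zero single_add]: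
  fixes p :: "'k \<Rightarrow>\<^sub>0 'a::comm_monoid_add"
  assumes "P 0" "\<And>k a p. P p \<Longrightarrow> P (single k a + p)"
  shows "P p"
proof -
  have "P (\<Sum>k\<in>K. single k (Poly_Mapping.lookup p k))" if "finite K" for K
    using that by induction (auto simp: assms)
  from this[of "Poly_Mapping.keys p"] show ?thesis by (simp add: poly_mapping_sum_single)
qed

text \<open>Both sides are additive in \<open>p\<close> and in \<open>q\<close>, so single terms
  decide. The instances are evaluation at a point and the two embeddings.\<close>

lemma poly_mapping_mult_hom:
  fixes h :: "('k::comm_monoid_add \<Rightarrow>\<^sub>0 'a::comm_semiring_1) \<Rightarrow> 'b::comm_semiring_1"
  assumes add: "\<And>p q. h (p + q) = h p + h q" and zero: "h 0 = 0"
    and single: "\<And>k l a b. h (single (k + l) (a * b)) =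
      h (single k a) * h (single l b)"
  shows "h (p * q) = h p * h q"
proof -
  have 1: "h (single k a * q) = h (single k a) * h q" for k a
    by (induction q rule: poly_mapping_induct) (simp_all add: zero add single mult_single distrib_left)
  show ?thesis
    by (induction p rule: poly_mapping_induct) (simp_all add: zero add 1 distrib_right)
qed

definition mono_eval :: "real ^ 'v::finite \<Rightarrow> nat ^ 'v \<Rightarrow> real" where
  "mono_eval x \<alpha> = (\<Prod>i\<in>UNIV. (x $ i) ^ (\<alpha> $ i))"

lemma mono_eval_0 [simp]: "mono_eval x 0 = 1"
  by (simp add: mono_eval_def)

lemma mono_eval_add: "mono_eval x (\<alpha> + \<beta>) = mono_eval x \<alpha> * mono_eval x \<beta>"
  by (simp add: mono_eval_def power_add prod.distrib)

text \<open>The numbers \<open>mono_eval x\<close> are the moments of the Dirac measure at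
  \<open>x\<close>; evaluation thus inherits linearity from \<open>riesz\<close>.\<close>

lemma peval_eq_riesz: "peval p x = riesz (mono_eval x) p"
  by (simp add: peval_def riesz_def mono_eval_def)

lemma riesz_add: "riesz m (p + q) = riesz m p + riesz m q"
  unfolding riesz_def by (rule sum_keys_add) (auto simp: algebra_simps)

lemma riesz_0 [simp]: "riesz m 0 = 0"
  by (simp add: riesz_def)

lemma riesz_single [simp]: "riesz m (single k a) = a * m k"
  unfolding riesz_def by (rule sum_keys_single) simp

lemma riesz_sum: "riesz m (sum p A) = (\<Sum>a\<in>A. riesz m (p a))"
  by (induction A rule: infinite_finite_induct) (auto simp: riesz_add)

lemma riesz_uminus: "riesz m (- p) = - riesz m p"
  using riesz_add[of m p "- p"] by simp

lemma riesz_diff: "riesz m (p - q) = riesz m p - riesz m q"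
  using riesz_add[of m p "- q"] by (simp add: riesz_uminus)

lemma riesz_pconst_mult: "riesz m (pconst a * p) = a * riesz m p"
  by (induction p rule: poly_mapping_induct)
     (simp_all add: pconst_def riesz_add mult_single distrib_left algebra_simps)

lemma riesz_monomial [simp]: "riesz m (monomial \<alpha>) = m \<alpha>"
  by (simp add: monomial_def)

lemma riesz_1 [simp]: "riesz m 1 = m 0"
  using riesz_single[of m 0 1] by simp

lemma peval_add: "peval (p + q) x = peval p x + peval q x"
  by (simp add: peval_eq_riesz riesz_add)

lemma peval_0 [simp]: "peval 0 x = 0"
  by (simp add: peval_eq_riesz)

lemma peval_1 [simp]: "peval 1 x = 1"
  by (simp add: peval_eq_riesz)

lemma peval_sum: "peval (sum p A) x = (\<Sum>a\<in>A. peval (p a) x)"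
  by (simp add: peval_eq_riesz riesz_sum)

lemma peval_diff: "peval (p - q) x = peval p x - peval q x"
  by (simp add: peval_eq_riesz riesz_diff)

lemma peval_uminus: "peval (- p) x = - peval p x"
  by (simp add: peval_eq_riesz riesz_uminus)

lemma peval_mult: "peval (p * q) x = peval p x * peval q x"
  by (rule poly_mapping_mult_hom[of "\<lambda>p. peval p x"])
     (simp_all add: peval_eq_riesz riesz_add mono_eval_add)

lemma peval_pconst [simp]: "peval (pconst a) x = a"
  by (simp add: peval_eq_riesz pconst_def)

lemma peval_monomial: "peval (monomial \<alpha>) x = mono_eval x \<alpha>"
  by (simp add: peval_eq_riesz)

lemma mono_eval_axis: "mono_eval x (axis i 1) = x $ i"
proof -
  have "mono_eval x (axis i 1) = (\<Prod>j\<in>UNIV. if j = i then x $ j else 1)"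
    unfolding mono_eval_def by (rule prod.cong) (auto simp: axis_def)
  then show ?thesis by simp
qed

lemma peval_pvar [simp]: "peval (pvar i) x = x $ i"
  by (simp add: pvar_def peval_monomial mono_eval_axis del: One_nat_def)

lemmas peval_simps = peval_add peval_diff peval_mult peval_uminus peval_sum peval_monomial

lemma monomial_add: "monomial (\<alpha> + \<beta>) = monomial \<alpha> * monomial \<beta>"
  by (simp add: monomial_def mult_single)

lemma monomial_0 [simp]: "monomial 0 = 1"
  by (simp add: monomial_def)

lemma pconst_1 [simp]: "pconst 1 = 1"
  by (simp add: pconst_def)

lemma pconst_0 [simp]: "pconst 0 = 0"
  by (simp add: pconst_def)

lemma pconst_add: "pconst (a + b) = pconst a + pconst b"
  by (simp add: pconst_def single_add)

lemma pconst_diff: "pconst (a - b) = pconst a - pconst b"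
  by (simp add: pconst_def single_diff)

lemma pconst_mult: "pconst (a * b) = pconst a * pconst b"
  by (simp add: pconst_def mult_single)

lemma single_eq_pconst_mult: "single \<alpha> a = pconst a * monomial \<alpha>"
  by (simp add: pconst_def monomial_def mult_single)

lemma mdeg_add: "mdeg (\<alpha> + \<beta>) = mdeg \<alpha> + mdeg \<beta>"
  by (simp add: mdeg_def sum.distrib)

lemma mdeg_0 [simp]: "mdeg 0 = 0"
  by (simp add: mdeg_def)

lemma mdeg_axis [simp]: "mdeg (axis i k) = k"
proof -
  have "mdeg (axis i k) = (\<Sum>j\<in>UNIV. if j = i then k else 0)"
    unfolding mdeg_def by (rule sum.cong) (auto simp: axis_def)
  then show ?thesis by simp
qed

lemma multi_index_induct [case_names zero axis]:
  fixes \<alpha> :: "nat ^ 'v::finite"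
  assumes "P 0" "\<And>\<alpha> i. P \<alpha> \<Longrightarrow> P (axis i 1 + \<alpha>)"
  shows "P \<alpha>"
proof (induction "mdeg \<alpha>" arbitrary: \<alpha>)
  case 0
  then have "\<alpha> = 0" by (auto simp: mdeg_def vec_eq_iff)
  then show ?case using assms by simp
next
  case (Suc n)
  then obtain i where i: "\<alpha> $ i \<noteq> 0"
    by (metis mdeg_def sum.neutral nat.distinct(1))
  \<comment> \<open>Subtraction of naturals is truncated, hence the choice of \<open>i\<close> with
    a nonzero exponent.\<close>
  then have eq: "\<alpha> = axis i 1 + (\<alpha> - axis i 1)"
    by (auto simp: vec_eq_iff axis_def)
  then have "mdeg \<alpha> = 1 + mdeg (\<alpha> - axis i 1)"
    using mdeg_add[of "axis i 1" "\<alpha> - axis i 1"] by simp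
  then have "P (\<alpha> - axis i 1)" using Suc by simp
  then show ?case using assms(2) eq by metis
qed

lemma finite_mdeg_le: "finite {\<alpha> :: nat ^ 'v::finite. mdeg \<alpha> \<le> d}"
proof -
  have "{\<alpha> :: nat ^ 'v. mdeg \<alpha> \<le> d} \<subseteq> vec_lambda ` (UNIV \<rightarrow>\<^sub>E {..d})"
  proof
    fix \<alpha> :: "nat ^ 'v" assume "\<alpha> \<in> {\<alpha>. mdeg \<alpha> \<le> d}"
    then have "\<alpha> $ i \<le> d" for i
      using member_le_sum[of i UNIV "\<lambda>i. \<alpha> $ i"] by (simp add: mdeg_def)
    then show "\<alpha> \<in> vec_lambda ` (UNIV \<rightarrow>\<^sub>E {..d})"
      by (intro image_eqI[of _ _ "vec_nth \<alpha>"]) auto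
  qed
  then show ?thesis by (rule finite_subset) (intro finite_imageI finite_PiE; simp)
qed

lemma mdeg_le_pdeg: "\<alpha> \<in> Poly_Mapping.keys p \<Longrightarrow> mdeg \<alpha> \<le> pdeg p"
  unfolding pdeg_def by (intro Max_ge) auto

text \<open>Reduces products to those with one variable, which is what the affine change of
  variables in \<open>moment_representation_cube\<close> can handle.\<close>

lemma mpoly_induct [case_names const add var]:
  fixes p :: "'v::finite mpoly"
  assumes "\<And>a. P (pconst a)" "\<And>p q. P p \<Longrightarrow> P q \<Longrightarrow> P (p + q)"
    "\<And>i p. P p \<Longrightarrow> P (pvar i * p)"
  shows "P p"
proof (induction p rule: poly_mapping_induct)
  case zero
  then show ?case using assms(1)[of 0] by simp
next
  case (single_add \<alpha> a p)
  have "P (single \<alpha> a)" for a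
  proof (induction \<alpha> rule: multi_index_induct)
    case zero
    then show ?case using assms(1)[of a] by (simp add: pconst_def)
  next
    case (axis \<alpha> i)
    have "single (axis i 1 + \<alpha>) a = pvar i * single \<alpha> a"
      by (simp add: pvar_def monomial_def mult_single)
    then show ?case using assms(3) axis by metis
  qed
  then show ?case using assms(2) single_add by blast
qed

section \<open>Embeddings into the polynomial ring in joint variables\<close>

lemma embed_left_add: "embed_left (p + q) = embed_left p + embed_left q"
  unfolding embed_left_def by (rule sum_keys_add) (auto simp: single_add)

lemma embed_left_0 [simp]: "embed_left 0 = 0"
  by (simp add: embed_left_def)

lemma embed_left_single [simp]: "embed_left (single \<alpha> a) = single (join \<alpha> 0) a"
  unfolding embed_left_def by (rule sum_keys_single) simp

lemma embed_right_add: "embed_right (p + q) = embed_right p + embed_right q"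
  unfolding embed_right_def by (rule sum_keys_add) (auto simp: single_add)

lemma embed_right_0 [simp]: "embed_right 0 = 0"
  by (simp add: embed_right_def)

lemma embed_right_single [simp]: "embed_right (single \<alpha> a) = single (join 0 \<alpha>) a"
  unfolding embed_right_def by (rule sum_keys_single) simp

lemma join_add: "join (a + b) (c + d) = join a c + join b d"
  for a b :: "'a::monoid_add ^ 'm::finite" and c d :: "'a ^ 'n::finite"
  by (auto simp: join_def vec_eq_iff split: sum.split)

lemma join_0 [simp]: "join 0 0 = 0"
  by (auto simp: join_def vec_eq_iff split: sum.split)

lemma join_nth [simp]: "join a b $ Inl i = a $ i" "join a b $ Inr j = b $ j"
  by (simp_all add: join_def)

lemma join_axis_left: "join (axis i a) 0 = axis (Inl i) a"
  by (auto simp: join_def vec_eq_iff axis_def split: sum.split)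

lemma join_axis_right: "join 0 (axis i a) = axis (Inr i) a"
  by (auto simp: join_def vec_eq_iff axis_def split: sum.split)

lemma embed_left_mult: "embed_left (p * q) = embed_left p * embed_left q"
  by (rule poly_mapping_mult_hom) (simp_all add: embed_left_add mult_single flip: join_add)

lemma embed_right_mult: "embed_right (p * q) = embed_right p * embed_right q"
  by (rule poly_mapping_mult_hom) (simp_all add: embed_right_add mult_single flip: join_add)

lemma embed_pconst [simp]: "embed_left (pconst a) = pconst a" "embed_right (pconst a) = pconst a"
  by (simp_all add: pconst_def)

lemma embed_pvar [simp]: "embed_left (pvar i) = pvar (Inl i)" "embed_right (pvar i) = pvar (Inr i)"
  by (simp_all add: pvar_def monomial_def join_axis_left join_axis_right)

lemma embed_diff:
  "embed_left (p - q) = embed_left p - embed_left q"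
  "embed_right (p - q) = embed_right p - embed_right q"
  by (simp_all add: eq_diff_eq flip: embed_left_add embed_right_add)

lemma prod_UNIV_sum:
  fixes f :: "'a::finite + 'b::finite \<Rightarrow> 'c::comm_monoid_mult"
  shows "(\<Prod>k\<in>UNIV. f k) = (\<Prod>i\<in>UNIV. f (Inl i)) * (\<Prod>j\<in>UNIV. f (Inr j))"
  using prod.Plus[of UNIV UNIV f] by (simp add: UNIV_Plus_UNIV comp_def)

lemma mono_eval_join: "mono_eval (join x y) (join \<alpha> \<beta>) = mono_eval x \<alpha> * mono_eval y \<beta>"
  by (simp add: mono_eval_def prod_UNIV_sum)

lemma peval_embed_left [simp]: "peval (embed_left p) (join x y) = peval p x"
  by (induction p rule: poly_mapping_induct)
     (simp_all add: embed_left_add peval_eq_riesz riesz_add mono_eval_join)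

lemma peval_embed_right [simp]: "peval (embed_right p) (join x y) = peval p y"
  by (induction p rule: poly_mapping_induct)
     (simp_all add: embed_right_add peval_eq_riesz riesz_add mono_eval_join)

lemma semialg_prod_description:
  "join x y \<in> semialg (prod_description gs hs) \<longleftrightarrow> x \<in> semialg gs \<and> y \<in> semialg hs"
  by (simp add: semialg_def prod_description_def ball_Un)

lemma continuous_on_peval [continuous_intros]:
  "continuous_on S h \<Longrightarrow> continuous_on S (\<lambda>x. peval p (h x))"
  unfolding peval_def by (intro continuous_intros)

lemma borel_measurable_continuous_sets:
  assumes "sets M = sets borel" "continuous_on UNIV f"
  shows "f \<in> M \<rightarrow>\<^sub>M borel"
  using borel_measurable_continuous_onI[OF assms(2)] assms(1) measurable_cong_sets by blast

lemma compact_continuous_bound: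
  fixes f :: "'a::topological_space \<Rightarrow> 'b::real_normed_vector"
  assumes "compact K" "continuous_on K f"
  obtains C where "\<And>x. x \<in> K \<Longrightarrow> norm (f x) \<le> C"
  using compact_imp_bounded[OF compact_continuous_image[OF assms(2,1)]] by (auto simp: bounded_iff)

lemma closed_semialg: "closed (semialg gs)"
proof -
  have "semialg gs = (\<Inter>g\<in>set gs. {x. 0 \<le> peval g x})"
    by (auto simp: semialg_def)
  then show ?thesis by (auto intro!: closed_Collect_le continuous_intros)
qed

section \<open>Partial derivatives of polynomials\<close>

lemma ppartial_add: "ppartial i (p + q) = ppartial i p + ppartial i q"
  unfolding ppartial_def by (rule sum_keys_add) (auto simp: algebra_simps single_add)

lemma ppartial_0 [simp]: "ppartial i 0 = 0"
  by (simp add: ppartial_def)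

lemma ppartial_single:
  "ppartial i (single \<alpha> a) = single (\<alpha> - axis i 1) (of_nat (\<alpha> $ i) * a)"
  unfolding ppartial_def by (rule sum_keys_single) simp

lemma has_derivative_mono_eval:
  "((\<lambda>x. mono_eval x \<alpha>) has_derivative
    (\<lambda>h. \<Sum>i\<in>UNIV. h $ i * (of_nat (\<alpha> $ i) * mono_eval x (\<alpha> - axis i 1)))) (at x)"
proof -
  \<comment> \<open>The truncated exponent is harmless: where \<open>\<alpha> $ i = 0\<close> the
    coefficient in front vanishes.\<close>
  have pr: "of_nat (\<alpha> $ i) * mono_eval x (\<alpha> - axis i 1) =
     of_nat (\<alpha> $ i) * (x $ i) ^ (\<alpha> $ i - 1) * (\<Prod>j\<in>UNIV - {i}. (x $ j) ^ (\<alpha> $ j))" for i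
  proof -
    have "mono_eval x (\<alpha> - axis i 1) = (x $ i) ^ (\<alpha> $ i - 1) *
       (\<Prod>j\<in>UNIV - {i}. (x $ j) ^ ((\<alpha> - axis i 1) $ j))"
      unfolding mono_eval_def by (subst prod.remove[of _ i]) (auto simp: axis_def)
    also have "(\<Prod>j\<in>UNIV - {i}. (x $ j) ^ ((\<alpha> - axis i 1) $ j)) = (\<Prod>j\<in>UNIV - {i}. (x $ j) ^ (\<alpha> $ j))"
      by (intro prod.cong) (auto simp: axis_def)
    finally show ?thesis by simp
  qed
  have "((\<lambda>x. \<Prod>i\<in>UNIV. (x $ i) ^ (\<alpha> $ i)) has_derivative
     (\<lambda>h. \<Sum>i\<in>UNIV. (of_nat (\<alpha> $ i) * h $ i * (x $ i) ^ (\<alpha> $ i - 1)) *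
        (\<Prod>j\<in>UNIV - {i}. (x $ j) ^ (\<alpha> $ j)))) (at x)"
    by (rule has_derivative_prod)
       (auto intro!: derivative_eq_intros bounded_linear_imp_has_derivative)
  then show ?thesis
    unfolding mono_eval_def[symmetric] by (rule has_derivative_eq_rhs) (auto simp: pr[unfolded One_nat_def] algebra_simps)
qed

lemma has_derivative_peval:
  "(peval p has_derivative (\<lambda>h. \<Sum>i\<in>UNIV. h $ i * peval (ppartial i p) x)) (at x)"
proof (induction p rule: poly_mapping_induct)
  case zero
  then show ?case by simp
next
  case (single_add \<alpha> a p)
  have "((\<lambda>x. a * mono_eval x \<alpha>) has_derivative
      (\<lambda>h. a * (\<Sum>i\<in>UNIV. h $ i * (of_nat (\<alpha> $ i) * mono_eval x (\<alpha> - axis i 1))))) (at x)"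
    by (intro has_derivative_mult_right has_derivative_mono_eval)
  then have "((\<lambda>x. a * mono_eval x \<alpha> + peval p x) has_derivative
     (\<lambda>h. a * (\<Sum>i\<in>UNIV. h $ i * (of_nat (\<alpha> $ i) * mono_eval x (\<alpha> - axis i 1))) +
        (\<Sum>i\<in>UNIV. h $ i * peval (ppartial i p) x))) (at x)"
    using single_add by (rule has_derivative_add)
  moreover have "peval (single \<alpha> a + p) = (\<lambda>x. a * mono_eval x \<alpha> + peval p x)"
    by (auto simp: peval_eq_riesz riesz_add)
  moreover have "a * (\<Sum>i\<in>UNIV. h $ i * (of_nat (\<alpha> $ i) * mono_eval x (\<alpha> - axis i 1))) +
        (\<Sum>i\<in>UNIV. h $ i * peval (ppartial i p) x) =
      (\<Sum>i\<in>UNIV. h $ i * peval (ppartial i (single \<alpha> a + p)) x)" for h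
    by (simp add: ppartial_add ppartial_single peval_add sum.distrib algebra_simps sum_distrib_left
       peval_eq_riesz[of "single _ _"])
  ultimately show ?case by simp
qed

section \<open>Moment matrices and quadratic modules\<close>

lemma moment_index_Sigma:
  "moment_index d gs =
     Sigma {..length gs} (\<lambda>k. {\<alpha>. mdeg \<alpha> + half_deg (pdeg ((1 # gs) ! k)) \<le> d})"
  by (auto simp: moment_index_def)

lemma finite_mdeg_add_le: "finite {\<alpha> :: nat ^ 'v::finite. mdeg \<alpha> + h \<le> d}"
  by (rule finite_subset[OF _ finite_mdeg_le[of d]]) auto

lemma riesz_mult_single:
  "riesz m (g * single \<beta> b) =
    b * (\<Sum>\<sigma>\<in>Poly_Mapping.keys g. Poly_Mapping.lookup g \<sigma> * m (\<beta> + \<sigma>))"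
proof -
  have "riesz m (g * single \<beta> b) = b * riesz (\<lambda>\<sigma>. m (\<beta> + \<sigma>)) g"
    by (induction g rule: poly_mapping_induct)
       (simp_all add: riesz_add distrib_right mult_single algebra_simps)
  then show ?thesis by (simp add: riesz_def)
qed

text \<open>A vector restricted to block \<open>k\<close> is the coefficient vector of a polynomial
  \<open>Q k\<close>, and distinct blocks do not interact. Semidefiniteness thereby becomes
  nonnegativity of \<open>L(g q^2)\<close> for \<open>q\<close> of bounded degree, the only form
  used afterwards.\<close>

lemma moment_matrix_quadratic_form:
  fixes w :: "nat \<times> (nat ^ 'v::finite) \<Rightarrow> real" and gs :: "'v mpoly list" and d :: nat
  defines "A \<equiv> \<lambda>k. {\<alpha>. mdeg \<alpha> + half_deg (pdeg ((1 # gs) ! k)) \<le> d}"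
  defines "Q \<equiv> \<lambda>k. \<Sum>\<alpha>\<in>A k. single \<alpha> (w (k, \<alpha>))"
  shows "(\<Sum>i\<in>moment_index d gs. \<Sum>j\<in>moment_index d gs. w i * moment_matrix gs m i j * w j) =
    (\<Sum>k\<le>length gs. riesz m ((1 # gs) ! k * Q k * Q k))"
proof -
  have fin: "finite (A k)" for k unfolding A_def by (rule finite_mdeg_add_le)
  have Sig: "moment_index d gs = Sigma {..length gs} A"
    unfolding moment_index_Sigma A_def ..
  define t where "t k \<alpha> l \<theta> = w (k, \<alpha>) * moment_matrix gs m (k, \<alpha>) (l, \<theta>) * w (l, \<theta>)" for k \<alpha> l \<theta>
  have entry: "t k \<alpha> k \<theta> =
     riesz m ((1 # gs) ! k * (single \<alpha> (w (k, \<alpha>)) * single \<theta> (w (k, \<theta>))))" for k \<alpha> \<theta>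
    by (simp add: t_def mult_single riesz_mult_single moment_matrix_def)
  have "(\<Sum>i\<in>moment_index d gs. \<Sum>j\<in>moment_index d gs. w i * moment_matrix gs m i j * w j) =
     (\<Sum>k\<le>length gs. \<Sum>\<alpha>\<in>A k. \<Sum>l\<le>length gs. \<Sum>\<theta>\<in>A l. t k \<alpha> l \<theta>)"
    unfolding Sig t_def using fin by (subst sum.Sigma) (auto simp: sum.Sigma split_def)
  also have "\<dots> = (\<Sum>k\<le>length gs. \<Sum>\<alpha>\<in>A k. \<Sum>\<theta>\<in>A k. t k \<alpha> k \<theta>)"
  proof (intro sum.cong refl)
    fix k \<alpha> assume k: "k \<in> {..length gs}"
    have "(\<Sum>l\<le>length gs. \<Sum>\<theta>\<in>A l. t k \<alpha> l \<theta>) =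
      (\<Sum>l\<le>length gs. if l = k then \<Sum>\<theta>\<in>A k. t k \<alpha> k \<theta> else 0)"
      by (intro sum.cong refl) (auto simp: t_def moment_matrix_def)
    also have "\<dots> = (\<Sum>\<theta>\<in>A k. t k \<alpha> k \<theta>)"
      using k by simp
    finally show "(\<Sum>l\<le>length gs. \<Sum>\<theta>\<in>A l. t k \<alpha> l \<theta>) = (\<Sum>\<theta>\<in>A k. t k \<alpha> k \<theta>)" .
  qed
  also have "\<dots> = (\<Sum>k\<le>length gs. riesz m ((1 # gs) ! k * Q k * Q k))"
  proof (intro sum.cong refl)
    fix k
    have "g * sum h B * sum h B = (\<Sum>\<alpha>\<in>B. \<Sum>\<theta>\<in>B. g * (h \<alpha> * h \<theta>))" for g :: "'v mpoly" and h and B :: "(nat ^ 'v) set"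
      by (simp only: mult.assoc[of g] sum_product) (simp only: sum_distrib_left)
    then show "(\<Sum>\<alpha>\<in>A k. \<Sum>\<theta>\<in>A k. t k \<alpha> k \<theta>) = riesz m ((1 # gs) ! k * Q k * Q k)"
      by (simp only: entry riesz_sum Q_def)
  qed
  finally show ?thesis .
qed

lemma moment_psdI:
  assumes "\<And>g q. g \<in> set (1 # gs) \<Longrightarrow>
    (\<And>\<alpha>. \<alpha> \<in> Poly_Mapping.keys q \<Longrightarrow> mdeg \<alpha> + half_deg (pdeg g) \<le> d) \<Longrightarrow> 0 \<le> riesz m (g * q * q)"
  shows "moment_psd d gs m"
  unfolding moment_psd_def psd_on_def
proof (intro conjI ballI allI)
  show "moment_matrix gs m i j = moment_matrix gs m j i" for i j
    by (auto simp: moment_matrix_def add.commute split: prod.splits)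
  have keys: "\<alpha> \<in> A" if "\<alpha> \<in> Poly_Mapping.keys (\<Sum>\<alpha>\<in>A. single \<alpha> (w \<alpha>))" for \<alpha> A and w :: "_ \<Rightarrow> real"
    using that by (rule contrapos_pp) (auto simp: in_keys_iff lookup_sum lookup_single when_def intro!: sum.neutral)
  show "0 \<le> (\<Sum>i\<in>moment_index d gs. \<Sum>j\<in>moment_index d gs. w i * moment_matrix gs m i j * w j)" for w
    unfolding moment_matrix_quadratic_form
    by (intro sum_nonneg assms nth_mem) (auto dest: keys)
qed

lemma moment_psdD:
  assumes "moment_psd d gs m" "g \<in> set (1 # gs)" "\<And>\<alpha>. \<alpha> \<in> Poly_Mapping.keys q \<Longrightarrow> mdeg \<alpha> + half_deg (pdeg g) \<le> d"
  shows "0 \<le> riesz m (g * q * q)"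
proof -
  obtain k where k: "k \<le> length gs" "(1 # gs) ! k = g"
    using assms(2) by (metis in_set_conv_nth length_Cons less_Suc_eq_le)
  \<comment> \<open>The test vector carries the coefficients of \<open>q\<close> in block
    \<open>k\<close> and zeros elsewhere, which isolates one constraint.\<close>
  define w where "w = (\<lambda>(l, \<alpha>). if l = k then Poly_Mapping.lookup q \<alpha> else 0)"
  have fin: "finite {\<alpha> :: nat ^ 'a. mdeg \<alpha> + h \<le> d}" for h
    by (rule finite_mdeg_add_le)
  have q: "(\<Sum>\<alpha> | mdeg \<alpha> + half_deg (pdeg g) \<le> d. single \<alpha> (Poly_Mapping.lookup q \<alpha>)) = q"
    by (subst sum_keys_superset[symmetric, where p = q and \<Phi> = "single"])
       (use assms(3) fin in \<open>auto simp: poly_mapping_sum_single\<close>)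
  have "0 \<le> (\<Sum>i\<in>moment_index d gs. \<Sum>j\<in>moment_index d gs. w i * moment_matrix gs m i j * w j)"
    using assms(1) by (auto simp: moment_psd_def psd_on_def)
  also have "\<dots> = (\<Sum>l\<le>length gs. if l = k then riesz m (g * q * q) else 0)"
    unfolding moment_matrix_quadratic_form
    by (intro sum.cong refl) (auto simp: w_def k q)
  finally show ?thesis using k by simp
qed

lemma moment_psd_mono:
  assumes "moment_psd d' gs m" "d \<le> d'"
  shows "moment_psd d gs m"
  by (rule moment_psdI, rule moment_psdD[OF assms(1)]) (use assms(2) in force)+

text \<open>The set \<open>P\<close> is kept abstract because several kinds occur: the polynomials
  nonnegative under a limit functional, those eventually nonnegative along the relaxations, those
  nonnegative at a point, and preimages of such sets under the embeddings.\<close>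

definition square_cone :: "'v::finite mpoly list \<Rightarrow> 'v mpoly set \<Rightarrow> bool" where
  "square_cone gs P \<longleftrightarrow> (\<forall>p\<in>P. \<forall>q\<in>P. p + q \<in> P) \<and> (\<forall>g\<in>set (1 # gs). \<forall>q. g * q * q \<in> P)"

lemma square_coneD:
  assumes "square_cone gs P"
  shows "p \<in> P \<Longrightarrow> q \<in> P \<Longrightarrow> p + q \<in> P" "g \<in> set gs \<Longrightarrow> g * q * q \<in> P" "q * q \<in> P" "0 \<in> P"
proof -
  show "p \<in> P \<Longrightarrow> q \<in> P \<Longrightarrow> p + q \<in> P" "g \<in> set gs \<Longrightarrow> g * q * q \<in> P"
    using assms by (auto simp: square_cone_def)
  have sq: "q * q \<in> P" for q
    using assms unfolding square_cone_def by (metis list.set_intros(1) mult_1)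
  show "q * q \<in> P" by (rule sq)
  show "0 \<in> P" using sq[of 0] by simp
qed

lemma square_cone_addI:
  "square_cone gs P \<Longrightarrow> s = p + q \<Longrightarrow> p \<in> P \<Longrightarrow> q \<in> P \<Longrightarrow> s \<in> P"
  using square_coneD(1) by blast

lemma square_cone_sum_list:
  assumes "square_cone gs P" "\<And>x. x \<in> set xs \<Longrightarrow> h x \<in> P"
  shows "(\<Sum>x\<leftarrow>xs. h x) \<in> P"
  using assms(2) by (induction xs) (auto intro: square_coneD[OF assms(1)])

lemma square_cone_sum:
  assumes "square_cone gs P" "\<And>x. x \<in> A \<Longrightarrow> h x \<in> P"
  shows "(\<Sum>x\<in>A. h x) \<in> P"
  using assms(2) by (induction A rule: infinite_finite_induct) (auto intro: square_coneD[OF assms(1)])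

text \<open>Squares in the weights move into the multiplier:
  \<open>r * r * h * q * q = h * (r * q) * (r * q)\<close>.\<close>

lemma quadratic_module_square_cone:
  assumes "square_cone gs P" "s \<in> quadratic_module gs"
  shows "s * q * q \<in> P"
proof -
  have sos: "\<sigma> * h * q * q \<in> P" if "sos \<sigma>" and h: "\<And>q. h * q * q \<in> P" for \<sigma> h
  proof -
    from that obtain rs where "\<sigma> = (\<Sum>r\<leftarrow>rs. r * r)" by (auto simp: sos_def)
    moreover have "(\<Sum>r\<leftarrow>rs. r * r) * h * q * q = (\<Sum>r\<leftarrow>rs. h * (r * q) * (r * q))"
    proof (induction rs)
      case (Cons r rs)
      have "r * r * h * q * q = h * (r * q) * (r * q)" by (simp only: mult_ac)
      with Cons show ?case by (simp only: list.map sum_list.Cons distrib_right)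
    qed simp
    moreover have "(\<Sum>r\<leftarrow>rs. h * (r * q) * (r * q)) \<in> P"
      by (intro square_cone_sum_list[OF assms(1)] h)
    ultimately show ?thesis by simp
  qed
  from assms(2) obtain \<sigma>0 \<sigma> where s: "s = \<sigma>0 + (\<Sum>i<length gs. \<sigma> i * gs ! i)"
    "sos \<sigma>0" "\<And>i. i < length gs \<Longrightarrow> sos (\<sigma> i)"
    unfolding quadratic_module_def by blast
  have "s * q * q = \<sigma>0 * 1 * q * q + (\<Sum>i<length gs. \<sigma> i * gs ! i * q * q)"
    by (simp add: s distrib_right sum_distrib_right)
  moreover have "\<sigma>0 * 1 * q * q \<in> P"
    by (rule sos[OF s(2)]) (simp add: square_coneD[OF assms(1)])
  moreover have "(\<Sum>i<length gs. \<sigma> i * gs ! i * q * q) \<in> P"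
    by (intro square_cone_sum[OF assms(1)] sos s square_coneD[OF assms(1)]) auto
  ultimately show ?thesis by (rule square_cone_addI[OF assms(1)])
qed

text \<open>A nonnegative scalar is the square of \<open>sqrt a\<close>, and this root is absorbed
  in \<open>q\<close>.\<close>

lemma square_cone_scaled:
  assumes "square_cone gs P" "0 \<le> a" "\<And>q. h * q * q \<in> P"
  shows "pconst a * h * q * q \<in> P"
proof -
  have "pconst a = pconst (sqrt a) * pconst (sqrt a)"
    using assms(2) by (simp flip: pconst_mult)
  then have "pconst a * h * q * q = pconst (sqrt a) * pconst (sqrt a) * h * q * q"
    by metis
  also have "\<dots> = h * (pconst (sqrt a) * q) * (pconst (sqrt a) * q)"
    by (simp only: mult_ac)
  finally have "pconst a * h * q * q = h * (pconst (sqrt a) * q) * (pconst (sqrt a) * q)" .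
  then show ?thesis using assms(3) by metis
qed

text \<open>Expresses through all cones, instead of through sums of squares, that
  \<open>R - x_i^2\<close> is certified by the constraints. In this form the property passes to
  larger \<open>R\<close> and to products of descriptions without any certificate being
  rewritten.\<close>

definition coord_bounded :: "'v::finite mpoly list \<Rightarrow> real \<Rightarrow> bool" where
  "coord_bounded gs R \<longleftrightarrow>
     (\<forall>P. square_cone gs P \<longrightarrow> (\<forall>i q. (pconst R - pvar i * pvar i) * q * q \<in> P))"

lemma coord_bounded_mono:
  assumes "coord_bounded gs R" "R \<le> R'"
  shows "coord_bounded gs R'"
  unfolding coord_bounded_def
proof (intro allI impI)
  fix P and i :: 'a and q assume P: "square_cone gs P"
  have "(pconst R' - pvar i * pvar i) * q * q =
     pconst (R' - R) * 1 * q * q + (pconst R - pvar i * pvar i) * q * q"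
    by (simp add: pconst_diff algebra_simps)
  moreover have "pconst (R' - R) * 1 * q * q \<in> P"
    by (rule square_cone_scaled[OF P]) (use assms in \<open>auto simp: square_coneD[OF P]\<close>)
  moreover have "(pconst R - pvar i * pvar i) * q * q \<in> P"
    using assms(1) P by (simp add: coord_bounded_def)
  ultimately show "(pconst R' - pvar i * pvar i) * q * q \<in> P"
    by (rule square_cone_addI[OF P])
qed

text \<open>\<open>R - x_i^2\<close> exceeds \<open>R - |x|^2\<close> by the squares of the other
  coordinates.\<close>

lemma archimedean_coord_bounded:
  assumes "archimedean_description gs"
  obtains R where "coord_bounded gs R"
proof -
  obtain R where R: "pconst R - (\<Sum>i\<in>UNIV. pvar i * pvar i) \<in> quadratic_module gs"
    using assms unfolding archimedean_description_def by blast
  have "coord_bounded gs R" unfolding coord_bounded_def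
  proof (intro allI impI)
    fix P and i :: 'a and q assume P: "square_cone gs P"
    have "(\<Sum>j\<in>UNIV. pvar j * pvar j) = pvar i * pvar i + (\<Sum>j\<in>UNIV - {i}. pvar j * pvar j)"
      by (rule sum.remove) auto
    then have "(pconst R - pvar i * pvar i) * q * q =
       (pconst R - (\<Sum>j\<in>UNIV. pvar j * pvar j)) * q * q + (\<Sum>j\<in>UNIV - {i}. (pvar j * q) * (pvar j * q))"
      by (simp add: algebra_simps sum_distrib_left sum_distrib_right)
    then show "(pconst R - pvar i * pvar i) * q * q \<in> P"
      by (rule square_cone_addI[OF P _ quadratic_module_square_cone[OF P R]
            square_cone_sum[OF P square_coneD(3)[OF P]]])
  qed
  then show thesis by (rule that)
qed

text \<open>\<open>T^2 - t^2 = 2 t (T - t) + (t - T)^2\<close>.\<close>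

lemma coord_bounded_time: "coord_bounded (time_description T) (T\<^sup>2)"
  unfolding coord_bounded_def
proof (intro allI impI)
  fix P and i :: 1 and q :: "1 mpoly" assume P: "square_cone (time_description T) P"
  have i: "i = 1" by (rule num1_eq1)
  have "pconst (T\<^sup>2) = (pconst T * pconst T :: 1 mpoly)" by (simp add: power2_eq_square flip: pconst_mult)
  moreover have "pconst 2 = (2 :: 1 mpoly)" using pconst_add[of 1 1] by (simp add: one_add_one)
  ultimately have "(pconst (T\<^sup>2) - pvar i * pvar i) * q * q =
     pconst 2 * (pvar 1 * (pconst T - pvar 1)) * q * q + ((pvar 1 - pconst T) * q) * ((pvar 1 - pconst T) * q)"
    unfolding i by (simp add: algebra_simps)
  moreover have "pconst 2 * (pvar 1 * (pconst T - pvar 1)) * q * q \<in> P"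
    by (rule square_cone_scaled[OF P]) (auto intro!: square_coneD[OF P] simp: time_description_def)
  ultimately show "(pconst (T\<^sup>2) - pvar i * pvar i) * q * q \<in> P"
    by (rule square_cone_addI[OF P _ _ square_coneD(3)[OF P]])
qed

text \<open>The multiplier \<open>q\<close> may mix both groups of variables. With \<open>q\<close>
  fixed, pulling \<open>P\<close> back along an embedding gives a cone over one factor, whose bound
  is then needed for the multiplier 1 only.\<close>

lemma coord_bounded_prod:
  assumes "coord_bounded gs R" "coord_bounded hs R"
  shows "coord_bounded (prod_description gs hs) R"
  unfolding coord_bounded_def
proof (intro allI impI)
  fix P i and q :: "('a + 'b) mpoly" assume P: "square_cone (prod_description gs hs) P"
  define PL where "PL = {p. embed_left p * q * q \<in> P}"
  define PR where "PR = {p. embed_right p * q * q \<in> P}"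
  have sq: "(e * u * u) * q * q = e * (u * q) * (u * q)" for e u :: "('a + 'b) mpoly"
    by (simp add: mult_ac)
  have one: "embed_left 1 = 1" "embed_right 1 = 1"
    using embed_pconst[of 1] by simp_all
  have gs: "embed_left g * u * u \<in> P" if "g \<in> set (1 # gs)" for g u
    using that square_coneD[OF P] by (auto simp: prod_description_def one)
  have hs: "embed_right g * u * u \<in> P" if "g \<in> set (1 # hs)" for g u
    using that square_coneD[OF P] by (auto simp: prod_description_def one)
  have "square_cone gs PL"
    unfolding square_cone_def PL_def mem_Collect_eq embed_left_mult embed_left_add distrib_right sq
    using gs square_coneD(1)[OF P] by blast
  moreover have "square_cone hs PR"
    unfolding square_cone_def PR_def mem_Collect_eq embed_right_mult embed_right_add distrib_right sq
    using hs square_coneD(1)[OF P] by blast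
  ultimately have *: "(pconst R - pvar i * pvar i) * 1 * 1 \<in> PL" "(pconst R - pvar j * pvar j) * 1 * 1 \<in> PR" for i j
    using assms unfolding coord_bounded_def by blast+
  show "(pconst R - pvar i * pvar i) * q * q \<in> P"
  proof (cases i)
    case (Inl j)
    then show ?thesis using *(1)[of j] by (simp add: PL_def embed_diff embed_left_mult)
  next
    case (Inr j)
    then show ?thesis using *(2)[of j] by (simp add: PR_def embed_diff embed_right_mult)
  qed
qed

text \<open>With \<open>k = mdeg \<alpha>\<close> and \<open>m = monomial \<alpha>\<close>, one more
  variable is split off by
  \<open>R^(k+1) - x_i^2 m^2 = R (R^k - m^2) + (R - x_i^2) m^2\<close>.\<close>

lemma coord_bounded_monomial_sq:
  assumes "coord_bounded gs R" "0 \<le> R" and P: "square_cone gs P"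
  shows "(pconst (R ^ mdeg \<alpha>) - monomial \<alpha> * monomial \<alpha>) * q * q \<in> P"
proof (induction \<alpha> arbitrary: q rule: multi_index_induct)
  case zero
  then show ?case using square_coneD(4)[OF P] by simp
next
  case (axis \<alpha> i)
  have "(pconst (R ^ mdeg (axis i 1 + \<alpha>)) - monomial (axis i 1 + \<alpha>) * monomial (axis i 1 + \<alpha>)) * q * q =
     pconst R * (pconst (R ^ mdeg \<alpha>) - monomial \<alpha> * monomial \<alpha>) * q * q +
     (pconst R - pvar i * pvar i) * (monomial \<alpha> * q) * (monomial \<alpha> * q)"
    by (simp add: mdeg_add pconst_mult monomial_add pvar_def algebra_simps)
  moreover have "pconst R * (pconst (R ^ mdeg \<alpha>) - monomial \<alpha> * monomial \<alpha>) * q * q \<in> P"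
    using axis assms(2) by (intro square_cone_scaled[OF P])
  moreover have "(pconst R - pvar i * pvar i) * (monomial \<alpha> * q) * (monomial \<alpha> * q) \<in> P"
    using assms(1) P by (auto simp: coord_bounded_def)
  ultimately show ?case by (rule square_cone_addI[OF P])
qed

text \<open>With \<open>A = R^(mdeg \<alpha>)\<close> and \<open>m = monomial \<alpha>\<close>, the
  sum \<open>A + m\<close> is half of \<open>(1 + m)^2 + (A - m^2) + (A - 1)\<close>; the last term
  is where \<open>1 \<le> R\<close> enters. Replacing \<open>m\<close> by \<open>-m\<close> gives
  the difference.\<close>

lemma coord_bounded_monomial:
  assumes "coord_bounded gs R" "1 \<le> R" and P: "square_cone gs P"
  shows "pconst (R ^ mdeg \<alpha>) + monomial \<alpha> \<in> P" "pconst (R ^ mdeg \<alpha>) - monomial \<alpha> \<in> P"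
proof -
  let ?A = "pconst (R ^ mdeg \<alpha>)" and ?m = "monomial \<alpha>"
  have h: "pconst (1/2) * x + pconst (1/2) * x = x" for x :: "'a mpoly"
  proof -
    have "pconst (1/2) + pconst (1/2) = (1 :: 'a mpoly)"
      by (simp flip: pconst_add)
    then show ?thesis by (simp flip: distrib_right)
  qed
  have half: "pconst (1/2) * h * q * q \<in> P" if "\<And>q. h * q * q \<in> P" for h q
    by (rule square_cone_scaled[OF P _ that]) simp
  have "pconst (R ^ mdeg \<alpha> - 1) * 1 * q * q \<in> P" for q
    by (rule square_cone_scaled[OF P]) (use one_le_power[OF assms(2)] square_coneD(3)[OF P] in auto)
  then have 1: "pconst (1/2) * pconst (R ^ mdeg \<alpha> - 1) * 1 * 1 \<in> P"
    by (intro half) simp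
  have 2: "pconst (1/2) * (?A - ?m * ?m) * 1 * 1 \<in> P"
    using coord_bounded_monomial_sq[OF assms(1) _ P] assms(2) by (intro half) auto
  have 3: "pconst (1/2) * 1 * u * u \<in> P" for u
    using square_coneD(3)[OF P] by (intro half) auto
  have mem: "pconst (1/2) * 1 * u * u + (pconst (1/2) * (?A - ?m * ?m) * 1 * 1
       + pconst (1/2) * pconst (R ^ mdeg \<alpha> - 1) * 1 * 1) \<in> P" for u
    by (rule square_coneD(1)[OF P 3 square_coneD(1)[OF P 2 1]])
  have ring: "c * 1 * (1 + y) * (1 + y) + (c * (x - y * y) * 1 * 1 + c * (x - 1) * 1 * 1) = (c * x + c * x) + (c * y + c * y)"
    for c x y :: "'b::comm_ring_1"
    by (simp add: algebra_simps)
  have eq: "pconst (1/2) * 1 * (1 + y) * (1 + y) + (pconst (1/2) * (?A - y * y) * 1 * 1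
       + pconst (1/2) * pconst (R ^ mdeg \<alpha> - 1) * 1 * 1) = ?A + y" for y :: "'a mpoly"
    by (simp only: pconst_diff pconst_1 ring h)
  show "?A + ?m \<in> P" by (rule subst[of _ _ "\<lambda>x. x \<in> P", OF eq mem])
  have "- ?m * - ?m = ?m * ?m" "?A + - ?m = ?A - ?m" by simp_all
  then show "?A - ?m \<in> P" using eq[of "- ?m"] mem[of "1 + - ?m"] by metis
qed

section \<open>Weak compactness on a cube\<close>

text \<open>Schoenberg's function of period 2: it is 0 within 1/3 of the even integers, 1 at
  distance at least 2/3 from them, and linear in between.\<close>

definition zigzag :: "real \<Rightarrow> real" where
  "zigzag t = max 0 (min 1 (3 * \<bar>t - 2 * of_int (round (t / 2))\<bar> - 1))"

lemma zigzag_bounds: "0 \<le> zigzag t" "zigzag t \<le> 1"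
  by (auto simp: zigzag_def)

text \<open>The distance to the nearest even integer is \<open>1\<close>-Lipschitz, being an infimum of distances.\<close>
lemma zigzag_lipschitz: "\<bar>zigzag s - zigzag t\<bar> \<le> 3 * \<bar>s - t\<bar>"
proof -
  let ?h = "\<lambda>t::real. \<bar>t - 2 * of_int (round (t / 2))\<bar>"
  have le: "?h a \<le> ?h b + \<bar>a - b\<bar>" for a b :: real
  proof -
    have "\<bar>of_int (round (a / 2)) - a / 2\<bar> \<le> \<bar>of_int (round (b / 2)) - a / 2\<bar>"
      using round_diff_minimal[of "a/2" "round (b/2)"] by (simp add: abs_minus_commute)
    then show ?thesis by argo
  qed
  from le[of s t] le[of t s] show ?thesis
    unfolding zigzag_def by (auto simp: max_def min_def abs_if split: if_splits)
qed

lemma continuous_on_zigzag [continuous_intros]: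
  "continuous_on S h \<Longrightarrow> continuous_on S (\<lambda>x. zigzag (h x))"
proof -
  have "continuous_on UNIV zigzag"
  proof (rule continuous_onI)
    fix x e :: real assume "e > 0"
    then show "\<exists>d>0. \<forall>x'\<in>UNIV. dist x' x < d \<longrightarrow> dist (zigzag x') (zigzag x) \<le> e"
      by (intro exI[of _ "e/3"]) (auto simp: dist_real_def intro: order.trans[OF zigzag_lipschitz])
  qed
  then show "continuous_on S h \<Longrightarrow> continuous_on S (\<lambda>x. zigzag (h x))"
    by (rule continuous_on_compose2) auto
qed

text \<open>The even integer stands for the digits already passed, 0 or 2/3 for the current ternary
  digit, and \<open>r\<close> for the tail, which is too short to leave the plateau.\<close>

lemma zigzag_digit:
  assumes "0 \<le> r" "r \<le> 1/3"
  shows "zigzag (2 * of_int n + r) = 0" "zigzag (2 * of_int n + 2/3 + r) = 1"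
proof -
  have "round ((2 * of_int n + r) / 2) = n"
    by (rule round_unique) (use assms in \<open>auto simp: field_simps\<close>)
  then show "zigzag (2 * of_int n + r) = 0"
    using assms by (auto simp: zigzag_def)
  let ?t = "2 * of_int n + 2/3 + r"
  have 1: "\<bar>?t - 2 * of_int k\<bar> \<ge> 2/3" for k
  proof -
    consider "k \<le> n" | "k \<ge> n + 1" by linarith
    then show ?thesis
    proof cases
      case 1
      then have "real_of_int k \<le> of_int n" by simp
      then show ?thesis using assms by argo
    next
      case 2
      then have "real_of_int k \<ge> of_int n + 1" by linarith
      then show ?thesis using assms by argo
    qed
  qed
  show "zigzag ?t = 1"
    using 1[of "round (?t / 2)"] by (simp add: zigzag_def max_def min_def)
qed

text \<open>Schoenberg's construction: the ternary digits \<open>0\<close> and \<open>2\<close> of the parameter encode the binary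
  digits of all coordinates at once.\<close>
lemma zigzag_ternary:
  fixes b :: "nat \<Rightarrow> bool"
  defines "t \<equiv> (suminf (\<lambda>k. 2 * of_bool (b k) / 3 ^ Suc k) :: real)"
  shows "zigzag (3 ^ k * t) = of_bool (b k)"
proof -
  define d where "d k = (2 * of_bool (b k) / 3 ^ Suc k :: real)" for k
  have sg: "summable (\<lambda>k. 2 / 3 ^ Suc k :: real)"
    using summable_mult[OF summable_geometric[of "1/3::real"], of "2/3"] by (simp add: power_divide)
  have sd: "summable d"
    by (rule summable_comparison_test'[OF sg, of 0]) (auto simp: d_def)
  have tail: "0 \<le> (suminf (\<lambda>j. d (j + n))) \<and> (suminf (\<lambda>j. d (j + n))) \<le> 1 / 3 ^ n" for n
  proof
    have s: "summable (\<lambda>j. d (j + n))" using sd by (simp add: summable_iff_shift)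
    show "0 \<le> (suminf (\<lambda>j. d (j + n)))" by (rule suminf_nonneg[OF s]) (auto simp: d_def)
    have g: "(\<lambda>j. 2 / 3 ^ Suc n * (1/3) ^ j) sums (2 / 3 ^ Suc n * (1 / (1 - 1/3)) :: real)"
      by (intro sums_mult geometric_sums) simp
    have "(suminf (\<lambda>j. d (j + n))) \<le> (suminf (\<lambda>j. 2 / 3 ^ Suc n * (1/3) ^ j))"
      by (rule suminf_le[OF _ s sums_summable[OF g]]) (auto simp: d_def power_add power_divide mult_ac)
    also have "\<dots> = 1 / 3 ^ n" using sums_unique[OF g] by simp
    finally show "(suminf (\<lambda>j. d (j + n))) \<le> 1 / 3 ^ n" .
  qed
  have t: "t = (suminf (\<lambda>j. d (j + Suc k))) + (\<Sum>j<Suc k. d j)"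
    unfolding t_def d_def[symmetric] by (rule suminf_split_initial_segment[OF sd])
  \<comment> \<open>Every digit is 0 or 2, so the part of \<open>3 ^ k * t\<close> before the
    ternary point is an even integer, a period of \<open>zigzag\<close>.\<close>
  define n where "n = (\<Sum>j<k. of_bool (b j) * 3 ^ (k - Suc j) :: int)"
  have head: "3 ^ k * (\<Sum>j<k. d j) = 2 * of_int n"
  proof -
    have "3 ^ k * d j = 2 * (of_bool (b j) * 3 ^ (k - Suc j))" if "j < k" for j
    proof -
      have "(3::real) ^ k = 3 ^ Suc j * 3 ^ (k - Suc j)"
        using that by (metis Suc_leI le_add_diff_inverse power_add)
      then show ?thesis by (simp add: d_def)
    qed
    then show ?thesis by (simp add: n_def sum_distrib_left del: sum_of_bool_mult_eq sum_mult_of_bool_eq)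
  qed
  define r where "r = 3 ^ k * (suminf (\<lambda>j. d (j + Suc k)))"
  have r: "0 \<le> r" "r \<le> 1/3"
    using tail[of "Suc k"] by (auto simp: r_def field_simps)
  have "3 ^ k * t = 2 * of_int n + 2/3 * of_bool (b k) + r"
    using head by (simp add: t r_def algebra_simps) (simp add: d_def field_simps)
  then show ?thesis using zigzag_digit[OF r, of n] by (cases "b k") auto
qed

lemma binary_expansion:
  fixes x :: real
  assumes "0 \<le> x" "x \<le> 1"
  obtains b :: "nat \<Rightarrow> bool" where "(\<lambda>k. of_bool (b k) / 2 ^ Suc k) sums x"
proof -
  \<comment> \<open>Greedy bits, with the remainder doubled at each step. For \<open>x = 1\<close>
    the remainder stays 1 and every bit is 1.\<close>
  define rem :: "nat \<Rightarrow> real" where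
    "rem = rec_nat x (\<lambda>_ y. if y \<ge> 1/2 then 2 * y - 1 else 2 * y)"
  have rem0: "rem 0 = x" and remS: "rem (Suc k) = (if rem k \<ge> 1/2 then 2 * rem k - 1 else 2 * rem k)" for k
    by (simp_all add: rem_def)
  have rem: "0 \<le> rem k \<and> rem k \<le> 1" for k
    by (induction k) (use assms in \<open>auto simp: rem0 remS\<close>)
  define b where "b k \<longleftrightarrow> rem k \<ge> 1/2" for k
  have part: "(\<Sum>k<n. of_bool (b k) / 2 ^ Suc k) = x - rem n / 2 ^ n" for n
    by (induction n) (auto simp: rem0 remS b_def field_simps)
  have "(\<lambda>n. rem n / 2 ^ n) \<longlonglongrightarrow> 0"
  proof (rule tendsto_sandwich[OF _ _ tendsto_const])
    show "(\<lambda>n. (1/2) ^ n :: real) \<longlonglongrightarrow> 0" by (rule LIMSEQ_power_zero) simp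
  qed (use rem in \<open>auto intro!: always_eventually simp: field_simps\<close>)
  then have "(\<lambda>n. x - rem n / 2 ^ n) \<longlonglongrightarrow> x - 0" by (intro tendsto_intros)
  then have "(\<lambda>k. of_bool (b k) / 2 ^ Suc k) sums x"
    unfolding sums_def part by simp
  then show thesis by (rule that)
qed

text \<open>Coordinate \<open>i\<close> reads the digits at the positions
  \<open>prod_encode (e i, k)\<close>. Different coordinates read disjoint positions, so all their
  binary digits can be prescribed at once. Continuity comes from uniform convergence of the
  series.\<close>

lemma space_filling_curve:
  obtains \<phi> :: "real \<Rightarrow> real ^ 'v::finite" where "continuous_on UNIV \<phi>"
    "\<And>t i. 0 \<le> \<phi> t $ i \<and> \<phi> t $ i \<le> 1"
    "\<And>x. (\<And>i. 0 \<le> x $ i \<and> x $ i \<le> 1) \<Longrightarrow> \<exists>t\<in>{0..1}. \<phi> t = x"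
proof -
  obtain e :: "'v \<Rightarrow> nat" where e: "inj e"
    using finite_imp_inj_to_nat_seg[of "UNIV :: 'v set"] by auto
  define \<phi> where "\<phi> t = (\<chi> i. suminf (\<lambda>k. zigzag (3 ^ prod_encode (e i, k) * t) / 2 ^ Suc k))" for t
  have half: "(\<lambda>k. 1 / 2 ^ Suc k :: real) sums 1"
    using power_half_series by (simp add: power_divide)
  have summ: "summable (\<lambda>k. zigzag (3 ^ prod_encode (e i, k) * t) / 2 ^ Suc k)" for i t
    by (rule summable_comparison_test'[OF sums_summable[OF half], of 0])
       (auto simp: zigzag_bounds divide_right_mono)
  have cont: "continuous_on UNIV \<phi>"
    unfolding \<phi>_def
  proof (intro continuous_on_vec_lambda)
    fix i :: 'v
    have "uniform_limit UNIV (\<lambda>n t. \<Sum>k<n. zigzag (3 ^ prod_encode (e i, k) * t) / 2 ^ Suc k)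
       (\<lambda>t. suminf (\<lambda>k. zigzag (3 ^ prod_encode (e i, k) * t) / 2 ^ Suc k)) sequentially"
      by (rule Weierstrass_m_test[OF _ sums_summable[OF half]])
         (auto simp: zigzag_bounds divide_right_mono)
    then show "continuous_on UNIV (\<lambda>t. suminf (\<lambda>k. zigzag (3 ^ prod_encode (e i, k) * t) / 2 ^ Suc k))"
      by (rule uniform_limit_theorem[rotated]) (auto intro!: continuous_intros always_eventually)
  qed
  have bd: "0 \<le> \<phi> t $ i \<and> \<phi> t $ i \<le> 1" for t i
  proof
    show "0 \<le> \<phi> t $ i"
      unfolding \<phi>_def by simp (intro suminf_nonneg summ[simplified], auto simp: zigzag_bounds)
    have "(suminf (\<lambda>k. zigzag (3 ^ prod_encode (e i, k) * t) / 2 ^ Suc k)) \<le> (suminf (\<lambda>k. 1 / 2 ^ Suc k))"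
      by (intro suminf_le summ sums_summable[OF half]) (auto simp: zigzag_bounds divide_right_mono)
    then show "\<phi> t $ i \<le> 1" unfolding \<phi>_def using sums_unique[OF half] by simp
  qed
  have surj: "\<exists>t\<in>{0..1}. \<phi> t = x" if x: "\<And>i. 0 \<le> x $ i \<and> x $ i \<le> 1" for x
  proof -
    have "\<exists>b. (\<lambda>k. of_bool (b k) / 2 ^ Suc k) sums (x $ i)" for i
      using binary_expansion[of "x $ i"] x by metis
    then obtain b where b: "\<And>i. (\<lambda>k. of_bool (b i k) / 2 ^ Suc k) sums (x $ i)" by metis
    define B where "B n = (case prod_decode n of (m, k) \<Rightarrow> b (inv e m) k)" for n
    define t where "t = (suminf (\<lambda>k. 2 * of_bool (B k) / 3 ^ Suc k) :: real)"
    have "zigzag (3 ^ prod_encode (e i, k) * t) = of_bool (b i k)" for i k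
      unfolding t_def zigzag_ternary by (simp add: B_def e)
    then have "\<phi> t = x"
      using b by (auto simp: \<phi>_def vec_eq_iff sums_iff)
    moreover have "0 \<le> t \<and> t \<le> 1"
    proof -
      have g: "(\<lambda>k. 2 / 3 * (1/3) ^ k) sums (2 / 3 * (1 / (1 - 1/3)) :: real)"
        by (intro sums_mult geometric_sums) simp
      have s: "summable (\<lambda>k. 2 * of_bool (B k) / 3 ^ Suc k :: real)"
        by (rule summable_comparison_test'[OF sums_summable[OF g], of 0]) (auto simp: power_divide)
      have "t \<le> (suminf (\<lambda>k. 2 / 3 * (1/3) ^ k))"
        unfolding t_def by (rule suminf_le[OF _ s sums_summable[OF g]]) (auto simp: power_divide)
      then show ?thesis
        using sums_unique[OF g] suminf_nonneg[OF s] by (auto simp: t_def)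
    qed
    ultimately show ?thesis by auto
  qed
  show thesis by (rule that[OF cont bd surj])
qed

text \<open>The atoms are lifted to parameters in \<open>{0..1}\<close>, which gives a tight
  sequence of laws on the line; a weak limit is pushed forward along the curve. The curve stays in
  the cube for every real parameter, so \<open>g\<close> composed with it is bounded and continuous
  on the whole line, as weak convergence requires.\<close>

lemma weak_compactness_cube:
  fixes A :: "nat \<Rightarrow> 'k set" and w :: "nat \<Rightarrow> 'k \<Rightarrow> real" and pt :: "nat \<Rightarrow> 'k \<Rightarrow> real ^ 'v::finite"
  assumes fin: "\<And>n. finite (A n)" and w: "\<And>n k. k \<in> A n \<Longrightarrow> 0 \<le> w n k"
    and one: "\<And>n. (\<Sum>k\<in>A n. w n k) = 1"
    and pt: "\<And>n k i. k \<in> A n \<Longrightarrow> 0 \<le> pt n k $ i \<and> pt n k $ i \<le> 1"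
  obtains \<nu> s where "prob_space \<nu>" "sets \<nu> = sets borel" "strict_mono s"
    "AE x in \<nu>. \<forall>i. 0 \<le> x $ i \<and> x $ i \<le> 1"
    "\<And>g :: real ^ 'v \<Rightarrow> real. continuous_on UNIV g \<Longrightarrow>
        (\<lambda>n. \<Sum>k\<in>A (s n). w (s n) k * g (pt (s n) k)) \<longlonglongrightarrow> (\<integral>x. g x \<partial>\<nu>)"
proof -
  obtain \<phi> :: "real \<Rightarrow> real ^ 'v" where \<phi>: "continuous_on UNIV \<phi>"
    "\<And>t i. 0 \<le> \<phi> t $ i \<and> \<phi> t $ i \<le> 1"
    "\<And>x. (\<And>i. 0 \<le> x $ i \<and> x $ i \<le> 1) \<Longrightarrow> \<exists>t\<in>{0..1}. \<phi> t = x"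
    using space_filling_curve[where 'v = 'v] by metis
  have "\<exists>t\<in>{0..1}. k \<in> A n \<longrightarrow> \<phi> t = pt n k" for n k
    using \<phi>(3)[of "pt n k"] pt[of k n] by (cases "k \<in> A n") (auto intro: bexI[of _ 0])
  then have "\<exists>\<psi>. \<forall>n k. \<psi> n k \<in> {0..1} \<and> (k \<in> A n \<longrightarrow> \<phi> (\<psi> n k) = pt n k)"
    by (intro choice allI) blast
  then obtain \<psi> where \<psi>: "\<And>n k. \<psi> n k \<in> {0..1}" "\<And>n k. k \<in> A n \<Longrightarrow> \<phi> (\<psi> n k) = pt n k"
    by blast
  define M where "M n = distr (point_measure (A n) (\<lambda>k. ennreal (w n k))) borel (\<psi> n)" for n
  have meas: "\<psi> n \<in> point_measure (A n) (\<lambda>k. ennreal (w n k)) \<rightarrow>\<^sub>M borel" for n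
    by (simp add: measurable_point_measure_eq1)
  have pp: "prob_space (point_measure (A n) (\<lambda>k. ennreal (w n k)))" for n
    by (rule prob_spaceI) (use fin w one in \<open>simp add: space_point_measure emeasure_point_measure_finite sum_ennreal\<close>)
  have real: "real_distribution (M n)" for n
    unfolding real_distribution_def real_distribution_axioms_def M_def
    by (simp add: prob_space.prob_space_distr[OF pp meas])
  have int: "integral\<^sup>L (M n) g = (\<Sum>k\<in>A n. w n k * g (\<psi> n k))" if "g \<in> borel_measurable borel" for g :: "real \<Rightarrow> real" and n
    unfolding M_def using that fin w
    by (simp add: integral_distr[OF meas] lebesgue_integral_point_measure_finite)
  \<comment> \<open>Tightness is stated with intervals open on the left; the endpoint -1 keeps the
    parameter 0 inside.\<close>
  have in1: "\<psi> n k \<in> {-1<..1}" for n k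
    using \<psi>(1)[of n k] by simp
  have "tight M" unfolding tight_def
  proof (intro conjI allI impI real)
    fix \<epsilon> :: real assume "\<epsilon> > 0"
    have "measure (M n) {-1<..1} = 1" for n
    proof -
      have "\<psi> n -` {-1<..1} \<inter> space (point_measure (A n) (\<lambda>k. ennreal (w n k))) =
         space (point_measure (A n) (\<lambda>k. ennreal (w n k)))"
        using in1[of n] by blast
      then show ?thesis
        unfolding M_def by (simp add: measure_distr[OF meas] prob_space.prob_space[OF pp])
    qed
    then show "\<exists>a b. a < b \<and> (\<forall>n. 1 - \<epsilon> < measure (M n) {a<..b})"
      using \<open>\<epsilon> > 0\<close> by (intro exI[of _ "-1"] exI[of _ 1]) auto
  qed
  from tight_imp_convergent_subsubsequence[OF this strict_mono_id] obtain s N where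
    s: "strict_mono s" "real_distribution N" "weak_conv_m (M \<circ> id \<circ> s) N" by blast
  interpret N: real_distribution N by fact
  have \<phi>m: "\<phi> \<in> borel_measurable borel" by (rule borel_measurable_continuous_onI[OF \<phi>(1)])
  then have \<phi>N: "\<phi> \<in> N \<rightarrow>\<^sub>M borel" by simp
  define \<nu> where "\<nu> = distr N borel \<phi>"
  show thesis
  proof (rule that[of \<nu> s])
    show "prob_space \<nu>" unfolding \<nu>_def by (rule N.prob_space_distr[OF \<phi>N])
    show "sets \<nu> = sets borel" by (simp add: \<nu>_def)
    show "strict_mono s" by fact
    have cl: "closed {x :: real ^ 'v. \<forall>i. 0 \<le> x $ i \<and> x $ i \<le> 1}"
      by (intro closed_Collect_all closed_Collect_conj closed_Collect_le continuous_intros)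
    show "AE x in \<nu>. \<forall>i. 0 \<le> x $ i \<and> x $ i \<le> 1"
      unfolding \<nu>_def using cl \<phi>(2) by (subst AE_distr_iff[OF \<phi>N]) (auto intro: borel_closed)
    fix g :: "real ^ 'v \<Rightarrow> real" assume g: "continuous_on UNIV g"
    have "compact (cbox 0 (1 :: real ^ 'v))" by (rule compact_cbox)
    then have "bounded (g ` cbox 0 1)"
      by (intro compact_imp_bounded compact_continuous_image continuous_on_subset[OF g]) auto
    then obtain B where B: "\<And>x. x \<in> cbox 0 1 \<Longrightarrow> norm (g x) \<le> B"
      by (auto simp: bounded_iff)
    have gc: "continuous_on UNIV (\<lambda>t. g (\<phi> t))"
      by (rule continuous_on_compose2[OF g \<phi>(1)]) auto
    have "(\<lambda>n. integral\<^sup>L ((M \<circ> id \<circ> s) n) (\<lambda>t. g (\<phi> t))) \<longlonglongrightarrow> integral\<^sup>L N (\<lambda>t. g (\<phi> t))"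
    proof (rule weak_conv_imp_integral_bdd_continuous_conv[OF _ s(2,3)])
      show "real_distribution ((M \<circ> id \<circ> s) n)" for n by (simp add: real)
      show "isCont (\<lambda>t. g (\<phi> t)) x" for x using gc by (simp add: continuous_on_eq_continuous_at)
      show "norm (g (\<phi> x)) \<le> B" for x
        by (rule B) (auto simp: mem_box_cart \<phi>(2))
    qed
    moreover have "integral\<^sup>L N (\<lambda>t. g (\<phi> t)) = (\<integral>x. g x \<partial>\<nu>)"
      unfolding \<nu>_def using g by (simp add: integral_distr[OF \<phi>N] borel_measurable_continuous_onI)
    moreover have "integral\<^sup>L ((M \<circ> id \<circ> s) n) (\<lambda>t. g (\<phi> t)) =
        (\<Sum>k\<in>A (s n). w (s n) k * g (pt (s n) k))" for n
      using int[OF borel_measurable_continuous_onI[OF gc], of "s n"] \<psi>(2) by simp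
    ultimately show "(\<lambda>n. \<Sum>k\<in>A (s n). w (s n) k * g (pt (s n) k)) \<longlonglongrightarrow> (\<integral>x. g x \<partial>\<nu>)"
      by simp
  qed
qed

section \<open>The moment problem\<close>

definition linear_form :: "('v::finite mpoly \<Rightarrow> real) \<Rightarrow> bool" where
  "linear_form L \<longleftrightarrow> (\<forall>p q. L (p + q) = L p + L q) \<and> (\<forall>a p. L (pconst a * p) = a * L p)"

context
  fixes L :: "'v::finite mpoly \<Rightarrow> real"
  assumes L: "linear_form L"
begin

lemma linear_form_add: "L (p + q) = L p + L q"
  and linear_form_scale: "L (pconst a * p) = a * L p"
  using L by (auto simp: linear_form_def)

lemma linear_form_0: "L 0 = 0"
  using linear_form_scale[of 0 0] by simp

lemma linear_form_pconst: "L (pconst a) = a * L 1"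
  using linear_form_scale[of a 1] by simp

lemma linear_form_diff: "L (p - q) = L p - L q"
  using linear_form_add[of "p - q" q] by simp

lemma linear_form_sum: "L (sum h A) = (\<Sum>a\<in>A. L (h a))"
  by (induction A rule: infinite_finite_induct) (auto simp: linear_form_add linear_form_0)

lemma linear_form_mult: "linear_form (\<lambda>p. L (h * p))"
  using linear_form_scale[of _ "h * _"]
  by (auto simp: linear_form_def distrib_left linear_form_add mult.left_commute)

text \<open>Multiplication by \<open>h\<close> affects the constant but not the rate
  \<open>r\<close>, so that \<open>L(h p)\<close>, as a functional of \<open>p\<close>, satisfies
  the same kind of bound as \<open>L\<close>.\<close>

lemma linear_form_growth_mult:
  assumes "0 < r" "\<And>\<alpha>. \<bar>L (monomial \<alpha>)\<bar> \<le> C * r ^ mdeg \<alpha>"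
  obtains D where "\<And>\<alpha>. \<bar>L (h * monomial \<alpha>)\<bar> \<le> D * r ^ mdeg \<alpha>"
proof -
  have "\<exists>D. \<forall>\<alpha>. \<bar>L (h * monomial \<alpha>)\<bar> \<le> D * r ^ mdeg \<alpha>"
  proof (induction h rule: poly_mapping_induct)
    case zero
    then show ?case by (auto simp: linear_form_0 intro: exI[of _ 0])
  next
    case (single_add \<beta> b p)
    then obtain D where D: "\<And>\<alpha>. \<bar>L (p * monomial \<alpha>)\<bar> \<le> D * r ^ mdeg \<alpha>" by blast
    have "\<bar>L ((single \<beta> b + p) * monomial \<alpha>)\<bar> \<le> (\<bar>b\<bar> * C * r ^ mdeg \<beta> + D) * r ^ mdeg \<alpha>" for \<alpha>
    proof -
      have "L ((single \<beta> b + p) * monomial \<alpha>) = b * L (monomial (\<beta> + \<alpha>)) + L (p * monomial \<alpha>)"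
        by (simp add: distrib_right linear_form_add single_eq_pconst_mult mult.assoc linear_form_scale monomial_add)
      also have "\<bar>\<dots>\<bar> \<le> \<bar>b\<bar> * \<bar>L (monomial (\<beta> + \<alpha>))\<bar> + \<bar>L (p * monomial \<alpha>)\<bar>"
        by (metis abs_mult abs_triangle_ineq)
      also have "\<dots> \<le> \<bar>b\<bar> * (C * r ^ mdeg (\<beta> + \<alpha>)) + D * r ^ mdeg \<alpha>"
        by (intro add_mono mult_left_mono assms D) auto
      finally show ?thesis by (simp add: mdeg_add power_add algebra_simps)
    qed
    then show ?case by blast
  qed
  then show thesis using that by blast
qed

lemma linear_form_cauchy_schwarz:
  assumes psd: "\<And>q. 0 \<le> L (q * q)"
  shows "(L (p * q))\<^sup>2 \<le> L (p * p) * L (q * q)"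
proof -
  have quad: "0 \<le> L (p * p) + 2 * t * L (p * q) + t\<^sup>2 * L (q * q)" for t
  proof -
    have "(p + pconst t * q) * (p + pconst t * q) =
      p * p + (pconst t * (p * q) + pconst t * (p * q)) + pconst t * (pconst t * (q * q))"
      by (simp add: algebra_simps)
    then have "L ((p + pconst t * q) * (p + pconst t * q)) = L (p * p) + 2 * t * L (p * q) + t\<^sup>2 * L (q * q)"
      by (simp only: linear_form_add linear_form_scale) (simp add: power2_eq_square)
    then show ?thesis using psd by metis
  qed
  show ?thesis
  proof (cases "L (q * q) = 0")
    case True
    have "L (p * q) = 0"
    proof (rule ccontr)
      assume n: "L (p * q) \<noteq> 0"
      \<comment> \<open>For \<open>L (q * q) = 0\<close> the quadratic is affine in
        \<open>t\<close>; this \<open>t\<close> gives it the value -1.\<close>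
      then have "2 * (- (L (p * p) + 1) / (2 * L (p * q))) * L (p * q) = - (L (p * p) + 1)"
        by (simp add: field_simps)
      then show False using quad[of "- (L (p * p) + 1) / (2 * L (p * q))"] by (simp only: True)
    qed
    then show ?thesis using True by simp
  next
    case False
    then have pos: "L (q * q) > 0" using psd[of q] by simp
    \<comment> \<open>The chosen \<open>t\<close> minimizes the quadratic.\<close>
    then show ?thesis using quad[of "- L (p * q) / L (q * q)"]
      by (simp add: field_simps power2_eq_square)
  qed
qed

end

text \<open>Log-convexity makes the ratios of consecutive terms nondecreasing, so the first ratio is bounded
  by the exponential growth rate.\<close>
lemma log_convex_growth:
  fixes a :: "nat \<Rightarrow> real"
  assumes nonneg: "\<And>k. 0 \<le> a k" and conv: "\<And>k. (a (Suc k))\<^sup>2 \<le> a k * a (Suc (Suc k))"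
    and growth: "\<And>k. a k \<le> D * \<rho> ^ k" and "0 < \<rho>"
  shows "a 1 \<le> \<rho> * a 0"
proof (rule ccontr)
  assume *: "\<not> a 1 \<le> \<rho> * a 0"
  have a0: "a 0 > 0"
  proof (rule ccontr)
    assume "\<not> a 0 > 0"
    then have "a 0 = 0" using nonneg[of 0] by simp
    then show False using * conv[of 0] by simp
  qed
  define c where "c = a 1 / a 0"
  have c: "\<rho> < c" using * a0 by (simp add: c_def field_simps)
  have step: "a k > 0 \<and> c * a k \<le> a (Suc k)" for k
  proof (induction k)
    case 0
    then show ?case using a0 by (simp add: c_def)
  next
    case (Suc k)
    have pos: "a (Suc k) > 0"
      using Suc c \<open>0 < \<rho>\<close> by (smt (verit) mult_pos_pos)
    have "a k * (c * a (Suc k)) \<le> (a (Suc k))\<^sup>2"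
      using Suc pos by (simp add: power2_eq_square mult.commute mult.left_commute)
    also have "\<dots> \<le> a k * a (Suc (Suc k))" by (rule conv)
    finally show ?case using Suc pos by simp
  qed
  have pw: "c ^ k * a 0 \<le> a k" for k
  proof (induction k)
    case (Suc k)
    have "c ^ Suc k * a 0 = c * (c ^ k * a 0)" by simp
    also have "\<dots> \<le> c * a k" using Suc c \<open>0 < \<rho>\<close> by (intro mult_left_mono) auto
    also have "\<dots> \<le> a (Suc k)" using step by simp
    finally show ?case .
  qed simp
  obtain k where k: "D / a 0 < (c / \<rho>) ^ k"
    using real_arch_pow[of "c / \<rho>" "D / a 0"] c \<open>0 < \<rho>\<close> by auto
  have "(c / \<rho>) ^ k \<le> D / a 0"
    using pw[of k] growth[of k] a0 \<open>0 < \<rho>\<close> by (simp add: field_simps)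
  then show False using k by simp
qed

text \<open>The constant \<open>C\<close> is existential so that the class survives multiplication
  by suitable polynomials; \<open>r\<close> becomes half the side of the cube that carries the
  measure.\<close>

definition bounded_psd :: "real \<Rightarrow> ('v::finite mpoly \<Rightarrow> real) \<Rightarrow> bool" where
  "bounded_psd r L \<longleftrightarrow> linear_form L \<and> (\<forall>q. 0 \<le> L (q * q)) \<and> (\<exists>C. \<forall>\<alpha>. \<bar>L (monomial \<alpha>)\<bar> \<le> C * r ^ mdeg \<alpha>)"

lemma axis_add: "axis i a + axis i b = axis i (a + b :: nat)"
  by (auto simp: axis_def vec_eq_iff)

lemma axis_nat_0 [simp]: "axis i (0 :: nat) = 0"
  by (auto simp: axis_def vec_eq_iff)

lemma pvar_power: "pvar i ^ k = monomial (axis i k)"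
proof (induction k)
  case 0
  show ?case by simp
next
  case (Suc k)
  then show ?case by (simp add: pvar_def axis_add flip: monomial_add)
qed

text \<open>The numbers \<open>L(x_i^(2k) q^2)\<close> form a log-convex sequence that grows at most
  like \<open>r^(2k)\<close>, so the first ratio is at most \<open>r^2\<close>: an unknown constant
  \<open>D\<close> is traded for the constant 1. A last Cauchy-Schwarz step passes from
  \<open>x_i^2\<close> to \<open>x_i\<close>.\<close>

lemma bounded_psd_coord:
  assumes "bounded_psd r L" "0 < r"
  shows "\<bar>L (pvar i * q * q)\<bar> \<le> r * L (q * q)"
proof -
  from assms obtain C where L: "linear_form L" and psd: "\<And>q. 0 \<le> L (q * q)"
    and C: "\<And>\<alpha>. \<bar>L (monomial \<alpha>)\<bar> \<le> C * r ^ mdeg \<alpha>" by (auto simp: bounded_psd_def)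
  obtain D where D: "\<And>\<alpha>. \<bar>L (q * q * monomial \<alpha>)\<bar> \<le> D * r ^ mdeg \<alpha>"
    using linear_form_growth_mult[OF L assms(2) C, of "q * q"] by blast
  define a where "a k = L ((pvar i ^ k * q) * (pvar i ^ k * q))" for k
  have "a 1 \<le> r\<^sup>2 * a 0"
  proof (rule log_convex_growth)
    show "0 \<le> a k" for k unfolding a_def by (rule psd)
    show "(a (Suc k))\<^sup>2 \<le> a k * a (Suc (Suc k))" for k
    proof -
      \<comment> \<open>The square of \<open>x_i^(k+1) q\<close> is regrouped as
        \<open>x_i^k q\<close> times \<open>x_i^(k+2) q\<close>; Cauchy-Schwarz then gives
        log-convexity.\<close>
      have "a (Suc k) = L ((pvar i ^ k * q) * (pvar i ^ Suc (Suc k) * q))"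
        by (simp add: a_def mult_ac)
      then show ?thesis
        unfolding a_def using linear_form_cauchy_schwarz[OF L psd, of "pvar i ^ k * q" "pvar i ^ Suc (Suc k) * q"] by metis
    qed
    show "a k \<le> D * (r\<^sup>2) ^ k" for k
    proof -
      have "(pvar i ^ k * q) * (pvar i ^ k * q) = q * q * monomial (axis i (2 * k))"
      proof -
        have "pvar i ^ (2 * k) = pvar i ^ k * pvar i ^ k"
          by (simp only: mult_2 power_add)
        then show ?thesis by (simp add: mult_ac flip: pvar_power)
      qed
      then show ?thesis using D[of "axis i (2 * k)"]
        by (simp add: a_def power_mult)
    qed
  qed (use assms in simp)
  then have 1: "L ((pvar i * q) * (pvar i * q)) \<le> r\<^sup>2 * L (q * q)"
    by (simp add: a_def)
  have "(L ((pvar i * q) * q))\<^sup>2 \<le> L ((pvar i * q) * (pvar i * q)) * L (q * q)"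
    by (rule linear_form_cauchy_schwarz[OF L psd])
  also have "\<dots> \<le> r\<^sup>2 * L (q * q) * L (q * q)"
    by (intro mult_right_mono 1 psd)
  also have "\<dots> = (r * L (q * q))\<^sup>2" by (simp add: power2_eq_square)
  finally show ?thesis
    using psd[of q] assms(2) by (simp add: abs_le_square_iff[symmetric])
qed

text \<open>Quantifying over all functionals of the class makes the set closed under products: after
  multiplication by one factor the functional is again in the class, so the next factor applies to
  it.\<close>

definition psd_multipliers :: "real \<Rightarrow> 'v::finite mpoly set" where
  "psd_multipliers r = {h. \<forall>L. bounded_psd r L \<longrightarrow> bounded_psd r (\<lambda>p. L (h * p))}"

lemma psd_multipliers_mult: "g \<in> psd_multipliers r \<Longrightarrow> h \<in> psd_multipliers r \<Longrightarrow> g * h \<in> psd_multipliers r"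
  by (auto simp: psd_multipliers_def mult.assoc)

lemma psd_multipliersI:
  assumes "0 < r" "\<And>L q. bounded_psd r L \<Longrightarrow> 0 \<le> L (h * (q * q))"
  shows "h \<in> psd_multipliers r"
  unfolding psd_multipliers_def
proof (intro CollectI allI impI)
  fix L :: "'a mpoly \<Rightarrow> real" assume B: "bounded_psd r L"
  then have "linear_form L" and "\<exists>C. \<forall>\<alpha>. \<bar>L (monomial \<alpha>)\<bar> \<le> C * r ^ mdeg \<alpha>"
    by (auto simp: bounded_psd_def)
  then show "bounded_psd r (\<lambda>p. L (h * p))"
    unfolding bounded_psd_def using assms(2)[OF B] linear_form_mult linear_form_growth_mult[OF _ assms(1)]
    by metis
qed

lemma psd_multipliers_basic:
  fixes i :: "'v::finite"
  assumes "0 < r"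
  shows "0 \<le> a \<Longrightarrow> (pconst a :: 'v mpoly) \<in> psd_multipliers r"
    "pconst r + pvar i \<in> psd_multipliers r" "pconst r - pvar i \<in> psd_multipliers r"
proof -
  have "0 \<le> L (pconst a * (q * q))" if "bounded_psd r L" "0 \<le> a" for L :: "'v mpoly \<Rightarrow> real" and q a
    using that by (simp add: bounded_psd_def linear_form_scale)
  then show "(pconst a :: 'v mpoly) \<in> psd_multipliers r" if "0 \<le> a"
    using psd_multipliersI[OF assms, of "pconst a :: 'v mpoly"] that by blast
  have "0 \<le> L ((pconst r + pvar i) * (q * q)) \<and> 0 \<le> L ((pconst r - pvar i) * (q * q))"
    if "bounded_psd r L" for L :: "'v mpoly \<Rightarrow> real" and q
    using bounded_psd_coord[OF that assms, of i q] that
    by (auto simp: bounded_psd_def linear_form_scale linear_form_add linear_form_diff distrib_right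
        left_diff_distrib mult.assoc)
  then show "pconst r + pvar i \<in> psd_multipliers r" "pconst r - pvar i \<in> psd_multipliers r"
    by (auto intro: psd_multipliersI assms)
qed

lemma psd_multipliers_1: "0 < r \<Longrightarrow> 1 \<in> psd_multipliers r"
  using psd_multipliers_basic(1)[of r 1] by simp

lemma psd_multipliers_power: "0 < r \<Longrightarrow> h \<in> psd_multipliers r \<Longrightarrow> h ^ k \<in> psd_multipliers r"
  by (induction k) (auto intro: psd_multipliers_mult psd_multipliers_1)

lemma psd_multipliers_prod:
  "0 < r \<Longrightarrow> (\<And>i. i \<in> A \<Longrightarrow> h i \<in> psd_multipliers r) \<Longrightarrow> (\<Prod>i\<in>A. h i) \<in> psd_multipliers r"
  by (induction A rule: infinite_finite_induct) (auto intro: psd_multipliers_mult psd_multipliers_1)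

text \<open>The Bernstein coefficients of \<open>u^a\<close> are
  \<open>(k choose a) / (N choose a)\<close>, here cleared of denominators since \<open>u\<close>
  will be a polynomial. Regrouping the binomial coefficients leaves the expansion of
  \<open>(u + (1 - u))^(N - a)\<close>, which is 1.\<close>

lemma bernstein_choose_sum:
  fixes u :: "'a::comm_ring_1"
  assumes "a \<le> N"
  shows "(\<Sum>k\<le>N. of_nat (k choose a) * (of_nat (N choose k) * u ^ k * (1 - u) ^ (N - k))) =
     of_nat (N choose a) * u ^ a"
proof -
  have "(\<Sum>k\<le>N. of_nat (k choose a) * (of_nat (N choose k) * u ^ k * (1 - u) ^ (N - k))) =
      (\<Sum>k\<in>{a..N}. of_nat (k choose a) * (of_nat (N choose k) * u ^ k * (1 - u) ^ (N - k)))"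
    by (rule sum.mono_neutral_right) (auto simp: binomial_eq_0)
  also have "\<dots> = (\<Sum>j\<le>N - a. of_nat ((a + j) choose a) * (of_nat (N choose (a + j)) * u ^ (a + j) * (1 - u) ^ (N - (a + j))))"
    by (rule sum.reindex_bij_witness[of _ "\<lambda>j. a + j" "\<lambda>k. k - a"]) (use assms in auto)
  also have "\<dots> = (\<Sum>j\<le>N - a. of_nat (N choose a) * u ^ a * (of_nat (N - a choose j) * u ^ j * (1 - u) ^ (N - a - j)))"
  proof (intro sum.cong refl)
    fix j assume j: "j \<in> {..N - a}"
    have "(N choose (a + j)) * ((a + j) choose a) = (N choose a) * ((N - a) choose j)"
      using choose_mult[of a "a + j" N] j assms by simp
    then have "of_nat ((a + j) choose a) * of_nat (N choose (a + j)) = (of_nat (N choose a) * of_nat ((N - a) choose j) :: 'a)"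
      by (metis mult.commute of_nat_mult)
    then show "of_nat ((a + j) choose a) * (of_nat (N choose (a + j)) * u ^ (a + j) * (1 - u) ^ (N - (a + j))) =
      of_nat (N choose a) * u ^ a * (of_nat (N - a choose j) * u ^ j * (1 - u) ^ (N - a - j))"
      by (simp add: power_add mult_ac) (simp add: mult.assoc[symmetric])
  qed
  also have "\<dots> = of_nat (N choose a) * u ^ a * (u + (1 - u)) ^ (N - a)"
    by (simp only: binomial_ring sum_distrib_left)
  finally show ?thesis by simp
qed

text \<open>Both sides are products of \<open>a\<close> factors, exchanged one at a time at a cost
  of at most \<open>a / (N - a)\<close> each. For \<open>k < a\<close> factors
  \<open>(k - j) / (N - j)\<close> with negative numerator occur; \<open>2 * a < N\<close> keeps
  them above -1.\<close>

lemma binomial_ratio_approx: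
  assumes "k \<le> N" "2 * a < N"
  shows "\<bar>real (k choose a) / real (N choose a) - (real k / real N) ^ a\<bar> \<le> a * (a / (N - a))"
proof -
  have ch: "real (m choose a) = (\<Prod>j<a. real m - real j) / fact a" for m
    by (simp add: binomial_gbinomial gbinomial_prod_rev atLeast0LessThan)
  have "real (k choose a) / real (N choose a) = (\<Prod>j<a. (real k - real j) / (real N - real j))"
    unfolding ch by (simp add: prod_dividef)
  moreover have "(real k / real N) ^ a = (\<Prod>j<a. real k / real N)" by simp
  moreover have "norm ((\<Prod>j<a. (real k - real j) / (real N - real j)) - (\<Prod>j<a. real k / real N)) \<le>
     (\<Sum>j<a. norm ((real k - real j) / (real N - real j) - real k / real N))"
    by (rule norm_prod_diff) (use assms in \<open>auto simp: field_simps abs_if\<close>)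
  moreover have "(\<Sum>j<a. norm ((real k - real j) / (real N - real j) - real k / real N)) \<le> (\<Sum>j<a. real a / (N - a))"
  proof (intro sum_mono)
    fix j assume "j \<in> {..<a}"
    then have j: "j < a" by simp
    have "(real k - real j) / (real N - real j) - real k / real N = - (j * (real N - k) / (real N * (real N - j)))"
      using assms j by (simp add: field_simps)
    then have "norm ((real k - real j) / (real N - real j) - real k / real N) = j * (real N - k) / (real N * (real N - j))"
      using assms j by simp
    also have "\<dots> \<le> a * real N / (real N * (real N - a))"
      using assms j by (intro frac_le mult_mono mult_pos_pos) auto
    finally show "norm ((real k - real j) / (real N - real j) - real k / real N) \<le> real a / (N - a)"
      using assms by (simp add: of_nat_diff)
  qed
  ultimately show ?thesis using assms by (simp add: of_nat_diff)
qed

lemma of_nat_pconst: "of_nat n = pconst (real n)"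
  by (simp add: pconst_def)

text \<open>The values of \<open>L\<close> on the Bernstein basis of degree \<open>N\<close> are
  weights on the grid of mesh \<open>1/N\<close>. These discrete measures have nearly the moments of
  \<open>L\<close> in the coordinates \<open>u i\<close>, with an error of order \<open>1/N\<close>,
  so a weak limit has them exactly. The affine map \<open>h\<close> returns to the original
  coordinates.\<close>

lemma moment_representation_cube:
  fixes L :: "'v::finite mpoly \<Rightarrow> real"
  assumes B: "bounded_psd r L" and r: "0 < r" and L1: "L 1 = 1"
  obtains \<nu> where "prob_space \<nu>" "sets \<nu> = sets borel" "AE x in \<nu>. \<forall>i. \<bar>x $ i\<bar> \<le> r"
    "\<And>p. L p = (\<integral>x. peval p x \<partial>\<nu>)"
proof -
  have L: "linear_form L" and psd: "\<And>q. 0 \<le> L (q * q)" using B by (auto simp: bounded_psd_def)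
  \<comment> \<open>The affine coordinate that carries the interval from \<open>-r\<close> to
    \<open>r\<close> onto the unit interval; \<open>u i\<close> and \<open>1 - u i\<close> are
    positive multiples of \<open>r + x_i\<close> and \<open>r - x_i\<close>.\<close>
  define u where "u i = pconst (1 / (2 * r)) * (pconst r + pvar i)" for i :: 'v
  have u': "1 - u i = pconst (1 / (2 * r)) * (pconst r - pvar i)" for i
  proof -
    have "pconst (1 / (2 * r)) * pconst r + pconst (1 / (2 * r)) * pconst r = (1 :: 'v mpoly)"
      using r by (simp flip: pconst_mult pconst_add)
    moreover have "pconst (1 / (2 * r)) * (pconst r - pvar i) + u i =
        pconst (1 / (2 * r)) * pconst r + pconst (1 / (2 * r)) * pconst r"
      by (simp add: u_def distrib_left right_diff_distrib)
    ultimately show ?thesis by (simp add: diff_eq_eq)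
  qed
  have pv: "pvar i = pconst (2 * r) * u i - pconst r" for i
    unfolding u_def using r by (simp add: mult.assoc[symmetric] flip: pconst_mult)
  have um: "u i \<in> psd_multipliers r" "1 - u i \<in> psd_multipliers r" for i
    unfolding u' unfolding u_def using r by (intro psd_multipliers_mult psd_multipliers_basic; simp)+
  define b where "b N i k = of_nat (N choose k) * u i ^ k * (1 - u i) ^ (N - k)" for N i k
  define A :: "nat \<Rightarrow> ('v \<Rightarrow> nat) set" where "A N = (\<Pi>\<^sub>E i\<in>UNIV. {..N})" for N
  define \<rho> where "\<rho> N a k = real (k choose a) / real (N choose a)" for N a k
  define w where "w N \<kappa> = L (\<Prod>i\<in>UNIV. b N i (\<kappa> i))" for N and \<kappa> :: "'v \<Rightarrow> nat"
  define pt :: "nat \<Rightarrow> ('v \<Rightarrow> nat) \<Rightarrow> real ^ 'v" where "pt N \<kappa> = (\<chi> i. \<kappa> i / N)" for N \<kappa>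
  define U where "U a = (\<Prod>i\<in>UNIV. u i ^ a i)" for a :: "'v \<Rightarrow> nat"
  have wn: "0 \<le> w N \<kappa>" for N \<kappa>
  proof -
    have "(\<Prod>i\<in>UNIV. b N i (\<kappa> i)) \<in> psd_multipliers r"
      unfolding b_def of_nat_pconst using r
      by (intro psd_multipliers_prod psd_multipliers_mult psd_multipliers_power um psd_multipliers_basic) auto
    then have "bounded_psd r (\<lambda>p. L ((\<Prod>i\<in>UNIV. b N i (\<kappa> i)) * p))"
      using B by (simp add: psd_multipliers_def)
    then have "0 \<le> L ((\<Prod>i\<in>UNIV. b N i (\<kappa> i)) * (1 * 1))" unfolding bounded_psd_def by blast
    then show ?thesis by (simp add: w_def)
  qed
  have finA: "finite (A N)" for N unfolding A_def by (intro finite_PiE) auto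
  \<comment> \<open>This identity is exact. An error arises only later, when the binomial ratio is
    replaced by a power of the grid point.\<close>
  have bern: "L (U a) = (\<Sum>\<kappa>\<in>A N. (\<Prod>i\<in>UNIV. \<rho> N (a i) (\<kappa> i)) * w N \<kappa>)"
    if N: "\<And>i. a i \<le> N" for a N
  proof -
    have "u i ^ a i = (\<Sum>k\<le>N. pconst (\<rho> N (a i) k) * b N i k)" for i
    proof -
      have n0: "real (N choose a i) \<noteq> 0" using N[of i] by simp
      have "pconst (inverse (real (N choose a i))) * (of_nat (N choose a i) * u i ^ a i) =
        (\<Sum>k\<le>N. pconst (\<rho> N (a i) k) * b N i k)"
        unfolding bernstein_choose_sum[OF N, symmetric] b_def
        by (simp add: sum_distrib_left of_nat_pconst pconst_mult divide_inverse mult_ac \<rho>_def)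
      moreover have "pconst (inverse (real (N choose a i))) * (of_nat (N choose a i) * u i ^ a i) = u i ^ a i"
        using n0 by (simp add: of_nat_pconst mult.assoc[symmetric] flip: pconst_mult)
      ultimately show ?thesis by simp
    qed
    then have "U a = (\<Prod>i\<in>UNIV. \<Sum>k\<in>{..N}. pconst (\<rho> N (a i) k) * b N i k)"
      unfolding U_def by simp
    also have "\<dots> = (\<Sum>\<kappa>\<in>A N. \<Prod>i\<in>UNIV. pconst (\<rho> N (a i) (\<kappa> i)) * b N i (\<kappa> i))"
      unfolding A_def by (rule prod_sum_PiE) auto
    also have "\<dots> = (\<Sum>\<kappa>\<in>A N. pconst (\<Prod>i\<in>UNIV. \<rho> N (a i) (\<kappa> i)) * (\<Prod>i\<in>UNIV. b N i (\<kappa> i)))"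
    proof -
      have "pconst (\<Prod>i\<in>I. h i) = (\<Prod>i\<in>I. pconst (h i) :: 'v mpoly)" if "finite I" for I and h :: "'v \<Rightarrow> real"
        using that by induction (auto simp: pconst_mult)
      then show ?thesis by (simp add: prod.distrib)
    qed
    finally show ?thesis by (simp add: linear_form_sum[OF L] linear_form_scale[OF L] w_def)
  qed
  \<comment> \<open>For the exponent 0 all ratios \<open>\<rho>\<close> are 1: the Bernstein basis
    is a partition of unity.\<close>
  have one: "(\<Sum>\<kappa>\<in>A N. w N \<kappa>) = 1" for N
    using bern[of "\<lambda>_. 0" N] by (simp add: U_def L1 \<rho>_def)
  have ptb: "0 \<le> pt N \<kappa> $ i \<and> pt N \<kappa> $ i \<le> 1" if "\<kappa> \<in> A N" for N \<kappa> i
    using that by (auto simp: pt_def A_def divide_le_eq_1)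
  obtain M s where M: "prob_space M" "sets M = sets borel" "strict_mono s"
    "AE x in M. \<forall>i. 0 \<le> x $ i \<and> x $ i \<le> 1"
    "\<And>g :: real ^ 'v \<Rightarrow> real. continuous_on UNIV g \<Longrightarrow>
        (\<lambda>n. \<Sum>k\<in>A (s n). w (s n) k * g (pt (s n) k)) \<longlonglongrightarrow> (\<integral>x. g x \<partial>M)"
    by (rule weak_compactness_cube[of A w pt]) (use finA wn one ptb in auto)
  interpret M: prob_space M by fact
  have LU: "L (U a) = (\<integral>x. (\<Prod>i\<in>UNIV. (x $ i) ^ a i) \<partial>M)" for a
  proof -
    let ?g = "\<lambda>x :: real ^ 'v. \<Prod>i\<in>UNIV. (x $ i) ^ a i"
    have lim: "(\<lambda>n. \<Sum>k\<in>A (s n). w (s n) k * ?g (pt (s n) k)) \<longlonglongrightarrow> (\<integral>x. ?g x \<partial>M)"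
      by (rule M(5)) (intro continuous_intros)
    define err where "err N = (\<Sum>i\<in>UNIV. a i * (a i / real (N - a i)))" for N
    have "\<bar>L (U a) - (\<Sum>k\<in>A N. w N k * ?g (pt N k))\<bar> \<le> err N" if N: "2 * (\<Sum>i\<in>UNIV. a i) < N" for N
    proof -
      have ai: "2 * a i < N" for i
        using N member_le_sum[of i UNIV a] by simp
      have aN: "a i \<le> N" for i
        using ai[of i] by simp
      have le1: "\<rho> N (a i) k \<le> 1" if "k \<le> N" for k i
        using binomial_right_mono[OF that, of "a i"] ai[of i] by (simp add: divide_le_eq_1 zero_less_binomial_iff \<rho>_def)
      have "\<bar>L (U a) - (\<Sum>k\<in>A N. w N k * ?g (pt N k))\<bar> =
         \<bar>\<Sum>k\<in>A N. w N k * ((\<Prod>i\<in>UNIV. \<rho> N (a i) (k i)) - (\<Prod>i\<in>UNIV. (k i / N) ^ a i))\<bar>"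
        by (subst bern[of a N, OF aN]) (simp add: pt_def sum_subtractf right_diff_distrib mult.commute)
      also have "\<dots> \<le> (\<Sum>k\<in>A N. w N k * err N)"
      proof (intro order.trans[OF sum_abs] sum_mono)
        fix k assume k: "k \<in> A N"
        then have kN: "k i \<le> N" for i by (auto simp: A_def)
        have "\<bar>(\<Prod>i\<in>UNIV. \<rho> N (a i) (k i)) - (\<Prod>i\<in>UNIV. (k i / N) ^ a i)\<bar> \<le>
          (\<Sum>i\<in>UNIV. \<bar>\<rho> N (a i) (k i) - (k i / N) ^ a i\<bar>)"
          unfolding real_norm_def[symmetric]
        proof (rule norm_prod_diff)
          show "norm (\<rho> N (a i) (k i)) \<le> 1" for i
            using le1[OF kN, of i] by (simp add: \<rho>_def)
          have "k i / N \<le> 1" for i using kN[of i] by (auto simp: divide_le_eq_1)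
          then show "norm ((k i / N) ^ a i) \<le> 1" for i by (simp add: power_le_one)
        qed
        also have "\<dots> \<le> err N"
          unfolding err_def \<rho>_def using binomial_ratio_approx[OF kN ai] aN
          by (intro sum_mono) (simp add: of_nat_diff)
        finally show "\<bar>w N k * ((\<Prod>i\<in>UNIV. \<rho> N (a i) (k i)) - (\<Prod>i\<in>UNIV. (k i / N) ^ a i))\<bar> \<le> w N k * err N"
          using wn by (simp add: abs_mult mult_left_mono)
      qed
      also have "\<dots> = err N" using one by (simp flip: sum_distrib_right)
      finally show ?thesis .
    qed
    then have ev: "eventually (\<lambda>N. \<bar>L (U a) - (\<Sum>k\<in>A N. w N k * ?g (pt N k))\<bar> \<le> err N) sequentially"
      by (rule eventually_mono[OF eventually_gt_at_top])
    have "err \<longlonglongrightarrow> (\<Sum>i\<in>UNIV. real (a i) * 0)" unfolding err_def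
    proof (intro tendsto_intros)
      fix i
      have "filterlim (\<lambda>N. real (N - a i)) at_top sequentially"
        by (rule filterlim_compose[OF filterlim_real_sequentially]) (rule filterlim_minus_const_nat_at_top)
      then show "(\<lambda>N. real (a i) / real (N - a i)) \<longlonglongrightarrow> 0"
        by (rule tendsto_divide_0[OF tendsto_const filterlim_mono[OF _ at_top_le_at_infinity order.refl]])
    qed
    then have "err \<longlonglongrightarrow> 0" by simp
    then have "(\<lambda>N. L (U a) - (\<Sum>k\<in>A N. w N k * ?g (pt N k))) \<longlonglongrightarrow> 0"
      by (rule Lim_null_comparison[rotated]) (use ev in simp)
    then have "(\<lambda>n. L (U a) - (\<Sum>k\<in>A (s n). w (s n) k * ?g (pt (s n) k))) \<longlonglongrightarrow> 0"
      by (rule LIMSEQ_subseq_LIMSEQ[OF _ M(3), unfolded comp_def])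
    from tendsto_diff[OF tendsto_const[of "L (U a)"] this]
    have "(\<lambda>n. \<Sum>k\<in>A (s n). w (s n) k * ?g (pt (s n) k)) \<longlonglongrightarrow> L (U a)" by simp
    from LIMSEQ_unique[OF this lim] show ?thesis .
  qed
  define h :: "real ^ 'v \<Rightarrow> real ^ 'v" where "h x = (\<chi> i. 2 * r * x $ i - r)" for x
  have hc: "continuous_on S h" for S unfolding h_def by (intro continuous_intros)
  have h: "h \<in> M \<rightarrow>\<^sub>M borel" by (rule borel_measurable_continuous_sets[OF M(2) hc])
  have pu: "peval (U a) (h x) = (\<Prod>i\<in>UNIV. (x $ i) ^ a i)" for a x
  proof -
    have "peval (u i) (h x) = x $ i" for i using r by (simp add: u_def peval_simps h_def)
    moreover have pw: "peval (p ^ k) y = peval p y ^ k" for p :: "'v mpoly" and k y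
      by (induction k) (auto simp: peval_mult)
    moreover have "peval (\<Prod>i\<in>I. f i) y = (\<Prod>i\<in>I. peval (f i) y)" if "finite I" for I y and f :: "'v \<Rightarrow> 'v mpoly"
      using that by induction (auto simp: peval_mult)
    ultimately show ?thesis by (simp add: U_def)
  qed
  have int: "integrable M (\<lambda>x. peval p (h x))" for p
  proof -
    have c: "continuous_on UNIV (\<lambda>x. peval p (h x))" by (intro continuous_intros hc)
    obtain C where C: "\<And>x. x \<in> cbox 0 1 \<Longrightarrow> norm (peval p (h x)) \<le> C"
      using compact_continuous_bound[OF compact_cbox continuous_on_subset[OF c subset_UNIV]] by blast
    show ?thesis
    proof (rule M.integrable_const_bound)
      show "AE x in M. norm (peval p (h x)) \<le> C"
        using M(4) by eventually_elim (rule C, simp add: mem_box_cart)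
      show "(\<lambda>x. peval p (h x)) \<in> borel_measurable M"
        by (rule borel_measurable_continuous_sets[OF M(2) c])
    qed
  qed
  \<comment> \<open>The factor \<open>U a\<close> is carried along because \<open>pvar i\<close> is
    affine in \<open>u i\<close>: multiplying by it leads to the exponent \<open>a\<close> raised by
    one at \<open>i\<close>.\<close>
  have main: "L (p * U a) = (\<integral>x. peval (p * U a) (h x) \<partial>M)" for p a
  proof (induction p arbitrary: a rule: mpoly_induct)
    case (const c)
    then show ?case by (simp add: linear_form_scale[OF L] peval_mult LU pu)
  next
    case (add p q)
    then show ?case by (simp add: distrib_right linear_form_add[OF L] peval_add int)
  next
    case (var i p)
    define a' where "a' = a(i := Suc (a i))"
    have Ui: "U a' = u i * U a"
    proof -
      have "U (a(i := Suc (a i))) = u i ^ Suc (a i) * (\<Prod>j\<in>UNIV - {i}. u j ^ a j)"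
        unfolding U_def by (subst prod.remove[of UNIV i]) (auto intro!: arg_cong2[of _ _ _ _ "(*)"] prod.cong)
      moreover have "U a = u i ^ a i * (\<Prod>j\<in>UNIV - {i}. u j ^ a j)"
        unfolding U_def by (rule prod.remove) auto
      ultimately show ?thesis by (simp add: mult.assoc a'_def)
    qed
    have "pvar i * p * U a = pconst (2 * r) * (p * U a') - pconst r * (p * U a)"
      unfolding Ui by (subst pv) (simp add: algebra_simps)
    then show ?case
      using var[of a] var[of a'] int[of "p * U a"] int[of "p * U a'"]
      by (simp only: linear_form_diff[OF L] linear_form_scale[OF L] peval_diff peval_mult[of "pconst _"] peval_pconst)
         simp
  qed
  show thesis
  proof (rule that[of "distr M borel h"])
    show "prob_space (distr M borel h)" by (rule M.prob_space_distr[OF h])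
    show "sets (distr M borel h) = sets borel" by simp
    have "closed {x :: real ^ 'v. \<forall>i. \<bar>x $ i\<bar> \<le> r}"
      by (intro closed_Collect_all closed_Collect_le continuous_intros)
    moreover have "\<bar>h x $ i\<bar> \<le> r" if "0 \<le> x $ i \<and> x $ i \<le> 1" for x i
      using that r mult_left_mono[of "x $ i" 1 "2 * r"] by (auto simp: h_def abs_le_iff)
    ultimately show "AE x in distr M borel h. \<forall>i. \<bar>x $ i\<bar> \<le> r"
      using M(4) by (subst AE_distr_iff[OF h]) (auto intro: borel_closed elim!: eventually_mono)
    show "L p = (\<integral>x. peval p x \<partial>distr M borel h)" for p
    proof -
      have "peval p \<in> borel_measurable borel"
        by (rule borel_measurable_continuous_onI) (intro continuous_intros)
      then show ?thesis using main[of p "\<lambda>_. 0"] by (simp add: U_def integral_distr[OF h])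
    qed
  qed
qed

section \<open>Representing measures on semialgebraic sets\<close>

lemma linear_form_bounded_psd:
  fixes L :: "'v::finite mpoly \<Rightarrow> real"
  assumes L: "linear_form L" and R: "coord_bounded gs R" "1 \<le> R" and P: "square_cone gs {p. 0 \<le> L p}"
  shows "bounded_psd R L" "\<bar>L (monomial \<alpha>)\<bar> \<le> L 1 * R ^ mdeg \<alpha>"
proof -
  have *: "\<bar>L (monomial \<alpha>)\<bar> \<le> L 1 * R ^ mdeg \<alpha>" for \<alpha>
    using coord_bounded_monomial[OF R P, of \<alpha>]
    by (auto simp: linear_form_add[OF L] linear_form_diff[OF L] linear_form_pconst[OF L] abs_le_iff mult.commute)
  then show "\<bar>L (monomial \<alpha>)\<bar> \<le> L 1 * R ^ mdeg \<alpha>" .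
  show "bounded_psd R L"
    using * L square_coneD(3)[OF P] by (auto simp: bounded_psd_def)
qed

text \<open>Makes the approximants of the Stone-Weierstrass theorem accessible to the Riesz
  functional.\<close>

lemma real_polynomial_function_peval:
  fixes f :: "real ^ 'v::finite \<Rightarrow> real"
  assumes "real_polynomial_function f"
  obtains p where "f = peval p"
proof -
  from assms have "\<exists>p. f = peval p"
  proof induction
    case (linear f)
    then interpret bounded_linear f .
    have *: "f x = (\<Sum>i\<in>UNIV. x $ i * f (axis i 1))" for x
      by (subst basis_expansion[symmetric, of x]) (simp add: sum scaleR scalar_mult_eq_scaleR)
    have "f = peval (\<Sum>i\<in>UNIV. pconst (f (axis i 1)) * pvar i)"
      by (rule ext, subst *) (simp add: peval_simps mult.commute)
    then show ?case ..
  next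
    case (const c)
    have "(\<lambda>x. c) = peval (pconst c)" by auto
    then show ?case by blast
  next
    case (add f g)
    then obtain p q where "f = peval p" "g = peval q" by blast
    then have "(\<lambda>x. f x + g x) = peval (p + q)" by (auto simp: peval_simps)
    then show ?case by blast
  next
    case (mult f g)
    then obtain p q where "f = peval p" "g = peval q" by blast
    then have "(\<lambda>x. f x * g x) = peval (p * q)" by (auto simp: peval_simps)
    then show ?case by blast
  qed
  then show thesis using that by blast
qed

text \<open>Test the hypothesis with polynomials \<open>q\<close> approximating the square root of the negative part of \<open>g\<close>.\<close>
lemma AE_nonneg_of_square_multiples:
  fixes g :: "real ^ 'v::finite \<Rightarrow> real"
  assumes "finite_measure \<nu>" and sets: "sets \<nu> = sets borel" and K: "compact K" "AE x in \<nu>. x \<in> K"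
    and g: "continuous_on UNIV g" and nn: "\<And>q. 0 \<le> (\<integral>x. g x * (peval q x)\<^sup>2 \<partial>\<nu>)"
  shows "AE x in \<nu>. 0 \<le> g x"
proof -
  interpret finite_measure \<nu> by fact
  have meas: "f \<in> borel_measurable \<nu>" if "continuous_on UNIV f" for f :: "real ^ 'v \<Rightarrow> real"
    by (rule borel_measurable_continuous_sets[OF sets that])
  define k where "k x = sqrt (max 0 (- g x))" for x
  have kc: "continuous_on S k" for S
    unfolding k_def by (intro continuous_intros continuous_on_subset[OF g]) auto
  have "\<exists>q. \<forall>x\<in>K. \<bar>k x - peval q x\<bar> < inverse (real (Suc n))" for n
  proof -
    have "0 < inverse (real (Suc n))" by simp
    from Stone_Weierstrass_real_polynomial_function[OF K(1) kc this]
    obtain f where "real_polynomial_function f" "\<And>x. x \<in> K \<Longrightarrow> \<bar>k x - f x\<bar> < inverse (real (Suc n))"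
      by metis
    moreover from this(1) obtain p where "f = peval p" by (rule real_polynomial_function_peval)
    ultimately show ?thesis by auto
  qed
  then obtain q where q: "\<And>n x. x \<in> K \<Longrightarrow> \<bar>k x - peval (q n) x\<bar> < inverse (real (Suc n))" by metis
  obtain G where G: "\<And>x. x \<in> K \<Longrightarrow> \<bar>g x\<bar> \<le> G"
    using compact_continuous_bound[OF K(1) continuous_on_subset[OF g subset_UNIV]] by auto
  obtain H where H: "\<And>x. x \<in> K \<Longrightarrow> \<bar>k x\<bar> \<le> H"
    using compact_continuous_bound[OF K(1) kc] by auto
  have lim: "(\<lambda>n. \<integral>x. g x * (peval (q n) x)\<^sup>2 \<partial>\<nu>) \<longlonglongrightarrow> (\<integral>x. g x * (k x)\<^sup>2 \<partial>\<nu>)"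
  proof (rule integral_dominated_convergence[where w = "\<lambda>_. G * (H + 1)\<^sup>2"])
    show "(\<lambda>x. g x * (k x)\<^sup>2) \<in> borel_measurable \<nu>" "(\<lambda>x. g x * (peval (q n) x)\<^sup>2) \<in> borel_measurable \<nu>" for n
      by (intro meas continuous_intros g kc)+
    show "AE x in \<nu>. (\<lambda>n. g x * (peval (q n) x)\<^sup>2) \<longlonglongrightarrow> g x * (k x)\<^sup>2"
      using K(2)
    proof eventually_elim
      case (elim x)
      have "(\<lambda>n. peval (q n) x - k x) \<longlonglongrightarrow> 0"
      proof (rule Lim_null_comparison[OF _ LIMSEQ_inverse_real_of_nat])
        show "\<forall>\<^sub>F n in sequentially. norm (peval (q n) x - k x) \<le> inverse (real (Suc n))"
          using q[OF elim] by (intro always_eventually) (auto simp: abs_minus_commute less_imp_le)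
      qed
      then have "(\<lambda>n. peval (q n) x) \<longlonglongrightarrow> k x" by (simp add: LIM_zero_iff)
      then show ?case by (intro tendsto_intros)
    qed
    show "AE x in \<nu>. norm (g x * (peval (q n) x)\<^sup>2) \<le> G * (H + 1)\<^sup>2" for n
      using K(2)
    proof eventually_elim
      case (elim x)
      have "inverse (real (Suc n)) \<le> 1" by (simp add: field_simps)
      then have "\<bar>peval (q n) x\<bar> \<le> H + 1" using q[OF elim, of n] H[OF elim] by linarith
      then have "(peval (q n) x)\<^sup>2 \<le> (H + 1)\<^sup>2"
        by (metis abs_ge_zero power2_abs power_mono)
      then show ?case using G[OF elim] by (auto simp: abs_mult intro!: mult_mono)
    qed
  qed simp
  have "0 \<le> (\<integral>x. g x * (k x)\<^sup>2 \<partial>\<nu>)"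
    by (rule LIMSEQ_le_const[OF lim]) (use nn in auto)
  \<comment> \<open>Multiplied by \<open>g\<close>, the square of \<open>k\<close> becomes minus the
    squared negative part, whose integral must therefore vanish.\<close>
  moreover have gk: "g x * (k x)\<^sup>2 = - ((max 0 (- g x))\<^sup>2)" for x
    by (auto simp: k_def max_def power2_eq_square)
  ultimately have le: "(\<integral>x. (max 0 (- g x))\<^sup>2 \<partial>\<nu>) \<le> 0" by simp
  have "integrable \<nu> (\<lambda>x. (max 0 (- g x))\<^sup>2)"
  proof (rule integrable_const_bound)
    show "AE x in \<nu>. norm ((max 0 (- g x))\<^sup>2) \<le> G\<^sup>2"
      using K(2)
    proof eventually_elim
      case (elim x)
      have "\<bar>max 0 (- g x)\<bar> \<le> \<bar>G\<bar>" using G[OF elim] by (auto simp: max_def)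
      then show ?case by (simp only: abs_le_square_iff) simp
    qed
    show "(\<lambda>x. (max 0 (- g x))\<^sup>2) \<in> borel_measurable \<nu>"
      by (intro meas continuous_intros g)
  qed
  then have "AE x in \<nu>. (max 0 (- g x))\<^sup>2 = 0"
    using le by (subst integral_nonneg_eq_0_iff_AE[symmetric]) (auto intro: antisym)
  then show ?thesis by eventually_elim (auto simp: max_def split: if_splits)
qed

text \<open>Division by the mass \<open>L 1\<close> reduces to a probability measure on a cube,
  which the constraints then confine to the semialgebraic set. If \<open>L 1 = 0\<close>, the bound
  by \<open>L 1\<close> kills every monomial and the null measure represents \<open>L\<close>; this
  occurs for the occupation measure when \<open>T = 0\<close>.\<close>

theorem moment_representation:
  fixes L :: "'v::finite mpoly \<Rightarrow> real"
  assumes L: "linear_form L" and R: "coord_bounded gs R" and P: "square_cone gs {p. 0 \<le> L p}"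
  obtains \<nu> where "finite_measure \<nu>" "sets \<nu> = sets borel" "AE x in \<nu>. x \<in> semialg gs"
    "\<And>p. L p = (\<integral>x. peval p x \<partial>\<nu>)"
proof -
  define r where "r = max 1 R"
  have R: "coord_bounded gs r" "1 \<le> r" using coord_bounded_mono[OF R] by (auto simp: r_def)
  note b = linear_form_bounded_psd[OF L R P]
  have L1: "0 \<le> L 1" using square_coneD(3)[OF P, of 1] by simp
  show thesis
  proof (cases "L 1 = 0")
    case True
    have "L p = 0" for p
    proof (induction p rule: poly_mapping_induct)
      case zero
      then show ?case by (rule linear_form_0[OF L])
    next
      case (single_add \<alpha> a p)
      then show ?case using b(2)[of \<alpha>] True
        by (simp add: linear_form_add[OF L] single_eq_pconst_mult linear_form_scale[OF L])
    qed
    then show thesis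
      by (intro that[of "null_measure borel"])
         (auto intro!: finite_measureI AE_I[where N = UNIV])
  next
    case False
    then have c: "0 < L 1" using L1 by simp
    define L' where "L' p = L p / L 1" for p
    have "bounded_psd r L'"
      unfolding bounded_psd_def
    proof (intro conjI allI exI)
      show "linear_form L'"
        using L by (auto simp: linear_form_def L'_def add_divide_distrib)
      show "0 \<le> L' (q * q)" for q using square_coneD(3)[OF P, of q] c by (simp add: L'_def)
      show "\<bar>L' (monomial \<alpha>)\<bar> \<le> 1 * r ^ mdeg \<alpha>" for \<alpha>
        using b(2)[of \<alpha>] c by (simp add: L'_def field_simps)
    qed
    moreover have "0 < r" "L' 1 = 1" using R(2) c by (auto simp: L'_def)
    ultimately obtain \<nu> where \<nu>: "prob_space \<nu>" "sets \<nu> = sets borel" "AE x in \<nu>. \<forall>i. \<bar>x $ i\<bar> \<le> r"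
      "\<And>p. L' p = (\<integral>x. peval p x \<partial>\<nu>)"
      by (rule moment_representation_cube[where L = L' and r = r]) blast
    interpret prob_space \<nu> by (rule \<nu>)
    define K where "K = cbox (\<chi> i. - r) (\<chi> i. r :: real ^ 'v)"
    have K: "compact K" "AE x in \<nu>. x \<in> K"
      using \<nu>(3) by (auto simp: K_def mem_box_cart abs_le_iff minus_le_iff elim!: eventually_mono)
    have "AE x in \<nu>. 0 \<le> peval g x" if g: "g \<in> set gs" for g
    proof (rule AE_nonneg_of_square_multiples[OF _ \<nu>(2) K])
      show "finite_measure \<nu>" by unfold_locales
      show "continuous_on UNIV (peval g)" by (intro continuous_intros)
      fix q
      have "0 \<le> L' (g * q * q)" using square_coneD(2)[OF P g, of q] c by (simp add: L'_def)
      then show "0 \<le> (\<integral>x. peval g x * (peval q x)\<^sup>2 \<partial>\<nu>)"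
        by (simp add: \<nu>(4) peval_mult power2_eq_square mult.assoc)
    qed
    then have ae: "AE x in \<nu>. x \<in> semialg gs"
      unfolding semialg_def by (simp add: AE_finite_allI)
    have meas: "peval p \<in> borel_measurable \<nu>" for p
      by (rule borel_measurable_continuous_sets[OF \<nu>(2)]) (intro continuous_intros)
    show thesis
    proof (rule that[of "density \<nu> (\<lambda>_. ennreal (L 1))"])
      show "finite_measure (density \<nu> (\<lambda>_. ennreal (L 1)))"
        by (rule finite_measureI) (simp add: emeasure_density_const emeasure_space_1 ennreal_mult_eq_top_iff)
      show "sets (density \<nu> (\<lambda>_. ennreal (L 1))) = sets borel" using \<nu>(2) by simp
      show "AE x in density \<nu> (\<lambda>_. ennreal (L 1)). x \<in> semialg gs"
        using ae by (subst AE_density) auto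
      show "L p = (\<integral>x. peval p x \<partial>density \<nu> (\<lambda>_. ennreal (L 1)))" for p
      proof -
        have "L p = L 1 * L' p" using c by (simp add: L'_def)
        then show ?thesis using meas[of p] L1 by (subst integral_density) (simp_all add: \<nu>(4))
      qed
    qed
  qed
qed

section \<open>Polynomial approximation in the \<open>C\<^sup>1\<close> norm\<close>

text \<open>Landau's kernel: being a polynomial, it turns convolutions into polynomials. It is a
  genuine weight on the ball of radius \<open>\<rho>\<close>, which has to contain the box of
  integration.\<close>

definition landau_kernel :: "real \<Rightarrow> nat \<Rightarrow> 'a::euclidean_space \<Rightarrow> real" where
  "landau_kernel \<rho> j z = (1 - (z \<bullet> z) / \<rho>\<^sup>2) ^ j"

abbreviation sym_box :: "real \<Rightarrow> 'a::euclidean_space set" where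
  "sym_box a \<equiv> cbox (- (a *\<^sub>R One)) (a *\<^sub>R One)"

text \<open>Values in a Banach space are allowed so that one estimate serves both a function and its
  derivative.\<close>

definition landau_mean :: "real \<Rightarrow> real \<Rightarrow> nat \<Rightarrow> ('a::euclidean_space \<Rightarrow> 'b::banach) \<Rightarrow> 'a \<Rightarrow> 'b" where
  "landau_mean a \<rho> j G x = (1 / integral (sym_box a) (landau_kernel \<rho> j :: 'a \<Rightarrow> real)) *\<^sub>R
     integral (sym_box a) (\<lambda>z. landau_kernel \<rho> j z *\<^sub>R G (x - z))"

lemma mem_sym_box: "x \<in> sym_box a \<longleftrightarrow> (\<forall>b\<in>Basis. \<bar>x \<bullet> b\<bar> \<le> a)"
  by (auto simp: mem_box abs_le_iff)

lemma norm_le_sym_box: "x \<in> sym_box a \<Longrightarrow> norm (x :: 'a::euclidean_space) \<le> real DIM('a) * a"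
  using norm_le_l1[of x] sum_bounded_above[of Basis "\<lambda>b. \<bar>x \<bullet> b\<bar>" a] by (auto simp: mem_sym_box)

lemma cball_subset_sym_box: "cball 0 a \<subseteq> sym_box a"
  using Basis_le_norm order.trans by (fastforce simp: mem_sym_box)

lemma continuous_on_landau_kernel [continuous_intros]:
  "continuous_on S h \<Longrightarrow> continuous_on S (\<lambda>x. landau_kernel \<rho> j (h x))"
  unfolding landau_kernel_def divide_inverse by (intro continuous_intros)

lemma landau_kernel_bounds:
  assumes "0 < \<rho>" "norm z \<le> \<rho>"
  shows "0 \<le> landau_kernel \<rho> j z"
    "d \<le> norm z \<Longrightarrow> 0 \<le> d \<Longrightarrow> landau_kernel \<rho> j z \<le> (1 - d\<^sup>2 / \<rho>\<^sup>2) ^ j"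
    "norm z \<le> d \<Longrightarrow> d \<le> \<rho> \<Longrightarrow> (1 - d\<^sup>2 / \<rho>\<^sup>2) ^ j \<le> landau_kernel \<rho> j z"
proof -
  have zz: "z \<bullet> z = (norm z)\<^sup>2" by (simp add: dot_square_norm)
  have le: "(norm z)\<^sup>2 \<le> \<rho>\<^sup>2" using assms by (intro power_mono) auto
  then have 0: "0 \<le> 1 - (z \<bullet> z) / \<rho>\<^sup>2" using assms by (simp add: zz field_simps)
  then show "0 \<le> landau_kernel \<rho> j z" by (simp add: landau_kernel_def)
  show "landau_kernel \<rho> j z \<le> (1 - d\<^sup>2 / \<rho>\<^sup>2) ^ j" if "d \<le> norm z" "0 \<le> d"
    unfolding landau_kernel_def
    by (rule power_mono[OF _ 0]) (use that in \<open>auto simp: zz intro!: divide_right_mono power_mono\<close>)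
  show "(1 - d\<^sup>2 / \<rho>\<^sup>2) ^ j \<le> landau_kernel \<rho> j z" if "norm z \<le> d" "d \<le> \<rho>"
  proof -
    have "d\<^sup>2 \<le> \<rho>\<^sup>2" using that norm_ge_zero[of z] by (intro power_mono) linarith+
    then have "0 \<le> 1 - d\<^sup>2 / \<rho>\<^sup>2" using assms by (simp add: field_simps)
    then show ?thesis
      unfolding landau_kernel_def
      by (rule power_mono[rotated]) (use that in \<open>auto simp: zz intro!: divide_right_mono power_mono\<close>)
  qed
qed

text \<open>The mass of the kernel outside a \<open>\<delta>\<close>-ball is exponentially smaller than its mass inside a
  smaller box.\<close>
lemma landau_kernel_approx_identity:
  fixes G :: "'a::euclidean_space \<Rightarrow> 'b::banach" and a \<rho> e :: real
  assumes G: "continuous_on UNIV G" and K: "compact K" and a: "0 < a" and \<rho>: "real DIM('a) * a \<le> \<rho>" and e: "0 < e"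
  shows "\<forall>\<^sub>F j in sequentially. \<forall>x\<in>K. norm (landau_mean a \<rho> j G x - G x) \<le> e"
proof -
  define B where "B = (sym_box a :: 'a set)"
  have \<rho>0: "0 < \<rho>" using a \<rho> by (intro less_le_trans[OF _ \<rho>]) simp
  have cB: "compact B" unfolding B_def by (rule compact_cbox)
  have nB: "norm z \<le> \<rho>" if "z \<in> B" for z
    using norm_le_sym_box[of z a] that \<rho> by (simp add: B_def)
  have B0: "0 \<in> B" using a by (simp add: B_def mem_sym_box)
  \<comment> \<open>A compact set with all arguments \<open>x - z\<close> that occur; it contains
    \<open>K\<close> since 0 lies in the box.\<close>
  define S where "S = (\<lambda>(x, z). x - z) ` (K \<times> B)"
  have cS: "compact S" unfolding S_def
    by (intro compact_continuous_image compact_Times K cB) (auto intro!: continuous_intros simp: split_def)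
  have KS: "x \<in> S" if "x \<in> K" for x
    using that B0 by (auto simp: S_def intro!: rev_image_eqI[of "(x, 0)"])
  have KBS: "x - z \<in> S" if "x \<in> K" "z \<in> B" for x z
    using that by (auto simp: S_def)
  have GS: "continuous_on S G" by (rule continuous_on_subset[OF G]) auto
  obtain M where M: "\<And>y. y \<in> S \<Longrightarrow> norm (G y) \<le> M"
    using compact_continuous_bound[OF cS GS] by blast
  define M' where "M' = \<bar>M\<bar>"
  have M': "norm (G y) \<le> M'" "0 \<le> M'" if "y \<in> S" for y using M[OF that] by (auto simp: M'_def)
  have M'0: "0 \<le> M'" by (simp add: M'_def)
  have "uniformly_continuous_on S G" by (rule compact_uniformly_continuous[OF GS cS])
  then obtain \<delta>0 where \<delta>0: "\<delta>0 > 0" "\<And>x y. x \<in> S \<Longrightarrow> y \<in> S \<Longrightarrow> dist x y < \<delta>0 \<Longrightarrow> dist (G x) (G y) < e / 2"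
    using e unfolding uniformly_continuous_on_def by (metis half_gt_zero)
  \<comment> \<open>The cap at \<open>\<rho>\<close> keeps \<open>q1\<close> below
    nonnegative.\<close>
  define \<delta> where "\<delta> = min \<delta>0 \<rho>"
  have \<delta>: "0 < \<delta>" "\<delta> \<le> \<rho>" "\<delta> \<le> \<delta>0" using \<delta>0 \<rho>0 by (auto simp: \<delta>_def)
  \<comment> \<open>A point of a box has norm at most the dimension times the half side, so this box
    lies in the ball of radius \<open>\<delta> / 2\<close>.\<close>
  define b where "b = min a (\<delta> / 2 / DIM('a))"
  have b: "0 < b" "b \<le> a" using a \<delta> by (auto simp: b_def)
  define B' where "B' = (sym_box b :: 'a set)"
  have B'B: "B' \<subseteq> B" using b by (fastforce simp: B'_def B_def mem_sym_box)
  have nB': "norm z \<le> \<delta> / 2" if "z \<in> B'" for z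
  proof -
    have "norm z \<le> real DIM('a) * b" using that norm_le_sym_box by (auto simp: B'_def)
    also have "\<dots> \<le> DIM('a) * (\<delta> / 2 / DIM('a))" by (intro mult_left_mono) (auto simp: b_def)
    finally show ?thesis by simp
  qed
  have cont: "continuous_on T (landau_kernel \<rho> j :: 'a \<Rightarrow> real)" for T j
    by (rule continuous_on_landau_kernel) (rule continuous_on_id)
  define N where "N j = integral B (landau_kernel \<rho> j)" for j
  \<comment> \<open>\<open>q1 ^ j\<close> bounds the kernel from above outside the
    \<open>\<delta>\<close>-ball, \<open>q2 ^ j\<close> from below inside the ball of half that
    radius. Halving the radius makes \<open>q1 < q2\<close> strict, so the quotient decays
    geometrically.\<close>
  define q1 where "q1 = 1 - \<delta>\<^sup>2 / \<rho>\<^sup>2"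
  define q2 where "q2 = 1 - (\<delta> / 2)\<^sup>2 / \<rho>\<^sup>2"
  have dle: "\<delta>\<^sup>2 \<le> \<rho>\<^sup>2" using \<delta> by (intro power_mono) auto
  have q1: "0 \<le> q1" using dle \<rho>0 by (simp add: q1_def field_simps)
  have "(\<delta> / 2)\<^sup>2 < \<delta>\<^sup>2" by (rule power_strict_mono) (use \<delta> in auto)
  then have "(\<delta> / 2)\<^sup>2 / \<rho>\<^sup>2 < \<delta>\<^sup>2 / \<rho>\<^sup>2"
    using \<rho>0 by (intro divide_strict_right_mono) auto
  then have q12: "q1 < q2" by (simp only: q1_def q2_def)
  have cB': "measure lborel B' > 0" unfolding B'_def using b by (intro content_pos_lt) (simp add: inner_simps)
  have intk: "landau_kernel \<rho> j integrable_on B" "landau_kernel \<rho> j integrable_on B'" for j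
    unfolding B_def B'_def by (intro integrable_continuous cont)+
  have Nlow: "measure lborel B' * q2 ^ j \<le> N j" for j
  proof -
    have "measure lborel B' * q2 ^ j = integral B' (\<lambda>_. q2 ^ j)" by (simp add: B'_def)
    also have "\<dots> \<le> integral B' (landau_kernel \<rho> j)"
    proof (rule integral_le)
      show "(\<lambda>_. q2 ^ j) integrable_on B'" by (simp add: B'_def integrable_const)
      show "q2 ^ j \<le> landau_kernel \<rho> j z" if "z \<in> B'" for z
        unfolding q2_def using \<delta> nB' nB B'B that \<rho>0 by (intro landau_kernel_bounds(3)) auto
    qed (rule intk)
    also have "\<dots> \<le> N j"
      unfolding N_def using B'B intk landau_kernel_bounds(1)[OF \<rho>0 nB] by (intro integral_subset_le) auto
    finally show ?thesis .
  qed
  have Npos: "0 < N j" for j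
    using cB' q1 q12 by (intro less_le_trans[OF _ Nlow] mult_pos_pos zero_less_power) auto
  have est: "norm (landau_mean a \<rho> j G x - G x) \<le>
      e / 2 + 2 * M' * measure lborel B / measure lborel B' * (q1 / q2) ^ j" if x: "x \<in> K" for x j
  proof -
    let ?k = "landau_kernel \<rho> j :: 'a \<Rightarrow> real"
    have i1: "(\<lambda>z. ?k z *\<^sub>R G (x - z)) integrable_on B"
      unfolding B_def by (intro integrable_continuous continuous_intros cont continuous_on_compose2[OF G]) auto
    have i2: "((\<lambda>z. ?k z *\<^sub>R G x) has_integral (N j *\<^sub>R G x)) B"
      unfolding N_def by (intro has_integral_scaleR_left integrable_integral intk)
    have "landau_mean a \<rho> j G x - G x =
        (1 / N j) *\<^sub>R (integral B (\<lambda>z. ?k z *\<^sub>R G (x - z)) - N j *\<^sub>R G x)"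
      using Npos[of j] by (simp add: scaleR_right_diff_distrib landau_mean_def flip: B_def N_def)
    also have "integral B (\<lambda>z. ?k z *\<^sub>R G (x - z)) - N j *\<^sub>R G x = integral B (\<lambda>z. ?k z *\<^sub>R (G (x - z) - G x))"
      using Henstock_Kurzweil_Integration.integral_diff[OF i1 has_integral_integrable[OF i2]] integral_unique[OF i2]
      by (simp add: scaleR_right_diff_distrib)
    finally have eq: "norm (landau_mean a \<rho> j G x - G x) =
        norm (integral B (\<lambda>z. ?k z *\<^sub>R (G (x - z) - G x))) / N j"
      using Npos[of j] by simp
    have "norm (integral B (\<lambda>z. ?k z *\<^sub>R (G (x - z) - G x))) \<le> integral B (\<lambda>z. e / 2 * ?k z + 2 * M' * q1 ^ j)"
    proof (rule Henstock_Kurzweil_Integration.integral_norm_bound_integral)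
      show "(\<lambda>z. ?k z *\<^sub>R (G (x - z) - G x)) integrable_on B"
        unfolding B_def by (intro integrable_continuous continuous_intros cont continuous_on_compose2[OF G]) auto
      show "(\<lambda>z. e / 2 * ?k z + 2 * M' * q1 ^ j) integrable_on B"
        unfolding B_def by (intro integrable_continuous continuous_intros cont)
      fix z assume z: "z \<in> B"
      have k0: "0 \<le> ?k z" by (rule landau_kernel_bounds(1)[OF \<rho>0 nB[OF z]])
      show "norm (?k z *\<^sub>R (G (x - z) - G x)) \<le> e / 2 * ?k z + 2 * M' * q1 ^ j"
      proof (cases "norm z < \<delta>")
        case True
        then have "dist (G (x - z)) (G x) < e / 2"
          using \<delta> KS[OF x] KBS[OF x z] by (intro \<delta>0(2)) (auto simp: dist_norm)
        then have "?k z * norm (G (x - z) - G x) \<le> ?k z * (e / 2)"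
          using k0 by (intro mult_left_mono) (auto simp: dist_norm)
        moreover have "0 \<le> 2 * M' * q1 ^ j" using M'0 q1 by simp
        moreover have "norm (?k z *\<^sub>R (G (x - z) - G x)) = ?k z * norm (G (x - z) - G x)"
          using k0 by simp
        ultimately show ?thesis by (simp only: mult.commute[of "?k z" "e / 2"])
      next
        case False
        have "norm (G (x - z) - G x) \<le> 2 * M'"
          using norm_triangle_ineq4[of "G (x - z)" "G x"] M'[OF KBS[OF x z]] M'[OF KS[OF x]] by linarith
        moreover have "?k z \<le> q1 ^ j"
          unfolding q1_def using False \<delta> by (intro landau_kernel_bounds(2)[OF \<rho>0 nB[OF z]]) auto
        ultimately have "?k z * norm (G (x - z) - G x) \<le> q1 ^ j * (2 * M')"
          using k0 q1 by (intro mult_mono) auto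
        moreover have "0 \<le> e / 2 * ?k z" using k0 e by simp
        ultimately show ?thesis using k0 by (simp add: mult_ac)
      qed
    qed
    also have "\<dots> = e / 2 * N j + 2 * M' * q1 ^ j * measure lborel B"
    proof (rule integral_unique)
      have "((\<lambda>z. e / 2 * ?k z + 2 * M' * q1 ^ j) has_integral e / 2 * N j + measure lborel B *\<^sub>R (2 * M' * q1 ^ j)) B"
        unfolding N_def using intk(1)[of j] unfolding B_def
        by (intro has_integral_add has_integral_mult_right integrable_integral has_integral_const)
      then show "((\<lambda>z. e / 2 * ?k z + 2 * M' * q1 ^ j) has_integral e / 2 * N j + 2 * M' * q1 ^ j * measure lborel B) B"
        by (simp add: mult_ac)
    qed
    finally have "norm (landau_mean a \<rho> j G x - G x) \<le>
        (e / 2 * N j + 2 * M' * q1 ^ j * measure lborel B) / N j"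
      unfolding eq using Npos[of j] by (intro divide_right_mono) auto
    also have "\<dots> = e / 2 + 2 * M' * measure lborel B * q1 ^ j / N j"
      using Npos[of j] by (simp add: field_simps)
    also have "\<dots> \<le> e / 2 + 2 * M' * measure lborel B * q1 ^ j / (measure lborel B' * q2 ^ j)"
      using Nlow[of j] cB' q1 q12 M'0
      by (intro add_left_mono divide_left_mono mult_pos_pos mult_nonneg_nonneg Npos) auto
    finally show ?thesis by (simp add: power_divide)
  qed
  have "(\<lambda>j. e / 2 + 2 * M' * measure lborel B / measure lborel B' * (q1 / q2) ^ j) \<longlonglongrightarrow> e / 2 + 2 * M' * measure lborel B / measure lborel B' * 0"
    using q1 q12 by (intro tendsto_intros LIMSEQ_power_zero) auto
  then have "\<forall>\<^sub>F j in sequentially. e / 2 + 2 * M' * measure lborel B / measure lborel B' * (q1 / q2) ^ j < e"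
    by (rule order_tendstoD(2)) (use e in simp)
  then show ?thesis
    by eventually_elim (blast intro: order.trans[OF est less_imp_le])
qed

text \<open>Testing against every continuous weight \<open>w\<close> makes the class stable under
  multiplication by \<open>P (x - y)\<close>. This shows by induction on \<open>P\<close> that
  convolutions are polynomials, with no expansion into monomials.\<close>

definition poly_kernel :: "'a::euclidean_space set \<Rightarrow> ('a \<Rightarrow> 'a \<Rightarrow> real) \<Rightarrow> bool" where
  "poly_kernel B Q \<longleftrightarrow> (\<forall>x. continuous_on UNIV (Q x)) \<and>
     (\<forall>w. continuous_on UNIV w \<longrightarrow> real_polynomial_function (\<lambda>x. integral B (\<lambda>y. Q x y * w y)))"

text \<open>For linear \<open>f\<close> the factor \<open>f (x - y)\<close> is
  \<open>f x - f y\<close>: the first part leaves the integral, the second joins the weight.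
  Products apply the induction hypothesis twice, hence the arbitrary \<open>Q\<close>.\<close>

lemma poly_kernel_mult:
  assumes "real_polynomial_function P" "poly_kernel (cbox a b) Q"
  shows "poly_kernel (cbox a b) (\<lambda>x y. P (x - y) * Q x y)"
  using assms
proof (induction arbitrary: Q)
  case (linear f)
  note lin = this
  interpret bounded_linear f by (rule lin)
  have Q: "continuous_on UNIV (Q x)" for x using lin by (auto simp: poly_kernel_def)
  have cf: "continuous_on UNIV f" by (rule linear_continuous_on[OF lin(1)])
  show ?case unfolding poly_kernel_def
  proof (intro conjI allI impI)
    show "continuous_on UNIV (\<lambda>y. f (x - y) * Q x y)" for x
      by (intro continuous_intros continuous_on_compose2[OF cf] Q) auto
    fix w :: "'a \<Rightarrow> real" assume w: "continuous_on UNIV w"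
    have fw: "continuous_on UNIV (\<lambda>y. f y * w y)" by (intro continuous_intros cf w)
    have i: "(\<lambda>y. Q x y * w y) integrable_on cbox a b" "(\<lambda>y. Q x y * (f y * w y)) integrable_on cbox a b" for x
      by (intro integrable_continuous continuous_intros continuous_on_subset[OF Q] continuous_on_subset[OF w]
           continuous_on_subset[OF cf]; simp)+
    have "integral (cbox a b) (\<lambda>y. f (x - y) * Q x y * w y) =
       f x * integral (cbox a b) (\<lambda>y. Q x y * w y) - integral (cbox a b) (\<lambda>y. Q x y * (f y * w y))" for x
    proof -
      have "(\<lambda>y. f (x - y) * Q x y * w y) = (\<lambda>y. f x * (Q x y * w y) - Q x y * (f y * w y))"
        by (auto simp: diff algebra_simps)
      moreover have "((\<lambda>y. f x * (Q x y * w y) - Q x y * (f y * w y)) has_integral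
          f x * integral (cbox a b) (\<lambda>y. Q x y * w y) - integral (cbox a b) (\<lambda>y. Q x y * (f y * w y))) (cbox a b)"
        by (intro has_integral_diff has_integral_mult_right integrable_integral i)
      ultimately show ?thesis by (simp only: integral_unique)
    qed
    moreover have "real_polynomial_function (\<lambda>x. integral (cbox a b) (\<lambda>y. Q x y * w y))"
      "real_polynomial_function (\<lambda>x. integral (cbox a b) (\<lambda>y. Q x y * (f y * w y)))"
      using lin w fw by (auto simp: poly_kernel_def)
    ultimately show "real_polynomial_function (\<lambda>x. integral (cbox a b) (\<lambda>y. f (x - y) * Q x y * w y))"
      using lin(1) by (simp only: real_polynomial_function_diff real_polynomial_function.intros)
  qed
next
  case (const c)
  then show ?case unfolding poly_kernel_def
    by (auto intro!: continuous_intros simp: mult.assoc)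
next
  case (add f g)
  from add.IH(1)[OF add.prems] add.IH(2)[OF add.prems]
  have F: "continuous_on UNIV (\<lambda>y. f (x - y) * Q x y)"
    and G: "continuous_on UNIV (\<lambda>y. g (x - y) * Q x y)" for x
    by (auto simp: poly_kernel_def)
  show ?case unfolding poly_kernel_def
  proof (intro conjI allI impI)
    show "continuous_on UNIV (\<lambda>y. (f (x - y) + g (x - y)) * Q x y)" for x
      using continuous_on_add[OF F G] by (simp add: distrib_right)
    fix w :: "'a \<Rightarrow> real" assume w: "continuous_on UNIV w"
    have "integral (cbox a b) (\<lambda>y. (f (x - y) + g (x - y)) * Q x y * w y) =
       integral (cbox a b) (\<lambda>y. f (x - y) * Q x y * w y) + integral (cbox a b) (\<lambda>y. g (x - y) * Q x y * w y)" for x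
      unfolding distrib_right
      by (intro Henstock_Kurzweil_Integration.integral_add integrable_continuous continuous_on_mult
          continuous_on_subset[OF F] continuous_on_subset[OF G] continuous_on_subset[OF w]) auto
    then show "real_polynomial_function (\<lambda>x. integral (cbox a b) (\<lambda>y. (f (x - y) + g (x - y)) * Q x y * w y))"
      using add.IH(1)[OF add.prems] add.IH(2)[OF add.prems] w by (auto simp: poly_kernel_def)
  qed
next
  case (mult f g)
  from mult.IH(1)[OF mult.IH(2)[OF mult.prems]] show ?case by (simp add: mult.assoc)
qed

lemma real_polynomial_function_landau_kernel: "real_polynomial_function (landau_kernel \<rho> j :: 'a::euclidean_space \<Rightarrow> real)"
proof -
  have "real_polynomial_function (\<lambda>z :: 'a. (1 - (\<Sum>b\<in>Basis. (z \<bullet> b) * (z \<bullet> b)) * inverse (\<rho>\<^sup>2)) ^ j)"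
  proof (rule real_polynomial_function_power, rule real_polynomial_function_diff, rule real_polynomial_function.intros(2))
    have "real_polynomial_function (\<lambda>z :: 'a. \<Sum>b\<in>Basis. (z \<bullet> b) * (z \<bullet> b))"
      by (rule real_polynomial_function_sum, simp)
         (rule real_polynomial_function.intros(4); rule real_polynomial_function.intros(1); rule bounded_linear_inner_left)
    then show "real_polynomial_function (\<lambda>z :: 'a. (\<Sum>b\<in>Basis. (z \<bullet> b) * (z \<bullet> b)) * inverse (\<rho>\<^sup>2))"
      by (rule real_polynomial_function.intros(4)[OF _ real_polynomial_function.intros(2)])
  qed
  moreover have "(\<lambda>z :: 'a. (1 - (\<Sum>b\<in>Basis. (z \<bullet> b) * (z \<bullet> b)) * inverse (\<rho>\<^sup>2)) ^ j) = landau_kernel \<rho> j"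
    by (rule ext) (simp only: landau_kernel_def divide_inverse euclidean_inner[symmetric])
  ultimately show ?thesis by simp
qed

section \<open>Approximation with compact support, and cutoff functions\<close>

definition C1_deriv :: "('a::real_normed_vector \<Rightarrow> real) \<Rightarrow> ('a \<Rightarrow> 'a \<Rightarrow>\<^sub>L real) \<Rightarrow> bool" where
  "C1_deriv f f' \<longleftrightarrow> (\<forall>x. (f has_derivative blinfun_apply (f' x)) (at x)) \<and> continuous_on UNIV f'"

text \<open>Convolution commutes with differentiation, so one index \<open>j\<close> of the kernel
  serves \<open>w\<close> and \<open>w'\<close>. The integral over \<open>z\<close> is the form that
  can be differentiated; after substitution, the integral over \<open>y\<close> on a fixed box is
  the form that is visibly a polynomial. They agree on a ball around \<open>K\<close>.\<close>

lemma C1_polynomial_approximation_compact_support: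
  fixes w :: "'a::euclidean_space \<Rightarrow> real"
  assumes w: "C1_deriv w w'" and C: "compact C" "\<And>x. x \<notin> C \<Longrightarrow> w x = 0"
    and K: "compact K" and e: "0 < e"
  obtains p p' where "real_polynomial_function p" "\<And>x. x \<in> K \<Longrightarrow> (p has_derivative p' x) (at x)"
    "\<And>x. x \<in> K \<Longrightarrow> \<bar>p x - w x\<bar> \<le> e" "\<And>x h. x \<in> K \<Longrightarrow> \<bar>p' x h - w' x h\<bar> \<le> e * norm h"
proof -
  have wd: "\<And>x. (w has_derivative blinfun_apply (w' x)) (at x)" and w'c: "continuous_on UNIV w'"
    using w by (auto simp: C1_deriv_def)
  have wc: "continuous_on UNIV w"
    by (meson wd has_derivative_continuous continuous_at_imp_continuous_on)
  obtain m where m: "\<And>x. x \<in> C \<union> K \<Longrightarrow> norm x \<le> m" and m0: "m > 0"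
    using compact_imp_bounded[OF compact_Un[OF C(1) K]] unfolding bounded_pos by blast
  define M where "M = m + 1"
  have M: "C \<subseteq> sym_box M"
    using m cball_subset_sym_box[of M] by (force simp: M_def)
  have KM: "K \<subseteq> ball 0 M"
  proof
    fix x assume "x \<in> K"
    then have "norm x \<le> m" using m by blast
    then show "x \<in> ball 0 M" by (simp add: M_def)
  qed
  \<comment> \<open>For \<open>x\<close> in the ball of radius \<open>M\<close> the box of half side
    \<open>2 * M\<close> centred at \<open>x\<close> still contains the support box.\<close>
  define a where "a = 2 * M"
  define B :: "'a set" where "B = sym_box a"
  define \<rho> where "\<rho> = real DIM('a) * a"
  have a0: "0 < a" using m0 by (simp add: a_def M_def)
  have "\<forall>\<^sub>F j in sequentially. (\<forall>x\<in>K. norm (landau_mean a \<rho> j w x - w x) \<le> e) \<and>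
     (\<forall>x\<in>K. norm (landau_mean a \<rho> j w' x - w' x) \<le> e)"
    unfolding \<rho>_def
    by (rule eventually_conj[OF landau_kernel_approx_identity[OF wc K a0 order.refl e]
          landau_kernel_approx_identity[OF w'c K a0 order.refl e]])
  then obtain j where j: "\<And>x. x \<in> K \<Longrightarrow> norm (landau_mean a \<rho> j w x - w x) \<le> e"
     "\<And>x. x \<in> K \<Longrightarrow> norm (landau_mean a \<rho> j w' x - w' x) \<le> e"
    using eventually_happens by force
  define c where "c = 1 / integral B (landau_kernel \<rho> j)"
  let ?k = "landau_kernel \<rho> j :: 'a \<Rightarrow> real"
  define p where "p x = c * integral (sym_box M) (\<lambda>y. ?k (x - y) * w y)" for x
  have poly: "real_polynomial_function p"
  proof -
    have "poly_kernel (sym_box M :: 'a set) (\<lambda>x y. 1)"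
      unfolding poly_kernel_def by auto
    from poly_kernel_mult[OF real_polynomial_function_landau_kernel this] wc
    have "real_polynomial_function (\<lambda>x. integral (sym_box M) (\<lambda>y. ?k (x - y) * w y))"
      by (auto simp: poly_kernel_def)
    then show ?thesis unfolding p_def by auto
  qed
  have conv: "integral B (\<lambda>z. ?k z *\<^sub>R w (x - z)) = integral (sym_box M) (\<lambda>y. ?k (x - y) * w y)"
    if x: "x \<in> ball 0 M" for x
  proof -
    let ?F = "\<lambda>y. ?k (x - y) * w y"
    have "integral B (\<lambda>z. ?k z *\<^sub>R w (x - z)) = integral (sym_box a) (\<lambda>z. (?F \<circ> (+) x) (- z))"
      by (simp add: B_def)
    also have "\<dots> = integral (sym_box a) (?F \<circ> (+) x)"
      using integral_reflect[of "a *\<^sub>R One" "- (a *\<^sub>R One)" "?F \<circ> (+) x"] by simp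
    also have "\<dots> = integral (cbox (- (a *\<^sub>R One) + x) (a *\<^sub>R One + x)) ?F"
      by (rule integral_shift_cbox_plus)
    also have "\<dots> = integral (sym_box M) ?F"
    proof -
      have "\<bar>x \<bullet> b\<bar> \<le> M" if "b \<in> Basis" for b
        using x Basis_le_norm[OF that, of x] by simp
      then have "- (a *\<^sub>R One) \<bullet> b + x \<bullet> b \<le> - (M *\<^sub>R One) \<bullet> b \<and> (M *\<^sub>R One) \<bullet> b \<le> (a *\<^sub>R One) \<bullet> b + x \<bullet> b"
        if "b \<in> Basis" for b
        using that by (fastforce simp: a_def abs_le_iff)
      then have "sym_box M \<subseteq> cbox (- (a *\<^sub>R One) + x) (a *\<^sub>R One + x)"
        by (intro subset_box_imp) (simp add: inner_add_left inner_diff_left)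
      moreover have "?F y = 0" if "y \<notin> sym_box M" for y using that M C(2) by auto
      ultimately have "(\<lambda>y. if y \<in> cbox (- (a *\<^sub>R One) + x) (a *\<^sub>R One + x) then ?F y else 0) =
          (\<lambda>y. if y \<in> sym_box M then ?F y else 0)"
        by (auto simp: fun_eq_iff)
      from arg_cong[OF this, of "integral UNIV"] show ?thesis by (simp only: integral_restrict_UNIV)
    qed
    finally show ?thesis .
  qed
  define D where "D x = landau_mean a \<rho> j w' x" for x
  have der: "(p has_derivative blinfun_apply (D x)) (at x)" if x: "x \<in> ball 0 M" for x
  proof -
    have "((\<lambda>x. integral B (\<lambda>z. ?k z *\<^sub>R w (x - z))) has_derivative
        integral B (\<lambda>z. ?k z *\<^sub>R w' (x - z))) (at x within UNIV)"
      unfolding B_def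
    proof (rule leibniz_rule)
      fix x z :: 'a
      have "((\<lambda>x. w (x - z)) has_derivative (\<lambda>h. blinfun_apply (w' (x - z)) (h - 0))) (at x)"
        by (rule has_derivative_compose[OF _ wd, of "\<lambda>x. x - z"]) (intro derivative_intros)
      then show "((\<lambda>x. ?k z *\<^sub>R w (x - z)) has_derivative blinfun_apply (?k z *\<^sub>R w' (x - z))) (at x within UNIV)"
        by (auto intro!: derivative_eq_intros simp: blinfun.scaleR_left)
    next
      show "(\<lambda>z. ?k z *\<^sub>R w (x - z)) integrable_on sym_box a" for x
        by (intro integrable_continuous continuous_intros continuous_on_compose2[OF wc]) auto
      show "continuous_on (UNIV \<times> sym_box a) (\<lambda>(x, z). ?k z *\<^sub>R w' (x - z))"
        unfolding split_def by (intro continuous_intros continuous_on_compose2[OF w'c]) auto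
    qed auto
    then have "((\<lambda>x. c * integral B (\<lambda>z. ?k z *\<^sub>R w (x - z))) has_derivative
        (\<lambda>h. c * blinfun_apply (integral B (\<lambda>z. ?k z *\<^sub>R w' (x - z))) h)) (at x)"
      by (rule has_derivative_mult_right)
    also have "(\<lambda>h. c * blinfun_apply (integral B (\<lambda>z. ?k z *\<^sub>R w' (x - z))) h) = blinfun_apply (D x)"
      by (simp add: fun_eq_iff D_def landau_mean_def c_def B_def blinfun.scaleR_left)
    finally have "((\<lambda>x. c * integral B (\<lambda>z. ?k z *\<^sub>R w (x - z))) has_derivative blinfun_apply (D x)) (at x)" .
    then show ?thesis
      by (rule has_derivative_transform_within_open[OF _ open_ball x]) (simp only: conv p_def)
  qed
  show thesis
  proof (rule that[OF poly])
    show "(p has_derivative blinfun_apply (D x)) (at x)" if "x \<in> K" for x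
      using der KM that by blast
    show "\<bar>p x - w x\<bar> \<le> e" if "x \<in> K" for x
      using j(1)[OF that] conv[of x] KM that by (auto simp: p_def c_def landau_mean_def B_def)
    show "\<bar>blinfun_apply (D x) h - blinfun_apply (w' x) h\<bar> \<le> e * norm h" if "x \<in> K" for x h
    proof -
      have "\<bar>blinfun_apply (D x) h - blinfun_apply (w' x) h\<bar> = norm (blinfun_apply (D x - w' x) h)"
        by (simp add: blinfun.diff_left)
      also have "\<dots> \<le> norm (D x - w' x) * norm h" by (rule norm_blinfun)
      also have "\<dots> \<le> e * norm h"
        using j(2)[OF that] by (intro mult_right_mono) (auto simp: D_def)
      finally show ?thesis .
    qed
  qed
qed

text \<open>Squaring removes the kink of the positive part at 0: the derivative
  \<open>2 * max 0 t\<close> is continuous. This is smooth enough for C^1 cutoffs.\<close>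

lemma C1_square_pos_part:
  assumes "C1_deriv f f'"
  shows "C1_deriv (\<lambda>x. (max 0 (f x))\<^sup>2) (\<lambda>x. (2 * max 0 (f x)) *\<^sub>R f' x)"
proof -
  have f: "(f has_derivative blinfun_apply (f' x)) (at x)" and f'c: "continuous_on UNIV f'" for x
    using assms by (auto simp: C1_deriv_def)
  have fc: "continuous_on UNIV f"
    by (meson f has_derivative_continuous continuous_at_imp_continuous_on)
  have sq: "((\<lambda>t::real. (max 0 t)\<^sup>2) has_field_derivative 2 * max 0 t) (at t)" for t
  proof (cases "t = 0")
    case True
    have "((\<lambda>h. ((max 0 (0 + h))\<^sup>2 - (max 0 0)\<^sup>2) / h) \<longlongrightarrow> 0) (at (0::real))"
    proof (rule Lim_null_comparison[where g = "\<lambda>h. \<bar>h\<bar>"])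
      show "\<forall>\<^sub>F h in at (0::real). norm (((max 0 (0 + h))\<^sup>2 - (max 0 0)\<^sup>2) / h) \<le> \<bar>h\<bar>"
        by (intro always_eventually) (auto simp: max_def power2_eq_square)
      show "((\<lambda>h::real. \<bar>h\<bar>) \<longlongrightarrow> 0) (at 0)" by (auto intro!: tendsto_eq_intros)
    qed
    then show ?thesis unfolding True DERIV_def by simp
  next
    case False
    then consider "t > 0" | "t < 0" by linarith
    then show ?thesis
    proof cases
      case 1
      have "((\<lambda>t::real. t\<^sup>2) has_field_derivative 2 * max 0 t) (at t)"
        using 1 by (auto intro!: derivative_eq_intros)
      then show ?thesis
        by (rule has_field_derivative_transform_within_open[where S = "{0<..}"]) (use 1 in auto)
    next
      case 2
      have "((\<lambda>t::real. 0) has_field_derivative 2 * max 0 t) (at t)"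
        using 2 by auto
      then show ?thesis
        by (rule has_field_derivative_transform_within_open[where S = "{..<0}"]) (use 2 in auto)
    qed
  qed
  show ?thesis unfolding C1_deriv_def
  proof (intro conjI allI)
    show "((\<lambda>x. (max 0 (f x))\<^sup>2) has_derivative blinfun_apply ((2 * max 0 (f x)) *\<^sub>R f' x)) (at x)" for x
      using has_derivative_compose[OF f[of x] sq[of "f x", unfolded has_field_derivative_def]]
      by (simp add: blinfun.scaleR_left[abs_def])
    show "continuous_on UNIV (\<lambda>x. (2 * max 0 (f x)) *\<^sub>R f' x)"
      by (intro continuous_intros fc f'c)
  qed
qed

lemma C1_sum:
  assumes "\<And>i. i \<in> I \<Longrightarrow> C1_deriv (f i) (f' i)"
  shows "C1_deriv (\<lambda>x. \<Sum>i\<in>I. f i x) (\<lambda>x. \<Sum>i\<in>I. f' i x)"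
  using assms unfolding C1_deriv_def
  by (auto intro!: continuous_intros has_derivative_sum simp: blinfun.sum_left[abs_def])

lemma C1_affine:
  assumes "C1_deriv f f'"
  shows "C1_deriv (\<lambda>x. a + b * f x) (\<lambda>x. b *\<^sub>R f' x)"
  using assms unfolding C1_deriv_def
  by (auto intro!: continuous_intros derivative_eq_intros simp: blinfun.scaleR_left[abs_def])

text \<open>A finite sum \<open>s\<close> of squared positive parts is positive on \<open>K\<close>
  and vanishes off finitely many closed balls inside \<open>U\<close>. Compactness of
  \<open>K\<close> gives \<open>s\<close> a positive lower bound there, and a profile in
  \<open>s\<close> levels it to 1.\<close>

lemma C1_cutoff:
  fixes K :: "'a::euclidean_space set"
  assumes K: "compact K" and U: "open U" "K \<subseteq> U"
  obtains \<psi> \<psi>' C where "C1_deriv \<psi> \<psi>'" "compact C" "C \<subseteq> U"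
    "\<And>x. x \<notin> C \<Longrightarrow> \<psi> x = 0 \<and> \<psi>' x = 0" "\<And>x. x \<in> K \<Longrightarrow> \<psi> x = 1 \<and> \<psi>' x = 0"
proof -
  have "\<exists>r>0. cball z r \<subseteq> U" if "z \<in> K" for z
    using U that open_contains_cball by blast
  then obtain r where r: "\<And>z. z \<in> K \<Longrightarrow> r z > 0 \<and> cball z (r z) \<subseteq> U" by metis
  have "K \<subseteq> (\<Union>z\<in>K. ball z (r z))" using r by auto
  from compactE_image[OF K _ this] obtain F where F: "F \<subseteq> K" "finite F" "K \<subseteq> (\<Union>z\<in>F. ball z (r z))"
    by auto
  define h where "h z x = (r z)\<^sup>2 + (-1) * ((x - z) \<bullet> (x - z))" for z x
  have h: "C1_deriv (h z) (\<lambda>x. (-1) *\<^sub>R (2 *\<^sub>R blinfun_inner_right (x - z)))" for z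
    unfolding h_def[abs_def]
    by (rule C1_affine, unfold C1_deriv_def)
       (auto intro!: continuous_intros derivative_eq_intros bounded_linear.continuous_on[OF bounded_linear_blinfun_inner_right]
         simp: blinfun.scaleR_left inner_commute)
  define s where "s x = (\<Sum>z\<in>F. (max 0 (h z x))\<^sup>2)" for x
  define s' where "s' x = (\<Sum>z\<in>F. (2 * max 0 (h z x)) *\<^sub>R (-1) *\<^sub>R (2 *\<^sub>R blinfun_inner_right (x - z)))" for x
  have s: "C1_deriv s s'"
    unfolding s_def[abs_def] s'_def[abs_def] by (intro C1_sum C1_square_pos_part h)
  define C where "C = (\<Union>z\<in>F. cball z (r z))"
  have h0: "h z x \<le> 0 \<longleftrightarrow> r z \<le> dist z x" if "z \<in> K" for z x
  proof -
    have "h z x \<le> 0 \<longleftrightarrow> (r z)\<^sup>2 \<le> (norm (x - z))\<^sup>2" by (simp add: h_def dot_square_norm)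
    also have "\<dots> \<longleftrightarrow> r z \<le> norm (x - z)" using r[OF that] by (intro power_mono_iff) auto
    finally show ?thesis by (simp add: dist_norm norm_minus_commute)
  qed
  have sC: "s x = 0 \<and> s' x = 0" if "x \<notin> C" for x
  proof -
    have "max 0 (h z x) = 0" if "z \<in> F" for z
    proof -
      have "r z \<le> dist z x" using that \<open>x \<notin> C\<close> by (force simp: C_def)
      then show ?thesis using h0[of z x] that F(1) by auto
    qed
    then show ?thesis by (simp add: s_def s'_def)
  qed
  have spos: "s x > 0" if x: "x \<in> K" for x
  proof -
    obtain z where z: "z \<in> F" "x \<in> ball z (r z)" using subsetD[OF F(3) x] by blast
    then have "h z x > 0" using h0[of z x] F by force
    then show ?thesis
      unfolding s_def using F(2) z by (intro sum_pos2[of F z]) auto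
  qed
  have sc: "continuous_on S s" for S
    using s unfolding C1_deriv_def
    by (meson has_derivative_continuous continuous_at_imp_continuous_on)
  obtain s0 where s0: "s0 > 0" "\<And>x. x \<in> K \<Longrightarrow> s0 \<le> s x"
  proof (cases "K = {}")
    case False
    from continuous_attains_inf[OF K False sc] obtain y where "y \<in> K" "\<forall>x\<in>K. s y \<le> s x" by blast
    then show ?thesis using that[of "s y"] spos by auto
  qed (use that[of 1] in auto)
  \<comment> \<open>As a function of \<open>s\<close> this is 0 at \<open>s = 0\<close> and
    constantly 1 from \<open>s = s0 / 2\<close> on, so both its value and its derivative are as
    required on \<open>K\<close>.\<close>
  define \<psi> where "\<psi> x = 1 + (-1) * (max 0 (1 + (- 2 / s0) * s x))\<^sup>2" for x
  define \<psi>' where "\<psi>' x = (-1) *\<^sub>R (2 * max 0 (1 + (- 2 / s0) * s x)) *\<^sub>R (- 2 / s0) *\<^sub>R s' x" for x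
  show thesis
  proof (rule that[of \<psi> \<psi>' C])
    show "C1_deriv \<psi> \<psi>'"
      unfolding \<psi>_def[abs_def] \<psi>'_def[abs_def] by (intro C1_affine C1_square_pos_part s)
    show "compact C" unfolding C_def using F by (intro compact_UN) auto
    show "C \<subseteq> U" unfolding C_def using F r by blast
    show "\<psi> x = 0 \<and> \<psi>' x = 0" if "x \<notin> C" for x using sC[OF that] by (simp add: \<psi>_def \<psi>'_def)
    show "\<psi> x = 1 \<and> \<psi>' x = 0" if "x \<in> K" for x
    proof -
      have "1 + (- 2 / s0) * s x \<le> 0" using s0(2)[OF that] s0(1) by (simp add: field_simps)
      then show ?thesis by (simp add: \<psi>_def \<psi>'_def max_def)
    qed
  qed
qed

text \<open>The cutoff is 1 with derivative 0 on \<open>K\<close>, so multiplying \<open>v\<close>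
  by it and extending by zero changes neither values nor derivatives there and leaves a function of
  compact support.\<close>

theorem C1_polynomial_approximation:
  fixes v :: "'a::euclidean_space \<Rightarrow> real"
  assumes v: "\<And>z. z \<in> U \<Longrightarrow> (v has_derivative blinfun_apply (v' z)) (at z)" "continuous_on U v'"
    and K: "compact K" "K \<subseteq> U" "open U" and e: "0 < e"
  obtains p p' where "real_polynomial_function p" "\<And>x. x \<in> K \<Longrightarrow> (p has_derivative p' x) (at x)"
    "\<And>x. x \<in> K \<Longrightarrow> \<bar>p x - v x\<bar> \<le> e" "\<And>x h. x \<in> K \<Longrightarrow> \<bar>p' x h - v' x h\<bar> \<le> e * norm h"
proof -
  obtain \<psi> \<psi>' C where \<psi>: "C1_deriv \<psi> \<psi>'" and C: "compact C" "C \<subseteq> U"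
    "\<And>x. x \<notin> C \<Longrightarrow> \<psi> x = 0 \<and> \<psi>' x = 0" and one: "\<And>x. x \<in> K \<Longrightarrow> \<psi> x = 1 \<and> \<psi>' x = 0"
    by (rule C1_cutoff[OF K(1) K(3) K(2)]) blast
  have \<psi>d: "(\<psi> has_derivative blinfun_apply (\<psi>' x)) (at x)" and \<psi>'c: "continuous_on S \<psi>'" for x S
    using \<psi> continuous_on_subset by (auto simp: C1_deriv_def)
  have \<psi>c: "continuous_on S \<psi>" for S
    by (meson \<psi>d has_derivative_continuous continuous_at_imp_continuous_on)
  have vc: "continuous_on U v"
    by (meson v(1) has_derivative_continuous continuous_at_imp_continuous_on)
  define w where "w x = (if x \<in> U then \<psi> x * v x else 0)" for x
  define w' where "w' x = (if x \<in> U then \<psi> x *\<^sub>R v' x + v x *\<^sub>R \<psi>' x else 0)" for x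
  have opC: "open (- C)" using C(1) by (simp add: compact_imp_closed open_Compl)
  have C1: "C1_deriv w w'" unfolding C1_deriv_def
  proof (intro conjI allI)
    fix x
    show "(w has_derivative blinfun_apply (w' x)) (at x)"
    proof (cases "x \<in> U")
      case True
      have "((\<lambda>x. \<psi> x * v x) has_derivative blinfun_apply (w' x)) (at x)"
        using True by (auto intro!: derivative_eq_intros \<psi>d v(1) simp: w'_def fun_eq_iff blinfun.add_left blinfun.scaleR_left)
      then show ?thesis
        by (rule has_derivative_transform_within_open[OF _ K(3) True]) (simp add: w_def)
    next
      case False
      then have x: "x \<in> - C" using C by auto
      have "((\<lambda>x. 0) has_derivative blinfun_apply (w' x)) (at x)"
        using False by (simp add: w'_def zero_blinfun.rep_eq)
      then show ?thesis
        by (rule has_derivative_transform_within_open[OF _ opC x]) (use C(3) in \<open>auto simp: w_def\<close>)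
    qed
    \<comment> \<open>Two open sets cover the space: on \<open>U\<close> the product formula
      applies, and off \<open>C\<close> everything is zero.\<close>
    have "continuous_on (U \<union> - C) w'"
    proof (rule continuous_on_open_Un[OF K(3) opC])
      have "continuous_on U (\<lambda>x. \<psi> x *\<^sub>R v' x + v x *\<^sub>R \<psi>' x)"
        by (intro continuous_intros \<psi>c v(2) vc \<psi>'c)
      then show "continuous_on U w'" by (rule continuous_on_eq) (simp add: w'_def)
      show "continuous_on (- C) w'"
        by (rule continuous_on_eq[OF continuous_on_const[of _ 0]]) (use C(3) in \<open>auto simp: w'_def\<close>)
    qed
    moreover have "U \<union> - C = UNIV" using C(2) by auto
    ultimately show "continuous_on UNIV w'" by simp
  qed
  have eq: "w x = v x \<and> w' x = v' x" if "x \<in> K" for x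
    using one[OF that] that K(2) by (auto simp: w_def w'_def)
  show thesis
  proof (rule C1_polynomial_approximation_compact_support[OF C1 C(1) _ K(1) e])
    show "w x = 0" if "x \<notin> C" for x using C(3)[OF that] by (simp add: w_def)
    fix p p' assume p: "real_polynomial_function p" "\<And>x. x \<in> K \<Longrightarrow> (p has_derivative p' x) (at x)"
      "\<And>x. x \<in> K \<Longrightarrow> \<bar>p x - w x\<bar> \<le> e" "\<And>x h. x \<in> K \<Longrightarrow> \<bar>p' x h - w' x h\<bar> \<le> e * norm h"
    show thesis by (rule that[of p p', OF p(1,2)]) (use p(3,4) eq in auto)
  qed
qed

section \<open>Measures and their moments\<close>

text \<open>Each index may have its own threshold in \<open>d\<close>, which is how moment bounds
  arise: a monomial of high degree is controlled only by relaxations of high order.\<close>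

lemma diagonal_convergent_subsequence:
  fixes f :: "nat \<Rightarrow> 'i \<Rightarrow> real"
  assumes "countable (UNIV :: 'i set)" and b: "\<And>i. \<forall>\<^sub>F d in sequentially. \<bar>f d i\<bar> \<le> B i"
  obtains s l where "strict_mono (s :: nat \<Rightarrow> nat)" "\<And>i. (\<lambda>n. f (s n) i) \<longlonglongrightarrow> l i"
proof -
  let ?e = "from_nat_into (UNIV :: 'i set)"
  interpret subseqs "\<lambda>n s. convergent (\<lambda>k. f (s k) (?e n))"
  proof
    fix n and s :: "nat \<Rightarrow> nat" assume "strict_mono s"
    \<comment> \<open>An eventual bound on a real sequence bounds all of it, since only finitely
      many terms precede.\<close>
    have "Bseq (\<lambda>d. f d (?e n))"
      using b[of "?e n"] by (auto intro!: BfunI)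
    then have "bounded (range (\<lambda>d. f d (?e n)))" by (simp add: Bseq_eq_bounded)
    then have "bounded (range (\<lambda>k. f (s k) (?e n)))" by (rule bounded_subset) auto
    then obtain l r where "strict_mono r" "((\<lambda>k. f (s k) (?e n)) \<circ> r) \<longlonglongrightarrow> l"
      using bounded_imp_convergent_subsequence by blast
    then show "\<exists>r. strict_mono r \<and> convergent (\<lambda>k. f ((s \<circ> r) k) (?e n))"
      by (auto simp: convergent_def comp_def)
  qed
  have "convergent (\<lambda>k. f ((diagseq \<circ> (+) (Suc n)) k) (?e n))" for n
    by (rule diagseq_holds) (use convergent_subseq_convergent in \<open>force simp: comp_def\<close>)
  moreover have "f (diagseq (k + Suc n)) (?e n) = f ((diagseq \<circ> (+) (Suc n)) k) (?e n)" for n k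
    by (simp only: comp_apply add.commute[of "Suc n"])
  ultimately have "convergent (\<lambda>k. f (diagseq (k + Suc n)) (?e n))" for n
    by presburger
  then have "convergent (\<lambda>k. f (diagseq k) (?e n))" for n
    by (subst convergent_ignore_initial_segment[symmetric])
  then have "convergent (\<lambda>k. f (diagseq k) i)" for i
    using from_nat_into_to_nat_on[OF assms(1), of i] by (metis UNIV_I)
  then show thesis
    using that[of diagseq "\<lambda>i. lim (\<lambda>k. f (diagseq k) i)"] subseq_diagseq by (auto simp: convergent_LIMSEQ_iff)
qed

lemma countable_multi_indices: "countable (UNIV :: (nat ^ 'v::finite) set)"
proof -
  have "(UNIV :: (nat ^ 'v) set) = (\<Union>d. {\<alpha>. mdeg \<alpha> \<le> d})" by auto
  then show ?thesis by (metis countable_UN countable_finite countableI_type finite_mdeg_le)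
qed

lemma (in finite_measure) integral_diff_bound:
  fixes f g :: "'a \<Rightarrow> real"
  assumes "integrable M f" "integrable M g" "AE x in M. \<bar>f x - g x\<bar> \<le> e"
  shows "\<bar>(\<integral>x. f x \<partial>M) - (\<integral>x. g x \<partial>M)\<bar> \<le> e * measure M (space M)"
proof -
  have "\<bar>(\<integral>x. f x \<partial>M) - (\<integral>x. g x \<partial>M)\<bar> = \<bar>\<integral>x. f x - g x \<partial>M\<bar>"
    using assms by simp
  also have "\<dots> \<le> (\<integral>x. \<bar>f x - g x\<bar> \<partial>M)" by (rule integral_abs_bound)
  also have "\<dots> \<le> (\<integral>x. e \<partial>M)" using assms by (intro integral_mono_AE) auto
  finally show ?thesis by (simp add: mult.commute)
qed

text \<open>Polynomials approximate continuous functions uniformly on \<open>K\<close>, continuous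
  functions decrease to indicators of closed sets, and closed sets are an intersection-stable
  generator of the Borel sets.\<close>

lemma finite_measure_eqI_polynomials:
  fixes M N :: "'a::euclidean_space measure"
  assumes fin: "finite_measure M" "finite_measure N" and sets: "sets M = sets borel" "sets N = sets borel"
    and K: "compact K" "AE x in M. x \<in> K" "AE x in N. x \<in> K"
    and eq: "\<And>f. real_polynomial_function f \<Longrightarrow> (\<integral>x. f x \<partial>M) = (\<integral>x. f x \<partial>N)"
  shows "M = N"
proof -
  interpret M: finite_measure M by fact
  interpret N: finite_measure N by fact
  have meas: "f \<in> borel_measurable M" "f \<in> borel_measurable N" if "continuous_on UNIV f" for f :: "'a \<Rightarrow> real"
    using borel_measurable_continuous_sets[OF _ that] sets by blast+
  have int: "integrable M f" "integrable N f" if f: "continuous_on UNIV f" for f :: "'a \<Rightarrow> real"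
  proof -
    obtain C where C: "\<And>x. x \<in> K \<Longrightarrow> norm (f x) \<le> C"
      using compact_continuous_bound[OF K(1) continuous_on_subset[OF f subset_UNIV]] by blast
    show "integrable M f"
      by (rule M.integrable_const_bound[OF _ meas(1)[OF f], of C]) (use K(2) C in \<open>auto elim!: eventually_mono\<close>)
    show "integrable N f"
      by (rule N.integrable_const_bound[OF _ meas(2)[OF f], of C]) (use K(3) C in \<open>auto elim!: eventually_mono\<close>)
  qed
  have cont: "(\<integral>x. f x \<partial>M) = (\<integral>x. f x \<partial>N)" if f: "continuous_on UNIV f" for f :: "'a \<Rightarrow> real"
  proof -
    define m where "m = measure M (space M) + measure N (space N) + 1"
    have m: "0 < m" by (simp add: m_def add_nonneg_pos)
    have "\<bar>(\<integral>x. f x \<partial>M) - (\<integral>x. f x \<partial>N)\<bar> \<le> 0 + e" if e: "0 < e" for e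
    proof -
      have em: "0 < e / m" using e m by simp
      from Stone_Weierstrass_real_polynomial_function[OF K(1) continuous_on_subset[OF f subset_UNIV] this]
      obtain g where g: "real_polynomial_function g" and fg: "\<And>x. x \<in> K \<Longrightarrow> \<bar>f x - g x\<bar> < e / m" by blast
      have gc: "continuous_on UNIV g"
        using g continuous_on_polymonial_function real_polynomial_function_eq by blast
      have fg: "AE x in L. \<bar>f x - g x\<bar> \<le> e / m" if "AE x in L. x \<in> K" for L
        using that by eventually_elim (use fg in \<open>auto intro: less_imp_le\<close>)
      have "\<bar>(\<integral>x. f x \<partial>M) - (\<integral>x. f x \<partial>N)\<bar> \<le> e / m * measure M (space M) + e / m * measure N (space N)"
        using M.integral_diff_bound[OF int(1)[OF f] int(1)[OF gc] fg[OF K(2)]]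
          N.integral_diff_bound[OF int(2)[OF f] int(2)[OF gc] fg[OF K(3)]] eq[OF g]
        by linarith
      also have "\<dots> \<le> e / m * m"
        unfolding distrib_left[symmetric] using em by (intro mult_left_mono) (auto simp: m_def)
      also have "\<dots> = e" using m by simp
      finally show ?thesis by simp
    qed
    from field_le_epsilon[of "\<bar>(\<integral>x. f x \<partial>M) - (\<integral>x. f x \<partial>N)\<bar>" 0, OF this] show ?thesis by simp
  qed
  have cl: "measure M C = measure N C" if C: "closed C" for C
  proof (cases "C = {}")
    case False
    define g where "g n x = max 0 (1 - real n * infdist x C)" for n x
    have gc: "continuous_on UNIV (g n)" for n
      unfolding g_def by (intro continuous_intros)
    have lim: "(\<lambda>n. g n x) \<longlonglongrightarrow> indicator C x" for x
    proof (cases "x \<in> C")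
      case True
      then show ?thesis by (simp add: g_def)
    next
      case nx: False
      then have pos: "infdist x C > 0" using infdist_pos_not_in_closed C False by blast
      obtain n0 :: nat where n0: "1 / infdist x C < n0" using reals_Archimedean2 by blast
      have "\<forall>\<^sub>F n in sequentially. g n x = 0"
        using eventually_ge_at_top[of n0]
      proof eventually_elim
        case (elim n)
        then have "1 / infdist x C < n" using n0 by simp
        then show ?case using pos by (simp add: g_def field_simps)
      qed
      then show ?thesis using nx by (simp add: tendsto_eventually)
    qed
    have bd: "norm (g n x) \<le> 1" for n x using infdist_nonneg[of x C] by (simp add: g_def)
    have "(\<lambda>n. \<integral>x. g n x \<partial>L) \<longlonglongrightarrow> measure L C"
      if "finite_measure L" "sets L = sets borel" for L
    proof -
      interpret L: finite_measure L by fact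
      have CL: "C \<in> sets L" using C that(2) by simp
      have "(\<lambda>n. \<integral>x. g n x \<partial>L) \<longlonglongrightarrow> (\<integral>x. indicator C x \<partial>L)"
      proof (rule integral_dominated_convergence[where w = "\<lambda>_. 1"])
        show "g n \<in> borel_measurable L" for n
          by (rule borel_measurable_continuous_sets[OF that(2) gc])
      qed (use lim bd CL in auto)
      then show ?thesis using CL by (simp add: sets.Int_space_eq2)
    qed
    from this[OF fin(1) sets(1)] this[OF fin(2) sets(2)] cont[OF gc] show ?thesis
      using LIMSEQ_unique by simp
  qed simp
  show ?thesis
  proof (rule measure_eqI_generator_eq[where E = "Collect closed" and \<Omega> = UNIV and A = "\<lambda>_. UNIV"])
    show "Int_stable (Collect closed :: 'a set set)" by (auto simp: Int_stable_def)
    show "emeasure M X = emeasure N X" if "X \<in> Collect closed" for X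
      using cl[of X] that by (simp add: M.emeasure_eq_measure N.emeasure_eq_measure)
    show "sets M = sigma_sets UNIV (Collect closed)" "sets N = sigma_sets UNIV (Collect closed)"
      unfolding sets borel_eq_closed by (rule sets_measure_of, simp)+
  qed auto
qed

section \<open>Measures on a compact set and their moments\<close>

lemma nonneg_measures_space: "\<nu> \<in> nonneg_measures S \<Longrightarrow> space \<nu> = S"
  using sets_eq_imp_space_eq[of \<nu> "restrict_space borel S"]
  by (simp add: nonneg_measures_def space_restrict_space)

lemma nonneg_measures_measurable:
  assumes "\<nu> \<in> nonneg_measures S" "continuous_on S f"
  shows "f \<in> \<nu> \<rightarrow>\<^sub>M borel"
  using borel_measurable_continuous_on_restrict[OF assms(2)] assms(1) measurable_cong_sets
  unfolding nonneg_measures_def by blast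

lemma nonneg_measures_integrable:
  fixes f :: "'a::topological_space \<Rightarrow> real"
  assumes \<nu>: "\<nu> \<in> nonneg_measures S" and S: "compact S" and f: "continuous_on S f"
  shows "integrable \<nu> f"
proof -
  interpret finite_measure \<nu> using \<nu> by (simp add: nonneg_measures_def)
  obtain C where C: "\<And>x. x \<in> S \<Longrightarrow> norm (f x) \<le> C"
    using compact_continuous_bound[OF S f] by blast
  show ?thesis
  proof (rule integrable_const_bound)
    show "AE x in \<nu>. norm (f x) \<le> C"
      by (rule AE_I2) (use C nonneg_measures_space[OF \<nu>] in auto)
    show "f \<in> borel_measurable \<nu>" by (rule nonneg_measures_measurable[OF \<nu> f])
  qed
qed

lemma nonneg_measures_integral_nonneg:
  fixes f :: "'a::topological_space \<Rightarrow> real"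
  shows "\<nu> \<in> nonneg_measures S \<Longrightarrow> (\<And>x. x \<in> S \<Longrightarrow> 0 \<le> f x) \<Longrightarrow> 0 \<le> (\<integral>x. f x \<partial>\<nu>)"
  by (rule Bochner_Integration.integral_nonneg) (simp add: nonneg_measures_space)

text \<open>The map \<open>h\<close> supplies the coordinates: measures live on pairs, multi-indices
  on joined vectors, and time and space even change their order.\<close>

definition moments :: "('a \<Rightarrow> real ^ 'v::finite) \<Rightarrow> 'a measure \<Rightarrow> nat ^ 'v \<Rightarrow> real" where
  "moments h \<nu> \<gamma> = (\<integral>z. mono_eval (h z) \<gamma> \<partial>\<nu>)"

lemma riesz_moments:
  assumes \<nu>: "\<nu> \<in> nonneg_measures S" and S: "compact S" and h: "continuous_on S h"
  shows "riesz (moments h \<nu>) p = (\<integral>z. peval p (h z) \<partial>\<nu>)"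
proof (induction p rule: poly_mapping_induct)
  case (single_add \<gamma> a p)
  have c: "continuous_on S (\<lambda>z. mono_eval (h z) \<gamma>)" unfolding mono_eval_def by (intro continuous_intros h)
  have "(\<integral>z. peval (single \<gamma> a + p) (h z) \<partial>\<nu>) = (\<integral>z. a * mono_eval (h z) \<gamma> + peval p (h z) \<partial>\<nu>)"
    by (simp add: peval_add peval_eq_riesz[of "single _ _"])
  also have "\<dots> = a * (\<integral>z. mono_eval (h z) \<gamma> \<partial>\<nu>) + (\<integral>z. peval p (h z) \<partial>\<nu>)"
    using nonneg_measures_integrable[OF \<nu> S c] nonneg_measures_integrable[OF \<nu> S continuous_on_peval[OF h], of p]
    by simp
  finally show ?case using single_add by (simp add: riesz_add moments_def)
qed simp

lemma moment_psd_of_measure: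
  assumes \<nu>: "\<nu> \<in> nonneg_measures S" and S: "compact S" and h: "continuous_on S h"
    and sub: "\<And>z. z \<in> S \<Longrightarrow> h z \<in> semialg gs"
  shows "moment_psd d gs (moments h \<nu>)"
proof (rule moment_psdI)
  fix g q assume "g \<in> set (1 # gs)"
  then have "0 \<le> peval (g * q * q) (h z)" if "z \<in> S" for z
    using sub[OF that] by (auto simp: semialg_def peval_mult mult.assoc)
  then show "0 \<le> riesz (moments h \<nu>) (g * q * q)"
    unfolding riesz_moments[OF \<nu> S h] by (rule nonneg_measures_integral_nonneg[OF \<nu>])
qed

text \<open>The polynomials nonnegative at a point of the set form a square cone, so the algebraic
  coordinate bound holds numerically at that point.\<close>

lemma compact_semialg:
  assumes "coord_bounded gs R"
  shows "compact (semialg gs)"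
proof -
  have "x \<in> cbox (\<chi> i. - sqrt R) (\<chi> i. sqrt R)" if x: "x \<in> semialg gs" for x
  proof -
    have "square_cone gs {p. 0 \<le> peval p x}"
      unfolding square_cone_def using x by (auto simp: peval_simps semialg_def mult.assoc)
    then have "(pconst R - pvar i * pvar i) * 1 * 1 \<in> {p. 0 \<le> peval p x}" for i
      using assms unfolding coord_bounded_def by blast
    then have "(x $ i)\<^sup>2 \<le> R" for i by (simp add: peval_simps power2_eq_square)
    then have "\<bar>x $ i\<bar> \<le> sqrt R" for i using real_le_rsqrt[of "\<bar>x $ i\<bar>"] by simp
    then show ?thesis by (simp add: mem_box_cart abs_le_iff minus_le_iff)
  qed
  then have "bounded (semialg gs)" by (meson bounded_cbox bounded_subset subsetI)
  then show ?thesis using closed_semialg compact_eq_bounded_closed by blast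
qed

text \<open>Representing measures are Borel measures on all of Euclidean space that are merely
  concentrated on the right set. The program wants measures on the set itself, in the coordinates of
  pairs.\<close>

lemma restrict_distr_nonneg_measures:
  fixes h :: "'a::topological_space \<Rightarrow> 'b::topological_space" and f :: "'b \<Rightarrow> real"
  assumes fin: "finite_measure \<nu>" and sets: "sets \<nu> = sets borel" and ae: "AE x in \<nu>. h x \<in> S"
    and h: "continuous_on UNIV h" and S: "closed S"
  defines "\<mu> \<equiv> restrict_space (distr \<nu> borel h) S"
  shows "\<mu> \<in> nonneg_measures S"
    "f \<in> borel_measurable borel \<Longrightarrow> (\<integral>z. f z \<partial>\<mu>) = (\<integral>x. f (h x) \<partial>\<nu>)"
proof -
  interpret finite_measure \<nu> by fact
  have hm: "h \<in> \<nu> \<rightarrow>\<^sub>M borel"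
    by (rule borel_measurable_continuous_sets[OF sets h])
  have Sb: "S \<in> sets borel" using S by simp
  have fd: "finite_measure (distr \<nu> borel h)" by (rule finite_measure_distr[OF hm])
  show "\<mu> \<in> nonneg_measures S"
    unfolding nonneg_measures_def \<mu>_def
    using finite_measure_restrict_space[OF fd, of S] Sb by (simp add: sets_restrict_space)
  assume f: "f \<in> borel_measurable borel"
  have "(\<integral>z. f z \<partial>\<mu>) = (\<integral>z. indicator S z *\<^sub>R f z \<partial>distr \<nu> borel h)"
    unfolding \<mu>_def using Sb by (intro integral_restrict_space) simp
  also have "\<dots> = (\<integral>x. indicator S (h x) *\<^sub>R f (h x) \<partial>\<nu>)"
    using f Sb by (intro integral_distr hm) auto
  also have "\<dots> = (\<integral>x. f (h x) \<partial>\<nu>)"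
  proof (rule integral_cong_AE)
    show "(\<lambda>x. indicator S (h x) *\<^sub>R f (h x)) \<in> borel_measurable \<nu>" "(\<lambda>x. f (h x)) \<in> borel_measurable \<nu>"
      using f hm Sb by measurable
    show "AE x in \<nu>. indicator S (h x) *\<^sub>R f (h x) = f (h x)"
      using ae by eventually_elim simp
  qed
  finally show "(\<integral>z. f z \<partial>\<mu>) = (\<integral>x. f (h x) \<partial>\<nu>)" .
qed

text \<open>The separate derivatives in time and space combine to the total derivative in the
  direction \<open>(1, F)\<close>. A bound on derivatives in operator norm thus controls the Lie
  derivative.\<close>

lemma lie_derivative_eq:
  fixes F :: "real \<Rightarrow> real ^ 'n::finite \<Rightarrow> real ^ 'n"
  assumes v: "(v has_derivative D) (at (t, x))"
  shows "lie_derivative F v (t, x) = D (1, F t x)"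
proof -
  interpret bounded_linear D using v by (rule has_derivative_bounded_linear)
  have "((\<lambda>s. (s, x)) has_derivative (\<lambda>s. (s, 0))) (at t)"
    by (auto intro!: derivative_eq_intros)
  from has_derivative_compose[OF this, of v D] v
  have "((\<lambda>s. v (s, x)) has_derivative (\<lambda>s. D (s, 0))) (at t)" by simp
  moreover have "(\<lambda>s. D (s, 0)) = (*) (D (1, 0))"
  proof
    show "D (s, 0) = D (1, 0) * s" for s
      using scaleR[of s "(1, 0)"] by (simp add: mult.commute)
  qed
  ultimately have "((\<lambda>s. v (s, x)) has_field_derivative D (1, 0)) (at t)"
    by (simp add: has_field_derivative_def)
  then have 1: "deriv (\<lambda>s. v (s, x)) t = D (1, 0)" by (rule DERIV_imp_deriv)
  have "((\<lambda>\<xi>. (t, \<xi>)) has_derivative (\<lambda>\<xi>. (0, \<xi>))) (at x)"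
    by (auto intro!: derivative_eq_intros)
  from has_derivative_compose[OF this, of v D] v
  have "((\<lambda>\<xi>. v (t, \<xi>)) has_derivative (\<lambda>\<xi>. D (0, \<xi>))) (at x)" by simp
  from frechet_derivative_at[OF this] have g: "gradient (\<lambda>\<xi>. v (t, \<xi>)) x = (\<chi> i. D (0, axis i 1))"
    unfolding gradient_def by metis
  have Dy: "D (0, y) = y \<bullet> (\<chi> i. D (0, axis i 1))" for y
  proof -
    have "bounded_linear (\<lambda>y. D (0, y))"
      by (rule bounded_linear_compose[OF bounded_linear_axioms]) (intro bounded_linear_intros)
    then interpret L: bounded_linear "\<lambda>y. D (0, y)" .
    have "D (0, y) = D (0, \<Sum>i\<in>UNIV. y $ i *s axis i 1)" by (simp add: basis_expansion)
    also have "\<dots> = (\<Sum>i\<in>UNIV. y $ i * D (0, axis i 1))"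
      by (simp add: L.sum L.scaleR scalar_mult_eq_scaleR)
    finally show ?thesis by (simp add: inner_vec_def)
  qed
  have "lie_derivative F v (t, x) = D (1, 0) + F t x \<bullet> (\<chi> i. D (0, axis i 1))"
    by (simp add: lie_derivative_def 1 g)
  also have "\<dots> = D (1, 0) + D (0, F t x)"
    by (simp only: Dy[of "F t x"])
  also have "\<dots> = D (1, F t x)" using add[of "(1, 0)" "(0, F t x)"] by simp
  finally show ?thesis .
qed

section \<open>Space-time coordinates\<close>

definition space_time :: "real \<times> (real ^ 'n::finite) \<Rightarrow> real ^ ('n + 1)" where
  "space_time z = join (snd z) (vec (fst z))"

definition space_time_inv :: "real ^ ('n::finite + 1) \<Rightarrow> real \<times> (real ^ 'n)" where
  "space_time_inv w = (w $ Inr 1, \<chi> i. w $ Inl i)"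

lemma join_eq: "join (\<chi> i. \<gamma> $ Inl i) (\<chi> j. \<gamma> $ Inr j) = \<gamma>"
  by (auto simp: join_def vec_eq_iff split: sum.split)

lemma join_vec_eq: "join (\<chi> i. \<gamma> $ Inl i) (vec (\<gamma> $ Inr 1)) = (\<gamma> :: 'a ^ ('n::finite + 1))"
  by (auto simp: join_def vec_eq_iff num1_eq1 split: sum.split)

lemma space_time_inverse [simp]: "space_time (space_time_inv w) = w"
  by (simp add: space_time_def space_time_inv_def join_vec_eq)

lemma space_time_nth [simp]: "space_time z $ Inl i = snd z $ i" "space_time z $ Inr j = fst z"
  by (simp_all add: space_time_def)

lemma continuous_on_join [continuous_intros]:
  assumes "continuous_on S f" "continuous_on S g"
  shows "continuous_on S (\<lambda>z. join (f z) (g z))"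
  unfolding join_def
proof (rule continuous_on_vec_lambda)
  fix k show "continuous_on S (\<lambda>x. case k of Inl i \<Rightarrow> f x $ i | Inr j \<Rightarrow> g x $ j)"
    by (cases k) (auto intro!: continuous_intros assms)
qed

lemma continuous_on_vec [continuous_intros]:
  "continuous_on S f \<Longrightarrow> continuous_on S (\<lambda>z. vec (f z) :: real ^ 'm)"
  unfolding vec_def by (intro continuous_on_vec_lambda)

lemma continuous_on_space_time [continuous_intros]:
  "continuous_on S f \<Longrightarrow> continuous_on S (\<lambda>z. space_time (f z))"
  unfolding space_time_def by (intro continuous_intros)

lemma continuous_on_space_time_inv [continuous_intros]:
  "continuous_on S f \<Longrightarrow> continuous_on S (\<lambda>z. space_time_inv (f z))"
  unfolding space_time_inv_def by (intro continuous_intros)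

lemma bounded_linear_space_time: "bounded_linear (space_time :: real \<times> (real ^ 'n::finite) \<Rightarrow> _)"
proof -
  have "space_time (x + y) $ k = (space_time x + space_time y) $ k"
    "space_time (c *\<^sub>R x) $ k = (c *\<^sub>R space_time x) $ k" for x y :: "real \<times> (real ^ 'n)" and c k
    by (cases k; simp)+
  then have "linear (space_time :: real \<times> (real ^ 'n) \<Rightarrow> _)"
    by (intro linearI) (simp_all add: vec_eq_iff)
  then show "bounded_linear (space_time :: real \<times> (real ^ 'n) \<Rightarrow> _)" by (rule linear_conv_bounded_linear[THEN iffD1])
qed

lemmas has_derivative_space_time = bounded_linear_imp_has_derivative[OF bounded_linear_space_time]

lemma sum_UNIV_sum:
  fixes f :: "'a::finite + 'b::finite \<Rightarrow> 'c::comm_monoid_add"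
  shows "(\<Sum>k\<in>UNIV. f k) = (\<Sum>i\<in>UNIV. f (Inl i)) + (\<Sum>j\<in>UNIV. f (Inr j))"
  using sum.Plus[of UNIV UNIV f] by (simp add: UNIV_Plus_UNIV comp_def)

lemma UNIV_num1: "(UNIV :: 1 set) = {1}"
  by (auto intro: num1_eq1)

lemma has_derivative_peval_space_time:
  "((\<lambda>z. peval p (space_time z)) has_derivative
     (\<lambda>h. (peval (ppartial (Inr 1) p) (space_time z), \<chi> i. peval (ppartial (Inl i) p) (space_time z)) \<bullet> h)) (at z)"
  by (rule has_derivative_eq_rhs[OF has_derivative_compose[OF has_derivative_space_time has_derivative_peval]])
     (auto simp: sum_UNIV_sum UNIV_num1 inner_prod_def inner_vec_def mult.commute add.commute)

lemma C1_on_peval_space_time: "C1_on U (\<lambda>z. peval p (space_time z))"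
  unfolding C1_on_def
proof (intro exI conjI ballI)
  let ?v' = "\<lambda>z. blinfun_inner_right (peval (ppartial (Inr 1) p) (space_time z), \<chi> i. peval (ppartial (Inl i) p) (space_time z))"
  show "((\<lambda>z. peval p (space_time z)) has_derivative blinfun_apply (?v' z)) (at z)" for z
    using has_derivative_peval_space_time[of p z] by simp
  show "continuous_on U ?v'"
    by (intro bounded_linear.continuous_on[OF bounded_linear_blinfun_inner_right] continuous_intros)
qed

lemma lie_derivative_peval:
  "lie_derivative (field_eval f) (\<lambda>z. peval p (space_time z)) z = peval (lie_poly f p) (space_time z)"
proof -
  obtain t x where z: "z = (t, x)" by (cases z)
  have "space_time (t, x) = join x (vec t)" by (simp add: space_time_def)
  then show ?thesis
    unfolding z lie_derivative_eq[OF has_derivative_peval_space_time]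
    by (simp add: lie_poly_def peval_simps field_eval_def inner_vec_def mult.commute)
qed

lemma lie_poly_add: "lie_poly f (p + q) = lie_poly f p + lie_poly f q"
  by (simp add: lie_poly_def ppartial_add distrib_left sum.distrib algebra_simps)

lemma semialg_space_time:
  assumes "0 \<le> T"
  shows "space_time (t, x) \<in> semialg (prod_description gX (time_description T)) \<longleftrightarrow> t \<in> {0..T} \<and> x \<in> semialg gX"
proof -
  have "vec t \<in> semialg (time_description T) \<longleftrightarrow> 0 \<le> t * (T - t)"
    by (simp add: semialg_def time_description_def peval_simps)
  also have "\<dots> \<longleftrightarrow> t \<in> {0..T}" using assms by (auto simp: zero_le_mult_iff)
  finally show ?thesis by (auto simp: space_time_def semialg_prod_description)
qed

text \<open>Composition with the linear left inverse \<open>H\<close> carries an approximant on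
  pairs to the joined variables.\<close>

lemma real_polynomial_function_peval_linear_iso:
  fixes q :: "'a::euclidean_space \<Rightarrow> real" and J :: "'a \<Rightarrow> real ^ 'v::finite"
  assumes q: "real_polynomial_function q" and H: "bounded_linear H" "\<And>z. H (J z) = z"
  obtains p where "\<And>z. q z = peval p (J z)"
proof -
  have "real_polynomial_function (q \<circ> H)"
    using real_polynomial_function_compose[of H q] q H(1) polynomial_function_bounded_linear by blast
  then obtain p where "q \<circ> H = peval p" by (rule real_polynomial_function_peval)
  then have "q z = peval p (J z)" for z using H(2) by (metis comp_apply)
  then show thesis by (rule that)
qed

section \<open>Convergence of the relaxation\<close>

lemma continuous_on_fst_snd_join: "continuous_on S (\<lambda>z. join (fst z) (snd z))"
  by (intro continuous_intros)

text \<open>With \<open>0 ^ 0 = 1\<close> this is the Kronecker delta of the Liouville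
  relation.\<close>

lemma mono_eval_0_vec: "mono_eval (0 :: real ^ 1) (vec \<beta>) = 0 ^ \<beta>"
  by (simp add: mono_eval_def)

text \<open>Monomials are admissible test functions on the whole space, and constraints times
  squares have nonnegative integrals. The same moment sequences therefore serve every
  \<open>d\<close>.\<close>

lemma measure_feasible_imp_lmi_feasible:
  fixes f :: "'n::finite \<Rightarrow> ('n + 1) mpoly"
  assumes T: "0 \<le> T" and R: "coord_bounded g0 R" "coord_bounded gX R" "coord_bounded gU R"
    and feas: "measure_feasible T (field_eval f) (semialg g0) (semialg gX) (semialg gU) \<mu>0 \<mu>p \<mu> \<eta>"
  defines "m\<eta> \<equiv> moments (\<lambda>z. join (fst z) (snd z)) \<eta>"
  shows "lmi_feasible d T f g0 gX gU (moments (\<lambda>x. x) \<mu>0)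
      (moments space_time \<mu>p) (moments space_time \<mu>) m\<eta>"
    and "riesz m\<eta> c = (\<integral>(x, y). peval c (join x y) \<partial>\<eta>)"
proof -
  note comp = compact_semialg[OF R(1)] compact_semialg[OF R(2)] compact_semialg[OF R(3)]
  have cTX: "compact ({0..T} \<times> semialg gX)" and cXU: "compact (semialg gX \<times> semialg gU)"
    using comp by (auto intro: compact_Times)
  from feas have eq: "distr \<eta> borel fst = distr \<mu>p borel snd" and
    liou: "liouville T (field_eval f) (semialg gX) \<mu>0 \<mu>p \<mu>" and one: "(\<integral>x. 1 \<partial>\<mu>0) = (1::real)" and
    \<mu>0: "\<mu>0 \<in> nonneg_measures (semialg g0)" and \<eta>: "\<eta> \<in> nonneg_measures (semialg gX \<times> semialg gU)" and
    \<mu>p: "\<mu>p \<in> nonneg_measures ({0..T} \<times> semialg gX)" and \<mu>: "\<mu> \<in> nonneg_measures ({0..T} \<times> semialg gX)"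
    unfolding measure_feasible_def by auto
  note r0 = riesz_moments[OF \<mu>0 comp(1) continuous_on_id]
  note rp = riesz_moments[OF \<mu>p cTX continuous_on_space_time[OF continuous_on_id]]
  note r = riesz_moments[OF \<mu> cTX continuous_on_space_time[OF continuous_on_id]]
  note r\<eta> = riesz_moments[OF \<eta> cXU continuous_on_fst_snd_join]
  show "riesz m\<eta> c = (\<integral>(x, y). peval c (join x y) \<partial>\<eta>)"
    unfolding m\<eta>_def r\<eta> by (simp add: split_def)
  have marg: "m\<eta> (join \<alpha> 0) = moments space_time \<mu>p (join \<alpha> 0)" for \<alpha>
  proof -
    have me: "(\<lambda>x. mono_eval x \<alpha>) \<in> borel_measurable borel"
      unfolding mono_eval_def by (intro borel_measurable_continuous_onI continuous_intros)
    have "fst \<in> \<eta> \<rightarrow>\<^sub>M borel"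
      by (rule nonneg_measures_measurable[OF \<eta>]) (intro continuous_intros)
    moreover have "snd \<in> \<mu>p \<rightarrow>\<^sub>M borel"
      by (rule nonneg_measures_measurable[OF \<mu>p]) (intro continuous_intros)
    ultimately have "(\<integral>z. mono_eval (fst z) \<alpha> \<partial>\<eta>) = (\<integral>z. mono_eval (snd z) \<alpha> \<partial>\<mu>p)"
      using eq integral_distr[OF _ me, of fst \<eta>] integral_distr[OF _ me, of snd \<mu>p] by metis
    then show ?thesis by (simp add: m\<eta>_def moments_def space_time_def mono_eval_join)
  qed
  have liou0: "Defs.liou f (moments (\<lambda>x. x) \<mu>0)
      (moments space_time \<mu>p) (moments space_time \<mu>) \<alpha> \<beta> = 0" for \<alpha> \<beta>
  proof -
    let ?p = "monomial (join \<alpha> (vec \<beta>)) :: ('n + 1) mpoly"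
    have "(\<integral>z. peval ?p (space_time z) \<partial>\<mu>p) = (\<integral>x. peval ?p (space_time (0, x)) \<partial>\<mu>0) +
        (\<integral>z. lie_derivative (field_eval f) (\<lambda>z. peval ?p (space_time z)) z \<partial>\<mu>)"
      using liou C1_on_peval_space_time[of UNIV ?p] unfolding liouville_def by blast
    moreover have "peval ?p (space_time (0, x)) = mono_eval x \<alpha> * (if \<beta> = 0 then 1 else 0)" for x
      by (simp add: peval_monomial space_time_def mono_eval_join mono_eval_0_vec)
    ultimately show ?thesis
      unfolding Defs.liou_def r lie_derivative_peval by (simp add: moments_def peval_monomial)
  qed
  show "lmi_feasible d T f g0 gX gU (moments (\<lambda>x. x) \<mu>0)
      (moments space_time \<mu>p) (moments space_time \<mu>) m\<eta>"
    unfolding lmi_feasible_def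
  proof (intro conjI allI impI)
    show "moments (\<lambda>x. x) \<mu>0 0 = 1" using one by (simp add: moments_def)
    show "moment_psd d g0 (moments (\<lambda>x. x) \<mu>0)"
      by (rule moment_psd_of_measure[OF \<mu>0 comp(1) continuous_on_id])
    show "moment_psd d (prod_description gX (time_description T)) (moments space_time \<mu>p)"
      by (rule moment_psd_of_measure[OF \<mu>p cTX continuous_on_space_time[OF continuous_on_id]])
         (auto simp: semialg_space_time[OF T])
    show "moment_psd (d + field_half_deg f - 1) (prod_description gX (time_description T)) (moments space_time \<mu>)"
      by (rule moment_psd_of_measure[OF \<mu> cTX continuous_on_space_time[OF continuous_on_id]])
         (auto simp: semialg_space_time[OF T])
    show "moment_psd d (prod_description gX gU) m\<eta>"
      unfolding m\<eta>_def
      by (rule moment_psd_of_measure[OF \<eta> cXU continuous_on_fst_snd_join]) (auto simp: semialg_prod_description)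
  qed (rule marg liou0)+
qed

lemma lmi_feasible_mono:
  assumes "lmi_feasible d' T f g0 gX gU m0 mp m m\<eta>" "d \<le> d'"
  shows "lmi_feasible d T f g0 gX gU m0 mp m m\<eta>"
  using assms(1) unfolding lmi_feasible_def
  by (elim conjE, intro conjI) (use assms(2) in \<open>auto elim: moment_psd_mono\<close>)

text \<open>For a fixed \<open>q\<close> the degree restriction is met once \<open>D d\<close> is
  large. The order is a function \<open>D\<close> because the matrix of \<open>m\<close> has a
  shifted order and because subsequences are taken.\<close>

lemma square_cone_eventually:
  fixes gs :: "'v::finite mpoly list"
  assumes psd: "\<And>d. moment_psd (D d) gs (m d)" and D: "filterlim D at_top F"
  shows "square_cone gs {p. \<forall>\<^sub>F d in F. 0 \<le> riesz (m d) p}"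
  unfolding square_cone_def
proof (intro conjI ballI allI)
  fix p q assume "p \<in> {p. \<forall>\<^sub>F d in F. 0 \<le> riesz (m d) p}" "q \<in> {p. \<forall>\<^sub>F d in F. 0 \<le> riesz (m d) p}"
  then have "\<forall>\<^sub>F d in F. 0 \<le> riesz (m d) p \<and> 0 \<le> riesz (m d) q" by (simp add: eventually_conj)
  then show "p + q \<in> {p. \<forall>\<^sub>F d in F. 0 \<le> riesz (m d) p}"
    by (auto simp: riesz_add elim: eventually_mono)
next
  fix g q :: "'v mpoly" assume g: "g \<in> set (1 # gs)"
  have "\<forall>\<^sub>F d in F. pdeg q + half_deg (pdeg g) \<le> D d"
    using D by (simp add: filterlim_at_top)
  then have "\<forall>\<^sub>F d in F. 0 \<le> riesz (m d) (g * q * q)"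
  proof eventually_elim
    case (elim d)
    show ?case
    proof (rule moment_psdD[OF psd g])
      fix \<alpha> assume "\<alpha> \<in> Poly_Mapping.keys q"
      then show "mdeg \<alpha> + half_deg (pdeg g) \<le> D d" using mdeg_le_pdeg[of \<alpha> q] elim by linarith
    qed
  qed
  then show "g * q * q \<in> {p. \<forall>\<^sub>F d in F. 0 \<le> riesz (m d) p}" by simp
qed

text \<open>The threshold depends on \<open>\<alpha>\<close>. The mass remains a factor: it is 1 for
  three of the sequences and has to be estimated for the fourth.\<close>

lemma eventually_moment_bound:
  assumes "\<And>d. moment_psd (D d) gs (m d)" "filterlim D at_top F" "coord_bounded gs R" "1 \<le> R"
  shows "\<forall>\<^sub>F d in F. \<bar>m d \<alpha>\<bar> \<le> R ^ mdeg \<alpha> * m d 0"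
proof -
  have riesz: "riesz (m d) (pconst a) = a * m d 0" for d a by (simp add: pconst_def)
  have "\<forall>\<^sub>F d in F. 0 \<le> riesz (m d) (pconst (R ^ mdeg \<alpha>) + monomial \<alpha>)"
    "\<forall>\<^sub>F d in F. 0 \<le> riesz (m d) (pconst (R ^ mdeg \<alpha>) - monomial \<alpha>)"
    using coord_bounded_monomial[OF assms(3,4) square_cone_eventually[OF assms(1,2)], of \<alpha>] by simp_all
  then show ?thesis
    by eventually_elim (simp add: riesz_add riesz_diff riesz abs_le_iff)
qed

lemma tendsto_riesz:
  assumes "\<And>\<alpha>. ((\<lambda>n. m n \<alpha>) \<longlongrightarrow> l \<alpha>) F"
  shows "((\<lambda>n. riesz (m n) p) \<longlongrightarrow> riesz l p) F"
  unfolding riesz_def by (intro tendsto_intros assms)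

lemma square_cone_limit:
  assumes psd: "\<And>d. moment_psd (D d) gs (m d)" and D: "filterlim D at_top F" and F: "F \<noteq> bot"
    and l: "\<And>\<alpha>. ((\<lambda>n. m n \<alpha>) \<longlongrightarrow> l \<alpha>) F"
  shows "square_cone gs {p. 0 \<le> riesz l p}"
proof -
  have sub: "0 \<le> riesz l p" if "\<forall>\<^sub>F d in F. 0 \<le> riesz (m d) p" for p
    by (rule tendsto_lowerbound[OF tendsto_riesz[OF l] that F])
  show ?thesis
    using square_cone_eventually[OF psd D] sub
    unfolding square_cone_def mem_Collect_eq by (auto simp: riesz_add)
qed

lemma linear_form_riesz: "linear_form (riesz l)"
  by (simp add: linear_form_def riesz_add riesz_pconst_mult)

lemma measurable_peval: "continuous_on UNIV h \<Longrightarrow> (\<lambda>z. peval p (h z)) \<in> borel_measurable borel"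
  by (rule borel_measurable_continuous_onI) (intro continuous_intros)

text \<open>The Liouville equation for polynomials extends to all \<open>C\<^sup>1\<close> test functions by density in the
  \<open>C\<^sup>1\<close> norm on the compact set \<open>[0,T] \<times> X\<close>.\<close>
lemma liouville_of_polynomials:
  fixes f :: "'n::finite \<Rightarrow> ('n + 1) mpoly"
  assumes X: "compact X" "X0 \<subseteq> X" "compact X0" and T: "0 \<le> T"
    and \<mu>0: "\<mu>0 \<in> nonneg_measures X0" and \<mu>p: "\<mu>p \<in> nonneg_measures ({0..T} \<times> X)"
    and \<mu>: "\<mu> \<in> nonneg_measures ({0..T} \<times> X)"
    and poly: "\<And>p. (\<integral>z. peval p (space_time z) \<partial>\<mu>p) =
      (\<integral>x. peval p (space_time (0, x)) \<partial>\<mu>0) + (\<integral>z. peval (lie_poly f p) (space_time z) \<partial>\<mu>)"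
  shows "liouville T (field_eval f) X \<mu>0 \<mu>p \<mu>"
  unfolding liouville_def
proof (intro allI impI)
  fix U :: "(real \<times> (real ^ 'n)) set" and v
  assume U: "open U" "{0..T} \<times> X \<subseteq> U" and v: "C1_on U v"
  let ?K = "{0..T} \<times> X" and ?F = "field_eval f"
  have K: "compact ?K" using X by (auto intro: compact_Times)
  from v obtain v' where v': "\<And>z. z \<in> U \<Longrightarrow> (v has_derivative blinfun_apply (v' z)) (at z)" "continuous_on U v'"
    unfolding C1_on_def by blast
  \<comment> \<open>The direction in which the derivative of a test function is taken.\<close>
  define G where "G z = (1 :: real, ?F (fst z) (snd z))" for z
  have Gc: "continuous_on S G" for S
    unfolding G_def field_eval_def by (intro continuous_intros continuous_on_vec_lambda)
  obtain C where C: "\<And>z. z \<in> ?K \<Longrightarrow> norm (G z) \<le> C" and C0: "0 < C"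
    using compact_imp_bounded[OF compact_continuous_image[OF Gc K]] unfolding bounded_pos by auto
  have lie: "lie_derivative ?F u z = D (G z)" if "(u has_derivative D) (at z)" for u D z
    using lie_derivative_eq[of u D "fst z" "snd z" ?F] that by (simp add: G_def)
  have vc: "continuous_on U v"
    by (meson v'(1) has_derivative_continuous continuous_at_imp_continuous_on)
  have lvc: "continuous_on ?K (lie_derivative ?F v)"
  proof -
    have "continuous_on ?K (\<lambda>z. blinfun_apply (v' z) (G z))"
      by (intro continuous_intros continuous_on_subset[OF v'(2) U(2)] Gc)
    then show ?thesis
    proof (rule continuous_on_eq)
      fix z assume "z \<in> ?K"
      then show "blinfun_apply (v' z) (G z) = lie_derivative ?F v z"
        using lie[OF v'(1)] subsetD[OF U(2)] by simp
    qed
  qed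
  \<comment> \<open>The initial slice lies in the compact set on which the test function is
    approximated; this uses that \<open>X0\<close> is contained in \<open>X\<close>.\<close>
  have X0K: "(0, x) \<in> ?K" if "x \<in> X0" for x using that X T by auto
  have v0c: "continuous_on X0 (\<lambda>x. v (0, x))"
    by (rule continuous_on_compose2[OF continuous_on_subset[OF vc U(2)]]) (use X0K in \<open>auto intro!: continuous_intros\<close>)
  let ?L = "\<lambda>v. integral\<^sup>L \<mu>p v - (\<integral>x. v (0, x) \<partial>\<mu>0) - integral\<^sup>L \<mu> (lie_derivative ?F v)"
  \<comment> \<open>Collects the three errors: two integrals contribute their mass, the third its
    mass times the bound \<open>C\<close> on the direction. The summand 1 makes \<open>M\<close>
    positive.\<close>
  define M where "M = measure \<mu>p (space \<mu>p) + measure \<mu>0 (space \<mu>0) + C * measure \<mu> (space \<mu>) + 1"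
  have M: "0 < M" unfolding M_def using C0 by (intro add_nonneg_pos) auto
  have est: "\<bar>(\<integral>z. g z \<partial>\<nu>) - (\<integral>z. h z \<partial>\<nu>)\<bar> \<le> e * measure \<nu> (space \<nu>)"
    if \<nu>: "\<nu> \<in> nonneg_measures S" "compact S" "continuous_on S g" "continuous_on S h" and gh: "\<And>z. z \<in> S \<Longrightarrow> \<bar>g z - h z\<bar> \<le> e"
    for \<nu> :: "'x::topological_space measure" and S g h e
  proof -
    interpret finite_measure \<nu> using \<nu> by (simp add: nonneg_measures_def)
    show ?thesis
      using \<nu> gh by (intro integral_diff_bound nonneg_measures_integrable AE_I2) (auto simp: nonneg_measures_space)
  qed
  have "\<bar>?L v\<bar> \<le> 0 + e" if e: "0 < e" for e
  proof -
    have em: "0 < e / M" using e M by simp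
    obtain q q' where
      q: "real_polynomial_function q" "\<And>z. z \<in> ?K \<Longrightarrow> (q has_derivative q' z) (at z)"
      "\<And>z. z \<in> ?K \<Longrightarrow> \<bar>q z - v z\<bar> \<le> e / M" "\<And>z h. z \<in> ?K \<Longrightarrow> \<bar>q' z h - v' z h\<bar> \<le> e / M * norm h"
      by (rule C1_polynomial_approximation[OF v' K U(2,1) em, where thesis = thesis]) (assumption, rule that)
    have sti: "bounded_linear (space_time_inv :: real ^ ('n + 1) \<Rightarrow> _)"
      unfolding space_time_inv_def
      by (rule linear_conv_bounded_linear[THEN iffD1], intro linearI) (auto simp: vec_eq_iff)
    have "space_time_inv (space_time z) = z" for z :: "real \<times> (real ^ 'n)"
      by (simp add: space_time_inv_def prod_eq_iff)
    from real_polynomial_function_peval_linear_iso[OF q(1) sti this]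
    obtain p where p: "\<And>z. q z = peval p (space_time z)" by blast
    have q_eq: "q = (\<lambda>z. peval p (space_time z))" using p by auto
    have qc: "continuous_on S q" for S unfolding q_eq by (intro continuous_intros)
    have lq: "lie_derivative ?F q = (\<lambda>z. peval (lie_poly f p) (space_time z))"
      unfolding q_eq by (rule ext) (rule lie_derivative_peval)
    have lqc: "continuous_on S (lie_derivative ?F q)" for S unfolding lq by (intro continuous_intros)
    have q0c: "continuous_on X0 (\<lambda>x. q (0, x))"
      unfolding q_eq by (intro continuous_intros)
    have "?L q = 0" unfolding lq unfolding q_eq using poly[of p] by simp
    moreover have "\<bar>integral\<^sup>L \<mu>p v - integral\<^sup>L \<mu>p q\<bar> \<le> e / M * measure \<mu>p (space \<mu>p)"
      using q(3) by (intro est[OF \<mu>p K continuous_on_subset[OF vc U(2)] qc]) (simp add: abs_minus_commute)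
    moreover have "\<bar>(\<integral>x. v (0, x) \<partial>\<mu>0) - (\<integral>x. q (0, x) \<partial>\<mu>0)\<bar> \<le> e / M * measure \<mu>0 (space \<mu>0)"
      using q(3)[OF X0K] by (intro est[OF \<mu>0 X(3) v0c q0c]) (simp add: abs_minus_commute)
    moreover have "\<bar>integral\<^sup>L \<mu> (lie_derivative ?F v) - integral\<^sup>L \<mu> (lie_derivative ?F q)\<bar> \<le> e / M * C * measure \<mu> (space \<mu>)"
    proof (rule est[OF \<mu> K lvc lqc])
      fix z assume z: "z \<in> ?K"
      then have "z \<in> U" using U(2) by blast
      then have "\<bar>lie_derivative ?F v z - lie_derivative ?F q z\<bar> = \<bar>q' z (G z) - v' z (G z)\<bar>"
        using lie[OF v'(1)] lie[OF q(2)[OF z]] by (simp add: abs_minus_commute)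
      also have "\<dots> \<le> e / M * norm (G z)" by (rule q(4)[OF z])
      also have "\<dots> \<le> e / M * C" using em C[OF z] by (intro mult_left_mono) auto
      finally show "\<bar>lie_derivative ?F v z - lie_derivative ?F q z\<bar> \<le> e / M * C" .
    qed
    ultimately have "\<bar>?L v\<bar> \<le> e / M * measure \<mu>p (space \<mu>p) + e / M * measure \<mu>0 (space \<mu>0) + e / M * C * measure \<mu> (space \<mu>)"
      by linarith
    also have "\<dots> = e / M * (measure \<mu>p (space \<mu>p) + measure \<mu>0 (space \<mu>0) + C * measure \<mu> (space \<mu>))"
      by (simp only: distrib_left mult.assoc)
    also have "\<dots> \<le> e / M * M" using em by (intro mult_left_mono) (auto simp: M_def)
    finally show ?thesis using M by simp
  qed
  from field_le_epsilon[of "\<bar>?L v\<bar>" 0, OF this]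
  show "integral\<^sup>L \<mu>p v = (\<integral>x. v (0, x) \<partial>\<mu>0) + integral\<^sup>L \<mu> (lie_derivative ?F v)" by simp
qed

text \<open>The four functionals are represented independently of each other. What couples the
  measures has to be recovered from the linear relations between their moments.\<close>

lemma measure_feasible_of_lmi_limit:
  fixes f :: "'n::finite \<Rightarrow> ('n + 1) mpoly"
  assumes T: "0 \<le> T" and sub: "semialg g0 \<subseteq> semialg gX"
    and R: "coord_bounded g0 R" "coord_bounded gX R" "coord_bounded gU R" "T\<^sup>2 \<le> R"
    and cone: "square_cone g0 {p. 0 \<le> riesz l0 p}" "square_cone (prod_description gX (time_description T)) {p. 0 \<le> riesz lp p}"
      "square_cone (prod_description gX (time_description T)) {p. 0 \<le> riesz l p}" "square_cone (prod_description gX gU) {p. 0 \<le> riesz l\<eta> p}"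
    and marg: "\<And>\<alpha>. l\<eta> (join \<alpha> 0) = lp (join \<alpha> 0)" and liou: "\<And>\<alpha> \<beta>. liou f l0 lp l \<alpha> \<beta> = 0" and one: "l0 0 = 1"
  obtains \<mu>0 \<mu>p \<mu> \<eta> where "measure_feasible T (field_eval f) (semialg g0) (semialg gX) (semialg gU) \<mu>0 \<mu>p \<mu> \<eta>"
    "\<And>c. (\<integral>(x, y). peval c (join x y) \<partial>\<eta>) = riesz l\<eta> c"
proof -
  let ?X = "semialg gX" and ?TX = "{0..T} \<times> semialg gX" and ?XU = "semialg gX \<times> semialg gU"
  have RT: "coord_bounded (prod_description gX (time_description T)) R"
    by (intro coord_bounded_prod R coord_bounded_mono[OF coord_bounded_time R(4)])
  have RU: "coord_bounded (prod_description gX gU) R" by (intro coord_bounded_prod R)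
  note comp = compact_semialg[OF R(1)] compact_semialg[OF R(2)] compact_semialg[OF R(3)]
  have cTX: "compact ?TX" and cXU: "compact ?XU" using comp by (auto intro: compact_Times)
  obtain \<nu>0 where \<nu>0: "finite_measure \<nu>0" "sets \<nu>0 = sets borel" "AE x in \<nu>0. x \<in> semialg g0"
    "\<And>p. riesz l0 p = (\<integral>x. peval p x \<partial>\<nu>0)"
    by (rule moment_representation[OF linear_form_riesz R(1) cone(1)]) blast
  obtain \<nu>p where \<nu>p: "finite_measure \<nu>p" "sets \<nu>p = sets borel" "AE x in \<nu>p. x \<in> semialg (prod_description gX (time_description T))"
    "\<And>p. riesz lp p = (\<integral>x. peval p x \<partial>\<nu>p)"
    by (rule moment_representation[OF linear_form_riesz RT cone(2)]) blast
  obtain \<nu> where \<nu>: "finite_measure \<nu>" "sets \<nu> = sets borel" "AE x in \<nu>. x \<in> semialg (prod_description gX (time_description T))"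
    "\<And>p. riesz l p = (\<integral>x. peval p x \<partial>\<nu>)"
    by (rule moment_representation[OF linear_form_riesz RT cone(3)]) blast
  obtain \<nu>\<eta> where \<nu>\<eta>: "finite_measure \<nu>\<eta>" "sets \<nu>\<eta> = sets borel" "AE x in \<nu>\<eta>. x \<in> semialg (prod_description gX gU)"
    "\<And>p. riesz l\<eta> p = (\<integral>x. peval p x \<partial>\<nu>\<eta>)"
    by (rule moment_representation[OF linear_form_riesz RU cone(4)]) blast
  define split :: "real ^ ('n + 'n) \<Rightarrow> _" where "split w = ((\<chi> i. w $ Inl i), (\<chi> j. w $ Inr j))" for w
  have splitc: "continuous_on UNIV split" unfolding split_def by (intro continuous_intros)
  have join_split: "join (fst (split w)) (snd (split w)) = w" for w by (simp add: split_def join_eq)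
  have stc: "continuous_on UNIV (space_time_inv :: real ^ ('n + 1) \<Rightarrow> _)"
    by (intro continuous_on_space_time_inv continuous_on_id)
  have inTX: "space_time_inv w \<in> ?TX" if "w \<in> semialg (prod_description gX (time_description T))" for w
    using semialg_space_time[OF T, of "fst (space_time_inv w)" "snd (space_time_inv w)" gX] that by (simp add: mem_Times_iff)
  have inXU: "split w \<in> ?XU" if "w \<in> semialg (prod_description gX gU)" for w
    using semialg_prod_description[of "fst (split w)" "snd (split w)" gX gU] that by (simp add: join_split mem_Times_iff)
  have ae: "AE w in \<nu>p. space_time_inv w \<in> ?TX" "AE w in \<nu>. space_time_inv w \<in> ?TX" "AE w in \<nu>\<eta>. split w \<in> ?XU"
    using \<nu>p(3) \<nu>(3) \<nu>\<eta>(3) inTX inXU by (auto elim: eventually_mono)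
  define \<mu>0 where "\<mu>0 = restrict_space (distr \<nu>0 borel (\<lambda>x. x)) (semialg g0)"
  define \<mu>p where "\<mu>p = restrict_space (distr \<nu>p borel space_time_inv) ?TX"
  define \<mu> where "\<mu> = restrict_space (distr \<nu> borel space_time_inv) ?TX"
  define \<eta> where "\<eta> = restrict_space (distr \<nu>\<eta> borel split) ?XU"
  note t0 = restrict_distr_nonneg_measures[OF \<nu>0(1-3) continuous_on_id closed_semialg, folded \<mu>0_def]
  note tp = restrict_distr_nonneg_measures[OF \<nu>p(1,2) ae(1) stc compact_imp_closed[OF cTX], folded \<mu>p_def]
  note t = restrict_distr_nonneg_measures[OF \<nu>(1,2) ae(2) stc compact_imp_closed[OF cTX], folded \<mu>_def]
  note t\<eta> = restrict_distr_nonneg_measures[OF \<nu>\<eta>(1,2) ae(3) splitc compact_imp_closed[OF cXU], folded \<eta>_def]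
  have m0: "(\<integral>x. peval p x \<partial>\<mu>0) = riesz l0 p" for p
    using t0(2)[OF measurable_peval[OF continuous_on_id], of p] by (simp add: \<nu>0(4))
  have mp: "(\<integral>z. peval p (space_time z) \<partial>\<mu>p) = riesz lp p" for p
    using tp(2)[OF measurable_peval[OF continuous_on_space_time[OF continuous_on_id]], of p] by (simp add: \<nu>p(4))
  have m: "(\<integral>z. peval p (space_time z) \<partial>\<mu>) = riesz l p" for p
    using t(2)[OF measurable_peval[OF continuous_on_space_time[OF continuous_on_id]], of p] by (simp add: \<nu>(4))
  have m\<eta>: "(\<integral>z. peval p (join (fst z) (snd z)) \<partial>\<eta>) = riesz l\<eta> p" for p
    using t\<eta>(2)[OF measurable_peval[OF continuous_on_fst_snd_join], of p] by (simp add: \<nu>\<eta>(4) join_split)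
  \<comment> \<open>Both sides are linear in \<open>p\<close>, so the relations for monomials extend
    to all polynomials.\<close>
  have liou_poly: "riesz lp p = (\<integral>x. peval p (space_time (0, x)) \<partial>\<mu>0) + riesz l (lie_poly f p)" for p
  proof (induction p rule: poly_mapping_induct)
    case zero
    then show ?case by (simp add: lie_poly_def)
  next
    case (single_add \<gamma> a p)
    define \<alpha> :: "nat ^ 'n" where "\<alpha> = (\<chi> i. \<gamma> $ Inl i)"
    define \<beta> where "\<beta> = \<gamma> $ Inr 1"
    have \<gamma>: "\<gamma> = join \<alpha> (vec \<beta>)" by (simp add: \<alpha>_def \<beta>_def join_vec_eq)
    let ?b = "if \<beta> = 0 then 1 else 0 :: real"
    have "lp \<gamma> = l0 \<alpha> * ?b + riesz l (lie_poly f (monomial \<gamma>))"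
      using liou[of \<alpha> \<beta>] by (simp add: liou_def \<gamma>)
    moreover have "lie_poly f (single \<gamma> a) = pconst a * lie_poly f (monomial \<gamma>)"
      by (simp add: lie_poly_def monomial_def ppartial_single pconst_def mult_single distrib_left sum_distrib_left
          mult.left_commute mult.commute)
    moreover have "(\<integral>x. peval (single \<gamma> a + p) (space_time (0, x)) \<partial>\<mu>0) =
        a * ?b * l0 \<alpha> + (\<integral>x. peval p (space_time (0, x)) \<partial>\<mu>0)"
    proof -
      have "peval (single \<gamma> a) (space_time (0, x)) = a * ?b * peval (monomial \<alpha>) x" for x
        by (simp add: single_eq_pconst_mult peval_simps \<gamma> space_time_def mono_eval_join mono_eval_0_vec)
      moreover have "integrable \<mu>0 (peval (monomial \<alpha>))" "integrable \<mu>0 (\<lambda>x. peval p (space_time (0, x)))"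
        by (intro nonneg_measures_integrable[OF t0(1) comp(1)] continuous_intros)+
      ultimately show ?thesis by (simp add: peval_add m0)
    qed
    ultimately show ?case
      using single_add by (simp add: riesz_add lie_poly_add riesz_pconst_mult algebra_simps)
  qed
  have liouville: "liouville T (field_eval f) ?X \<mu>0 \<mu>p \<mu>"
    by (rule liouville_of_polynomials[OF comp(2) sub comp(1) T t0(1) tp(1) t(1)])
       (simp add: mp m liou_poly)
  \<comment> \<open>Polynomials in \<open>x\<close> alone integrate equally, and both marginals are
    carried by the compact set \<open>?X\<close>.\<close>
  have marginals: "distr \<eta> borel fst = distr \<mu>p borel snd"
  proof (rule finite_measure_eqI_polynomials[OF _ _ _ _ comp(2)])
    have f: "fst \<in> \<eta> \<rightarrow>\<^sub>M borel"
      by (rule nonneg_measures_measurable[OF t\<eta>(1)]) (intro continuous_intros)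
    have s: "snd \<in> \<mu>p \<rightarrow>\<^sub>M borel"
      by (rule nonneg_measures_measurable[OF tp(1)]) (intro continuous_intros)
    show "finite_measure (distr \<eta> borel fst)" "finite_measure (distr \<mu>p borel snd)"
      using t\<eta>(1) tp(1) f s by (auto simp: nonneg_measures_def intro: finite_measure.finite_measure_distr)
    show "sets (distr \<eta> borel fst) = sets borel" "sets (distr \<mu>p borel snd) = sets borel" by simp_all
    have Xb: "?X \<in> sets borel" using closed_semialg[of gX] by simp
    show "AE x in distr \<eta> borel fst. x \<in> ?X"
      using Xb by (subst AE_distr_iff[OF f]) (auto simp: nonneg_measures_space[OF t\<eta>(1)] intro!: AE_I2)
    show "AE x in distr \<mu>p borel snd. x \<in> ?X"
      using Xb by (subst AE_distr_iff[OF s]) (auto simp: nonneg_measures_space[OF tp(1)] intro!: AE_I2)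
    fix q :: "real ^ 'n \<Rightarrow> real" assume "real_polynomial_function q"
    then obtain p where q: "q = peval p" by (rule real_polynomial_function_peval)
    have qm: "peval p \<in> borel_measurable borel" using measurable_peval[OF continuous_on_id] .
    have emb: "riesz l\<eta> (embed_left p) = riesz lp (embed_left p)"
    proof (induction p rule: poly_mapping_induct)
      case (single_add \<alpha> a p)
      then show ?case by (simp add: embed_left_add riesz_add marg)
    qed simp
    have "(\<integral>x. q x \<partial>distr \<eta> borel fst) = (\<integral>z. peval (embed_left p) (join (fst z) (snd z)) \<partial>\<eta>)"
      unfolding q by (simp add: integral_distr[OF f qm])
    also have "\<dots> = (\<integral>z. peval (embed_left p) (space_time z) \<partial>\<mu>p)"
      by (simp only: m\<eta> mp emb)
    also have "\<dots> = (\<integral>x. q x \<partial>distr \<mu>p borel snd)"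
      unfolding q by (simp add: integral_distr[OF s qm] space_time_def)
    finally show "(\<integral>x. q x \<partial>distr \<eta> borel fst) = (\<integral>x. q x \<partial>distr \<mu>p borel snd)" .
  qed
  show thesis
  proof (rule that[of \<mu>0 \<mu>p \<mu> \<eta>])
    show "measure_feasible T (field_eval f) (semialg g0) ?X (semialg gU) \<mu>0 \<mu>p \<mu> \<eta>"
      unfolding measure_feasible_def using marginals liouville t0(1) tp(1) t(1) t\<eta>(1) m0[of 1] one by simp
    show "(\<integral>(x, y). peval c (join x y) \<partial>\<eta>) = riesz l\<eta> c" for c
      using m\<eta>[of c] by (simp add: split_def case_prod_unfold)
  qed
qed

text \<open>Normalizing \<open>m0\<close> bounds all four masses through the linear constraints, and
  each mass bounds the moments of its sequence. The limit of a common subsequence satisfies all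
  relations, since each of them holds from some order on.\<close>

lemma lmi_limit:
  fixes f :: "'n::finite \<Rightarrow> ('n + 1) mpoly"
  assumes T: "0 \<le> T" and sub: "semialg g0 \<subseteq> semialg gX"
    and R: "coord_bounded g0 R" "coord_bounded gX R" "coord_bounded gU R" "T\<^sup>2 \<le> R" "1 \<le> R"
    and feas: "\<And>d. lmi_feasible d T f g0 gX gU (m0 d) (mp d) (m d) (m\<eta> d)"
    and cost: "\<And>d. riesz (m\<eta> d) c \<le> r"
  obtains \<mu>0 \<mu>p \<mu> \<eta> where "measure_feasible T (field_eval f) (semialg g0) (semialg gX) (semialg gU) \<mu>0 \<mu>p \<mu> \<eta>"
    "(\<integral>(x, y). peval c (join x y) \<partial>\<eta>) \<le> r"
proof -
  let ?gT = "prod_description gX (time_description T)" and ?gU = "prod_description gX gU"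
  have RT: "coord_bounded ?gT R"
    by (intro coord_bounded_prod R coord_bounded_mono[OF coord_bounded_time R(4)])
  have RU: "coord_bounded ?gU R" by (intro coord_bounded_prod R)
  from feas have one: "m0 d 0 = 1" and psd0: "moment_psd d g0 (m0 d)" and psdp: "moment_psd d ?gT (mp d)"
    and psd: "moment_psd (d + field_half_deg f - 1) ?gT (m d)" and psd\<eta>: "moment_psd d ?gU (m\<eta> d)"
    and marg: "mdeg \<alpha> \<le> 2 * d \<Longrightarrow> m\<eta> d (join \<alpha> 0) = mp d (join \<alpha> 0)"
    and liou: "mdeg \<alpha> + \<beta> \<le> 2 * d \<Longrightarrow> Defs.liou f (m0 d) (mp d) (m d) \<alpha> \<beta> = 0" for d \<alpha> \<beta>
    by (auto simp: lmi_feasible_def)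
  have D: "filterlim (\<lambda>d. d) at_top sequentially" by (rule filterlim_ident)
  have D': "filterlim (\<lambda>d. d + field_half_deg f - 1) at_top sequentially"
    unfolding filterlim_at_top
  proof
    \<comment> \<open>The order falls short of \<open>d\<close> by 1 if \<open>f\<close> has degree
      0, hence the margin.\<close>
    fix Z show "\<forall>\<^sub>F d in sequentially. Z \<le> d + field_half_deg f - 1"
      using eventually_ge_at_top[of "Z + 1"] by eventually_elim simp
  qed
  \<comment> \<open>The Liouville relation for the monomial 1, whose Lie derivative is zero.\<close>
  have onep: "mp d 0 = 1" for d
  proof -
    have "lie_poly f (monomial (0 :: nat ^ ('n + 1))) = 0"
      by (simp add: lie_poly_def ppartial_single flip: single_one)
    then show ?thesis using liou[of 0 0 d] one[of d] by (simp add: Defs.liou_def vec_def zero_vec_def[symmetric])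
  qed
  have one\<eta>: "m\<eta> d 0 = 1" for d using marg[of 0 d] onep by simp
  define \<tau> :: "nat ^ ('n + 1)" where "\<tau> = axis (Inr 1) 1"
  \<comment> \<open>The Liouville relation for the monomial \<open>t\<close>: its Lie derivative is
    1 and its initial term is 0.\<close>
  have mass: "m d 0 = mp d \<tau>" if "1 \<le> d" for d
  proof -
    have \<tau>: "join 0 (vec 1) = \<tau>" unfolding \<tau>_def
      by (auto simp: vec_eq_iff join_def axis_def num1_eq1 split: sum.split)
    have "lie_poly f (monomial \<tau>) = 1"
      by (simp add: lie_poly_def monomial_def ppartial_single \<tau>_def axis_def)
    then show ?thesis using liou[of 0 1 d] that by (simp add: Defs.liou_def \<tau>[simplified])
  qed
  note b0 = eventually_moment_bound[OF psd0 D R(1,5)]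
  note bp = eventually_moment_bound[OF psdp D RT R(5)]
  note b = eventually_moment_bound[OF psd D' RT R(5)]
  note b\<eta> = eventually_moment_bound[OF psd\<eta> D RU R(5)]
  \<comment> \<open>The first time moment of \<open>mp\<close> is at most \<open>R\<close> because
    \<open>mp\<close> has mass 1; this is the extra factor.\<close>
  have bm: "\<forall>\<^sub>F d in sequentially. \<bar>m d \<alpha>\<bar> \<le> R ^ mdeg \<alpha> * R" for \<alpha>
    using b[of \<alpha>] bp[of \<tau>] eventually_ge_at_top[of 1]
  proof eventually_elim
    case (elim d)
    then have "m d 0 \<le> R" by (simp add: mass onep \<tau>_def)
    then have "R ^ mdeg \<alpha> * m d 0 \<le> R ^ mdeg \<alpha> * R" using R(5) by (intro mult_left_mono) auto
    then show ?case using elim by linarith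
  qed
  \<comment> \<open>The four sequences are merged over one countable index set, so that a single
    diagonal argument yields a common subsequence.\<close>
  define g :: "nat \<Rightarrow> (((nat ^ 'n) + (nat ^ ('n + 1))) + ((nat ^ ('n + 1)) + (nat ^ ('n + 'n)))) \<Rightarrow> real"
    where "g d = case_sum (case_sum (m0 d) (mp d)) (case_sum (m d) (m\<eta> d))" for d
  define B where "B = case_sum (case_sum (\<lambda>\<alpha> :: nat ^ 'n. R ^ mdeg \<alpha>) (\<lambda>\<alpha> :: nat ^ ('n + 1). R ^ mdeg \<alpha>))
      (case_sum (\<lambda>\<alpha> :: nat ^ ('n + 1). R ^ mdeg \<alpha> * R) (\<lambda>\<alpha> :: nat ^ ('n + 'n). R ^ mdeg \<alpha>))"
  have cnt: "countable (UNIV :: ('x + 'y) set)" if "countable (UNIV :: 'x set)" "countable (UNIV :: 'y set)"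
    using countable_Plus[OF that] by (simp add: UNIV_Plus_UNIV)
  have ev: "\<forall>\<^sub>F d in sequentially. \<bar>g d i\<bar> \<le> B i" for i
    using b0 bp bm b\<eta> unfolding g_def B_def one onep one\<eta> by (simp split: sum.split)
  have cU: "countable (UNIV :: (((nat ^ 'n) + (nat ^ ('n + 1))) + ((nat ^ ('n + 1)) + (nat ^ ('n + 'n)))) set)"
    by (intro cnt countable_multi_indices)
  obtain s l where s: "strict_mono s" and l: "\<And>i. (\<lambda>n. g (s n) i) \<longlonglongrightarrow> l i"
    by (rule diagonal_convergent_subsequence[where f = g and B = B, OF cU ev]) blast
  define l0 where "l0 \<alpha> = l (Inl (Inl \<alpha>))" for \<alpha>
  define lp where "lp \<alpha> = l (Inl (Inr \<alpha>))" for \<alpha>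
  define lm where "lm \<alpha> = l (Inr (Inl \<alpha>))" for \<alpha>
  define l\<eta> where "l\<eta> \<alpha> = l (Inr (Inr \<alpha>))" for \<alpha>
  have L0: "(\<lambda>n. m0 (s n) \<alpha>) \<longlonglongrightarrow> l0 \<alpha>" and Lp: "(\<lambda>n. mp (s n) \<gamma>) \<longlonglongrightarrow> lp \<gamma>"
    and Lm: "(\<lambda>n. m (s n) \<gamma>) \<longlonglongrightarrow> lm \<gamma>" and L\<eta>: "(\<lambda>n. m\<eta> (s n) \<delta>) \<longlonglongrightarrow> l\<eta> \<delta>" for \<alpha> \<gamma> \<delta>
    using l[of "Inl (Inl \<alpha>)"] l[of "Inl (Inr \<gamma>)"] l[of "Inr (Inl \<gamma>)"] l[of "Inr (Inr \<delta>)"]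
    by (simp_all add: g_def l0_def lp_def lm_def l\<eta>_def)
  have Ds: "filterlim s at_top sequentially" by (rule filterlim_subseq[OF s])
  have Ds': "filterlim (\<lambda>n. s n + field_half_deg f - 1) at_top sequentially"
    by (rule filterlim_compose[OF D' Ds])
  have ge: "\<forall>\<^sub>F n in sequentially. k \<le> s n" for k
    using Ds by (simp add: filterlim_at_top)
  have cone: "square_cone g0 {p. 0 \<le> riesz l0 p}" "square_cone ?gT {p. 0 \<le> riesz lp p}"
      "square_cone ?gT {p. 0 \<le> riesz lm p}" "square_cone ?gU {p. 0 \<le> riesz l\<eta> p}"
    using square_cone_limit[OF psd0 Ds sequentially_bot L0] square_cone_limit[OF psdp Ds sequentially_bot Lp]
      square_cone_limit[OF psd Ds' sequentially_bot Lm] square_cone_limit[OF psd\<eta> Ds sequentially_bot L\<eta>] by blast+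
  have marg': "l\<eta> (join \<alpha> 0) = lp (join \<alpha> 0)" for \<alpha>
  proof (rule tendsto_unique[OF sequentially_bot L\<eta>])
    have "\<forall>\<^sub>F n in sequentially. mp (s n) (join \<alpha> 0) = m\<eta> (s n) (join \<alpha> 0)"
      using ge[of "mdeg \<alpha>"] by eventually_elim (simp add: marg)
    then show "(\<lambda>n. m\<eta> (s n) (join \<alpha> 0)) \<longlonglongrightarrow> lp (join \<alpha> 0)"
      by (rule Lim_transform_eventually[OF Lp])
  qed
  have liou': "Defs.liou f l0 lp lm \<alpha> \<beta> = 0" for \<alpha> \<beta>
  proof (rule tendsto_unique[OF sequentially_bot])
    show "(\<lambda>n. Defs.liou f (m0 (s n)) (mp (s n)) (m (s n)) \<alpha> \<beta>) \<longlonglongrightarrow> Defs.liou f l0 lp lm \<alpha> \<beta>"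
      unfolding Defs.liou_def by (intro tendsto_intros L0 Lp tendsto_riesz Lm)
    have "\<forall>\<^sub>F n in sequentially. 0 = Defs.liou f (m0 (s n)) (mp (s n)) (m (s n)) \<alpha> \<beta>"
      using ge[of "mdeg \<alpha> + \<beta>"] by eventually_elim (simp add: liou)
    then show "(\<lambda>n. Defs.liou f (m0 (s n)) (mp (s n)) (m (s n)) \<alpha> \<beta>) \<longlonglongrightarrow> 0"
      by (rule Lim_transform_eventually[OF tendsto_const])
  qed
  have one': "l0 0 = 1" using L0[of 0] one by (simp add: LIMSEQ_const_iff)
  have cost': "riesz l\<eta> c \<le> r"
    by (rule LIMSEQ_le_const2[OF tendsto_riesz[OF L\<eta>]]) (use cost in auto)
  show thesis
  proof (rule measure_feasible_of_lmi_limit[OF T sub R(1-4) cone marg' liou' one'])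
    fix \<mu>0 \<mu>p \<mu> \<eta>
    assume "measure_feasible T (field_eval f) (semialg g0) (semialg gX) (semialg gU) \<mu>0 \<mu>p \<mu> \<eta>"
      "\<And>c. (\<integral>(x, y). peval c (join x y) \<partial>\<eta>) = riesz l\<eta> c"
    then show thesis using that cost' by simp
  qed
qed

theorem theorem4p1:
  fixes T :: real
    and c :: "('n::finite + 'n) mpoly"
    and f :: "'n \<Rightarrow> ('n + 1) mpoly"
    and g0 gX gU :: "'n mpoly list"
  assumes "0 \<le> T"
    and "semialg g0 \<subseteq> semialg gX" and "semialg gU \<subseteq> semialg gX"
    and "archimedean_description g0"
    and "archimedean_description gX"
    and "archimedean_description gU"
  shows "(\<forall>d. lmi_defined d T c f g0 gX gU \<longrightarrow>
            lmi_value d T c f g0 gX gU \<le> lmi_value (Suc d) T c f g0 gX gU \<and>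
            lmi_value d T c f g0 gX gU
              \<le> measure_value T (\<lambda>x y. peval c (join x y)) (field_eval f)
                  (semialg g0) (semialg gX) (semialg gU))
    \<and> (\<lambda>d. lmi_value d T c f g0 gX gU) \<longlonglongrightarrow>
        measure_value T (\<lambda>x y. peval c (join x y)) (field_eval f)
          (semialg g0) (semialg gX) (semialg gU)"
proof -
  obtain R0 RX RU where "coord_bounded g0 R0" "coord_bounded gX RX" "coord_bounded gU RU"
    using archimedean_coord_bounded assms(4-6) by metis
  \<comment> \<open>A common bound for the three descriptions; \<open>T\<^sup>2\<close> serves the
    time constraint and 1 the estimate of monomials.\<close>
  moreover define R where "R = Max {R0, RX, RU, T\<^sup>2, 1}"
  ultimately have R: "coord_bounded g0 R" "coord_bounded gX R" "coord_bounded gU R" "T\<^sup>2 \<le> R" "1 \<le> R"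
    by (auto intro: coord_bounded_mono)
  let ?v = "\<lambda>d. lmi_value d T c f g0 gX gU"
  let ?p = "measure_value T (\<lambda>x y. peval c (join x y)) (field_eval f) (semialg g0) (semialg gX) (semialg gU)"
  have mono: "?v d \<le> ?v (Suc d)" for d
    unfolding lmi_value_def
  proof (rule Inf_superset_mono, clarify)
    fix m0 mp m m\<eta> assume "lmi_feasible (Suc d) T f g0 gX gU m0 mp m m\<eta>"
    then have "lmi_feasible d T f g0 gX gU m0 mp m m\<eta>" by (rule lmi_feasible_mono) simp
    then show "\<exists>m0' mp' m' m\<eta>'. ereal (riesz m\<eta> c) = ereal (riesz m\<eta>' c) \<and>
        lmi_feasible d T f g0 gX gU m0' mp' m' m\<eta>'" by blast
  qed
  have below: "?v d \<le> ?p" for d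
    unfolding measure_value_def
  proof (rule Inf_greatest, clarify)
    fix \<mu>0 \<mu>p \<mu> \<eta>
    assume feas: "measure_feasible T (field_eval f) (semialg g0) (semialg gX) (semialg gU) \<mu>0 \<mu>p \<mu> \<eta>"
    note F = measure_feasible_imp_lmi_feasible[OF assms(1) R(1-3) feas]
    show "?v d \<le> ereal (\<integral>(x, y). peval c (join x y) \<partial>\<eta>)"
      unfolding lmi_value_def F(2)[symmetric] by (rule Inf_lower) (use F(1) in blast)
  qed
  have "incseq ?v" using mono by (rule incseq_SucI)
  then have "?v \<longlonglongrightarrow> (SUP d. ?v d)" by (rule LIMSEQ_SUP)
  moreover have "(SUP d. ?v d) = ?p"
  proof (rule antisym)
    show "(SUP d. ?v d) \<le> ?p" using below by (rule SUP_least)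
    show "?p \<le> (SUP d. ?v d)"
    proof (rule ccontr)
      assume "\<not> ?p \<le> (SUP d. ?v d)"
      \<comment> \<open>A real number between the two exists even if \<open>?p\<close> is infinite,
        so the case that no measures are feasible is covered: the limit then produces a feasible
        point.\<close>
      then obtain r :: real where r: "(SUP d. ?v d) < ereal r" "ereal r < ?p"
        using ereal_dense2 by (metis not_le)
      have "\<exists>m0 mp m m\<eta>. lmi_feasible d T f g0 gX gU m0 mp m m\<eta> \<and> riesz m\<eta> c \<le> r" for d
      proof -
        have "?v d < ereal r" using r(1) by (meson SUP_upper UNIV_I le_less_trans)
        then obtain m0 mp m m\<eta> where "lmi_feasible d T f g0 gX gU m0 mp m m\<eta>" "riesz m\<eta> c < r"
          unfolding lmi_value_def Inf_less_iff by auto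
        then show ?thesis using less_imp_le by blast
      qed
      then obtain m0 mp m m\<eta> where "\<And>d. lmi_feasible d T f g0 gX gU (m0 d) (mp d) (m d) (m\<eta> d)"
        "\<And>d. riesz (m\<eta> d) c \<le> r" by metis
      then obtain \<mu>0 \<mu>p \<mu> \<eta> where
        feas: "measure_feasible T (field_eval f) (semialg g0) (semialg gX) (semialg gU) \<mu>0 \<mu>p \<mu> \<eta>"
        and le: "(\<integral>(x, y). peval c (join x y) \<partial>\<eta>) \<le> r"
        by (rule lmi_limit[OF assms(1,2) R])
      have "?p \<le> ereal (\<integral>(x, y). peval c (join x y) \<partial>\<eta>)"
        unfolding measure_value_def by (rule Inf_lower) (use feas in blast)
      also have "\<dots> \<le> ereal r" using le by simp
      finally show False using r(2) by simp
    qed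
  qed
  ultimately show ?thesis using mono below by auto
qed

end
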